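(* Assume $\mathrm{Im}(\tau)>0$. Then: (i) For $z\in\mathcal P(\tau)$, $F(z;\tau)=\frac{i}{\tau}F\left(\frac{iz}{\tau};-\frac1\tau\right)$. (ii) For $z\in\mathcal S(\tau)$ and every integer $n\ge2$, $F(z;n\tau)=\frac1n\sum_{k=0}^{n-1}F\left(\frac1n(z+\pi i(n-2k-1));\tau\right)$. (iii) For $z\in\mathcal P(\tau)$ and $0<\epsilon<\min\left(\frac\pi2,\mathrm{Im}\left(-\frac{\pi}{2\tau}\right)\right)$, $$F(z;\tau)=\frac12\int_{\mathbb R+i\epsilon}\frac{e^{izx/\pi}}{\sinh(x)\sinh(i\tau x)}\,dx.$$ (iv) For $z\in\mathcal S(\tau)\cap(-\mathcal S(\tau))$, $F(z;\tau)=F(-z;\tau)-\frac{iz}{\tau}$. (v) Assume $\mathrm{Re}(\tau)\ne0$ and define $\delta=\mathrm{sign}(\mathrm{Re}(\tau))$. For $z\in\mathcal S(\tau)$, $$F(z;\tau)=\delta\sum_{k\ge0}\left[\frac{2\pi i}{1+\exp\left(z+2\pi\delta(k+\frac12)\tau\right)}+\frac{2\pi\tau^{-1}}{1+\exp\left(\frac{iz}{\tau}+\frac{2\pi\delta}{\tau}(k+\frac12)\right)}\right].$$ (vi) Assume $\mathrm{Re}(\tau)\neq0$. For $z\in\mathcal S(\tau)\cap\{z:\mathrm{Re}(z)>0\}$, $$F(z;\tau)=-\pi i\sum_{k\ge1}(-1)^k\left[\frac{e^{-kz}}{\sinh(\pi k\tau)}-\frac{i}{\tau}\frac{e^{-ikz/\tau}}{\sinh(\pi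 k/\tau)}\right].$$
   Context: For $\mathrm{Im}(\tau)>0$ define $\mathcal S(\tau)=\{z\in\mathbb C:|\mathrm{Re}(z\bar\tau)|<\pi\,\mathrm{Im}(\tau)\}$ and $\mathcal P(\tau)=\mathcal S(\tau)\cap\{z\in\mathbb C:|\mathrm{Im}(z)|<\pi\,\mathrm{Im}(\tau)\}$. For $z\in\mathcal S(\tau)$ define $F(z;\tau)=\int_{\mathbb R}\frac{dx}{(1+e^{z+i\tau x})(1+e^{x})}$ (an absolutely convergent integral).
   Formalization: In (v) some z in S(τ) make a denominator vanish (e.g. τ=1/10+i, z=πi−πτ, k=0), so the series is undefined there; equality is stated for z where no denominator vanishes, and at every z in S(τ) the right-hand side is shown to tend to F(z;τ). *)

theory Defs
  imports "HOL-Analysis.Analysis"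
begin

definition stripS :: "complex \<Rightarrow> complex set" where
  "stripS \<tau> = {z. \<bar>Re (z * cnj \<tau>)\<bar> < pi * Im \<tau>}"

definition regionP :: "complex \<Rightarrow> complex set" where
  "regionP \<tau> = stripS \<tau> \<inter> {z. \<bar>Im z\<bar> < pi * Im \<tau>}"

text \<open>Meaningful for \<open>Im \<tau> > 0\<close> and \<open>z \<in> stripS \<tau>\<close>: there the denominator has
  no real zero and the integral converges absolutely.\<close>

definition F_int :: "complex \<Rightarrow> complex \<Rightarrow> complex" where
  "F_int z \<tau> =
     (LBINT x. 1 / ((1 + exp (z + \<i> * \<tau> * complex_of_real x)) * (1 + exp (complex_of_real x))))"

definition residue_exp1 :: "complex \<Rightarrow> complex \<Rightarrow> nat \<Rightarrow> complex" where
  "residue_exp1 \<tau> z k =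
     exp (z + 2 * of_real pi * of_real (sgn (Re \<tau>)) * (of_nat k + 1/2) * \<tau>)"

definition residue_exp2 :: "complex \<Rightarrow> complex \<Rightarrow> nat \<Rightarrow> complex" where
  "residue_exp2 \<tau> z k =
     exp (\<i> * z / \<tau> + 2 * of_real pi * of_real (sgn (Re \<tau>)) / \<tau> * (of_nat k + 1/2))"

text \<open>For some \<open>z \<in> stripS \<tau>\<close> (e.g. \<open>z = \<pi> \<i> - \<pi> \<tau>\<close> with \<open>\<tau> = 1/10 + \<i>\<close>) a denominator
  below vanishes, and HOL division makes the quotient \<open>0\<close>. Such \<open>z\<close> are removable
  singularities of the series: each pole of a first summand is cancelled by a pole of a second
  summand, in general with a different index.\<close>

definition residue_term :: "complex \<Rightarrow> complex \<Rightarrow> nat \<Rightarrow> complex" where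
  "residue_term \<tau> z k =
     2 * of_real pi * \<i> / (1 + residue_exp1 \<tau> z k)
     + (2 * of_real pi * inverse \<tau>) / (1 + residue_exp2 \<tau> z k)"

definition residue_regular :: "complex \<Rightarrow> complex \<Rightarrow> bool" where
  "residue_regular \<tau> z \<longleftrightarrow>
     (\<forall>k. 1 + residue_exp1 \<tau> z k \<noteq> 0 \<and> 1 + residue_exp2 \<tau> z k \<noteq> 0)"

definition lambert_term :: "complex \<Rightarrow> complex \<Rightarrow> nat \<Rightarrow> complex" where
  "lambert_term \<tau> z k =
     (-1) ^ k * (exp (- (of_nat k * z)) / sinh (of_real pi * of_nat k * \<tau>)
       - \<i> / \<tau> * (exp (- (\<i> * of_nat k * z / \<tau>)) / sinh (of_real pi * of_nat k / \<tau>)))"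

definition sinh_integrand :: "complex \<Rightarrow> complex \<Rightarrow> complex \<Rightarrow> complex" where
  "sinh_integrand \<tau> z x = exp (\<i> * z * x / of_real pi) / (sinh x * sinh (\<i> * \<tau> * x))"

end

theory Submission
  imports
    Defs
    "HOL-Probability.Sinc_Integral"
    "HOL-Complex_Analysis.Complex_Analysis"
    "HOL-Real_Asymp.Real_Asymp"
begin

text \<open>
  The proof rests on two principles.

  Analytic continuation in both variables. The integrand of \<open>F_int\<close> decays exponentially, locally
  uniformly in \<open>(z, \<tau>)\<close>, so \<open>F_int\<close> is holomorphic in each variable. An identity between
  holomorphic functions of \<open>(z, \<tau>)\<close> therefore holds everywhere once it holds for real \<open>z\<close> and
  \<open>\<tau> = \<i> b\<close> with \<open>b > 0\<close>: continue first in \<open>\<tau>\<close> with a real \<open>z\<close> fixed, where the admissible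
  \<open>\<tau>\<close> form a convex cone, then in \<open>z\<close> with \<open>\<tau>\<close> fixed (\<open>identity_by_two_continuations\<close>). In
  the real case the integral is a convolution of two Fermi functions \<open>1 / (1 + exp x)\<close>, and (i) is
  a linear substitution, (iv) follows by integrating an explicit derivative, and (iii) results from
  inserting the Fourier integral of one of the two factors and exchanging the integrations. Part (ii) is a partial fraction decomposition of
  the integrand at the roots of \<open>X ^ n = -1\<close>.

  Translation of the contour by periods. Moving the real line down by \<open>2 \<pi> N\<close> leaves the factor
  \<open>1 + exp x\<close> unchanged and replaces \<open>z\<close> by \<open>z + 2 \<pi> N \<tau>\<close>, which may be corrected by an integral
  multiple of \<open>2 \<pi> \<i>\<close> to return to the strip. The residues passed on the way are the terms of
  the series in (v), by \<open>strip_residue_theorem\<close>; thus \<open>F_int z \<tau>\<close> is a partial sum of that series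
  plus \<open>F_int Z \<tau>\<close> for a point \<open>Z\<close> of the strip with large real part (\<open>F_int_shift_finite\<close>). If
  \<open>Z\<close> stays away from the boundary of the strip, the remainder tends to \<open>0\<close>. That this
  can be arranged for infinitely many \<open>N\<close> is a fact on rotations of the circle
  (\<open>rotation_avoids_half_integers\<close>). The case \<open>Re \<tau> < 0\<close> follows by complex conjugation.
  Since \<open>F_int\<close> is continuous and the exceptional points are isolated, the limit formulation at
  arbitrary points of the strip follows as well.

  For \<open>Re z > 0\<close> all exponentials in the denominators of (v) have modulus larger than \<open>1\<close>; expanding
  each term into a geometric series and summing over \<open>k\<close> first gives the Lambert series (vi).
\<close>

section \<open>Holomorphic dependence of integrals on a parameter\<close>

lemma integrable_exp_minus_abs:
  fixes m :: real
  assumes "m > 0"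
  shows "integrable lborel (\<lambda>x::real. exp (- (m * \<bar>x\<bar>)))"
proof -
  have 1: "integrable lborel (\<lambda>x::real. indicator {0<..} x * exp (- (x * m)))"
    using integrable_I0i_exp_mscale[OF assms] by (simp add: set_integrable_def)
  have 2: "integrable lborel (\<lambda>x::real. indicator {0<..} (-x) * exp (- (-x * m)))"
    using lborel_integrable_real_affine[OF 1, of "-1" 0] by simp
  show ?thesis
  proof (rule Bochner_Integration.integrable_bound[OF Bochner_Integration.integrable_add[OF 1 2]])
    show "AE x in lborel. norm (exp (- (m * \<bar>x\<bar>)))
            \<le> norm (indicator {0<..} x * exp (- (x * m)) + indicator {0<..} (-x) * exp (- (-x * m)))"
      by (rule AE_mp[OF AE_lborel_singleton[of 0]]) (auto simp: indicator_def mult.commute)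
  qed auto
qed

text \<open>Differentiation under the integral. A local bound on \<open>f\<close> alone suffices: Cauchy's inequality turns
  it into a bound on the derivative, hence on the difference quotients, and dominated convergence
  applies.\<close>

lemma holomorphic_parametric_integral:
  fixes f :: "complex \<Rightarrow> 'a \<Rightarrow> complex"
  assumes "open S"
    and meas: "\<And>w. w \<in> S \<Longrightarrow> f w \<in> borel_measurable M"
    and holo: "\<And>x. (\<lambda>w. f w x) holomorphic_on S"
    and dom: "\<And>w\<^sub>0. w\<^sub>0 \<in> S \<Longrightarrow>
      \<exists>r>0. \<exists>g. integrable M g \<and> (\<forall>w\<in>S. dist w w\<^sub>0 < r \<longrightarrow> (\<forall>x. norm (f w x) \<le> g x))"
  shows "(\<lambda>w. integral\<^sup>L M (f w)) holomorphic_on S"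
proof -
  have int: "integrable M (f w)" if w: "w \<in> S" for w
  proof -
    obtain r g where r: "r > 0" and g: "integrable M g"
      and gb: "\<forall>v\<in>S. dist v w < r \<longrightarrow> (\<forall>x. norm (f v x) \<le> g x)"
      using dom[OF w] by blast
    have "norm (f w x) \<le> norm (g x)" for x
      using gb[rule_format, of w x] w r by simp
    then show ?thesis
      by (intro Bochner_Integration.integrable_bound[OF g meas[OF w]] AE_I2)
  qed
  have "\<exists>D. ((\<lambda>w. integral\<^sup>L M (f w)) has_field_derivative D) (at w\<^sub>0)" if w0: "w\<^sub>0 \<in> S" for w\<^sub>0
  proof -
    obtain r1 g where r1: "r1 > 0" and g: "integrable M g"
      and gb: "\<forall>w\<in>S. dist w w\<^sub>0 < r1 \<longrightarrow> (\<forall>x. norm (f w x) \<le> g x)"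
      using dom[OF w0] by blast
    obtain r2 where r2: "r2 > 0" "cball w\<^sub>0 r2 \<subseteq> S"
      using \<open>open S\<close> w0 open_contains_cball by blast
    define r where "r = min (r1/2) r2"
    have r: "r > 0" "cball w\<^sub>0 r \<subseteq> S" using r1 r2 by (auto simp: r_def)
    have bnd: "norm (f w x) \<le> g x" if "w \<in> cball w\<^sub>0 r" for w x
      using gb that r r1 by (auto simp: r_def dist_commute subset_iff)
    have lip: "norm (f w x - f w\<^sub>0 x) \<le> (2 * g x / r) * norm (w - w\<^sub>0)"
      if w: "w \<in> cball w\<^sub>0 (r/2)" for w x
    proof (rule field_differentiable_bound[of "cball w\<^sub>0 (r/2)" "\<lambda>w. f w x" "deriv (\<lambda>w. f w x)"])
      fix v assume v: "v \<in> cball w\<^sub>0 (r/2)"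
      then have vS: "cball v (r/2) \<subseteq> cball w\<^sub>0 r"
        by (smt (verit) dist_triangle mem_cball subsetI field_sum_of_halves)
      with r have vS': "cball v (r/2) \<subseteq> S" by blast
      have "v \<in> S" using vS' r by auto
      then show "((\<lambda>w. f w x) has_field_derivative deriv (\<lambda>w. f w x) v) (at v within cball w\<^sub>0 (r/2))"
        using holo[of x] \<open>open S\<close> holomorphic_derivI by blast
      have "norm ((deriv ^^ 1) (\<lambda>w. f w x) v) \<le> fact 1 * g x / (r/2) ^ 1"
      proof (rule Cauchy_inequality)
        show "(\<lambda>w. f w x) holomorphic_on ball v (r/2)"
          using vS' ball_subset_cball by (intro holomorphic_on_subset[OF holo[of x]]) blast
        show "continuous_on (cball v (r/2)) (\<lambda>w. f w x)"
          using vS' by (intro holomorphic_on_imp_continuous_on holomorphic_on_subset[OF holo[of x]])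
        show "norm (f y x) \<le> g x" if "norm (v - y) = r/2" for y
          using vS that by (intro bnd) (auto simp: subset_iff dist_norm)
      qed (use r in auto)
      then show "norm (deriv (\<lambda>w. f w x) v) \<le> 2 * g x / r" by (simp add: mult.commute)
    qed (use w r in auto)
    define D where "D = (\<lambda>x. deriv (\<lambda>w. f w x) w\<^sub>0)"
    have lim: "((\<lambda>w. (f w x - f w\<^sub>0 x) / (w - w\<^sub>0)) \<longlongrightarrow> D x) (at w\<^sub>0)" for x
      using holomorphic_derivI[OF holo[of x] \<open>open S\<close> w0, of UNIV]
      unfolding D_def has_field_derivative_iff .
    have "((\<lambda>w. (integral\<^sup>L M (f w) - integral\<^sup>L M (f w\<^sub>0)) / (w - w\<^sub>0)) \<longlongrightarrow> integral\<^sup>L M D) (at w\<^sub>0)"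
      unfolding tendsto_at_iff_sequentially comp_def
    proof (intro allI impI)
      fix X assume X: "\<forall>i. X i \<in> UNIV - {w\<^sub>0}" "X \<longlonglongrightarrow> w\<^sub>0"
      have "eventually (\<lambda>i. X i \<in> cball w\<^sub>0 (r/2)) sequentially"
        using X(2) r unfolding tendsto_iff
        by (auto simp: dist_commute elim!: allE[of _ "r/2"] eventually_mono)
      then obtain N where N: "\<And>i. i \<ge> N \<Longrightarrow> X i \<in> cball w\<^sub>0 (r/2)"
        by (auto simp: eventually_sequentially)
      define Y where "Y = (\<lambda>i. X (i + N))"
      have Y: "\<And>i. Y i \<noteq> w\<^sub>0" "\<And>i. Y i \<in> cball w\<^sub>0 (r/2)" "Y \<longlonglongrightarrow> w\<^sub>0"
        using X N by (auto simp: Y_def LIMSEQ_ignore_initial_segment)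
      have YS: "Y i \<in> S" for i
        using Y(2)[of i] r by (auto simp: subset_iff)
      let ?q = "\<lambda>i x. (f (Y i) x - f w\<^sub>0 x) / (Y i - w\<^sub>0)"
      have ql: "(\<lambda>i. ?q i x) \<longlonglongrightarrow> D x" for x
        using lim[of x] Y unfolding tendsto_at_iff_sequentially comp_def by blast
      have qm: "?q i \<in> borel_measurable M" for i
        using meas[OF YS[of i]] meas[OF w0] by measurable
      have L: "(\<lambda>i. integral\<^sup>L M (?q i)) \<longlonglongrightarrow> integral\<^sup>L M D"
      proof (rule integral_dominated_convergence[where w = "\<lambda>x. 2 * g x / r"])
        show "D \<in> borel_measurable M"
          by (rule borel_measurable_LIMSEQ_metric[OF qm]) (rule ql)
        show "integrable M (\<lambda>x. 2 * g x / r)" using g by simp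
        show "AE x in M. norm (?q i x) \<le> 2 * g x / r" for i
          using lip[OF Y(2)[of i]] Y(1)[of i] by (auto simp: norm_divide pos_divide_le_eq)
      qed (use qm ql in auto)
      have "(\<lambda>i. integral\<^sup>L M (?q i)) = (\<lambda>i. (integral\<^sup>L M (f (Y i)) - integral\<^sup>L M (f w\<^sub>0)) / (Y i - w\<^sub>0))"
        using int[OF YS] int[OF w0] by (intro ext) simp
      from L[unfolded this]
      have "(\<lambda>i. (integral\<^sup>L M (f (X (i+N))) - integral\<^sup>L M (f w\<^sub>0)) / (X (i+N) - w\<^sub>0)) \<longlonglongrightarrow> integral\<^sup>L M D"
        unfolding Y_def .
      then show "(\<lambda>i. (integral\<^sup>L M (f (X i)) - integral\<^sup>L M (f w\<^sub>0)) / (X i - w\<^sub>0)) \<longlonglongrightarrow> integral\<^sup>L M D"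
        by (rule LIMSEQ_offset)
    qed
    then show ?thesis by (auto simp: has_field_derivative_iff)
  qed
  then show ?thesis
    using \<open>open S\<close> by (auto simp: holomorphic_on_open)
qed

section \<open>The domain of the integral and its dependence on the parameters\<close>

lemma exp_eq_minus_one_iff: "exp x = - 1 \<longleftrightarrow> (\<exists>n::int. x = \<i> * of_real pi * of_int (2 * n + 1))"
proof -
  have "exp x = - 1 \<longleftrightarrow> exp x = exp (\<i> * of_real pi)" by simp
  also have "\<dots> \<longleftrightarrow> (\<exists>n::int. x = \<i> * of_real pi + (of_int (2 * n) * pi) * \<i>)"
    by (rule exp_eq)
  also have "\<dots> \<longleftrightarrow> (\<exists>n::int. x = \<i> * of_real pi * of_int (2 * n + 1))"
    by (simp add: algebra_simps)
  finally show ?thesis .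
qed

text \<open>The zeros of \<open>1 + exp w\<close> are the odd multiples of \<open>\<i> \<pi>\<close>. The closed strip around the origin
  bounded by lines of slope \<open>- \<alpha>\<close> and described by the second hypothesis avoids them, and there
  \<open>1 + exp w\<close> is as large as \<open>1 + exp (Re w)\<close> up to a constant that depends only on the distance
  \<open>\<kappa>\<close> and on a bound for the slope. This uniformity gives all domination estimates below.
  If \<open>Re w\<close> is small, the angle \<open>Im w\<close> stays away from \<open>\<pi>\<close>; if it is large, the
  moduli of the two summands differ.\<close>

lemma one_plus_exp_lower_bound:
  fixes \<kappa> A :: real
  assumes "0 < \<kappa>" "0 \<le> A"
  obtains c where "c > 0"
    "\<And>w \<alpha>. \<bar>\<alpha>\<bar> \<le> A \<Longrightarrow> \<bar>Im w + \<alpha> * Re w\<bar> \<le> pi - \<kappa> \<Longrightarrow> c * (1 + exp (Re w)) \<le> norm (1 + exp w)"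
proof -
  define \<eta> where "\<eta> = \<kappa> / (2 * (A + 1))"
  have \<eta>: "\<eta> > 0" "A * \<eta> \<le> \<kappa> / 2"
    using assms by (auto simp: \<eta>_def field_simps)
  \<comment> \<open>For \<open>\<bar>Re w\<bar> \<le> \<eta>\<close> the angle satisfies \<open>\<bar>Im w\<bar> \<le> \<pi> - \<kappa> / 2\<close>, and \<open>c1\<^sup>2 = (1 + cos (\<pi> - \<kappa> / 2)) / 2\<close>.\<close>
  define c1 where "c1 = sin (\<kappa> / 4)"
  define c2 where "c2 = (1 - exp (- \<eta>)) / 2"
  have c2': "2 * c2 = 1 - exp (- \<eta>)" by (simp add: c2_def)
  have c2: "c2 > 0" using \<eta> by (simp add: c2_def)
  show thesis
  proof (cases "\<kappa> \<le> pi")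
    case False
    then show thesis using that[of 1] by (auto simp: abs_if split: if_splits)
  next
    case True
    have c1: "c1 > 0" unfolding c1_def using assms True by (intro sin_gt_zero) auto
    show thesis
    proof (rule that[of "min c1 c2"])
      fix w :: complex and \<alpha> :: real
      assume \<alpha>: "\<bar>\<alpha>\<bar> \<le> A" and w: "\<bar>Im w + \<alpha> * Re w\<bar> \<le> pi - \<kappa>"
      define u v where "u = Re w" and "v = Im w"
      have nrm: "(norm (1 + exp w))\<^sup>2 = (1 + exp u)\<^sup>2 - 2 * exp u * (1 - cos v)"
      proof -
        have "(norm (1 + exp w))\<^sup>2 = (1 + exp u * cos v)\<^sup>2 + (exp u * sin v)\<^sup>2"
          by (simp add: cmod_power2 u_def v_def Re_exp Im_exp)
        also have "\<dots> = 1 + 2 * exp u * cos v + (exp u)\<^sup>2 * ((sin v)\<^sup>2 + (cos v)\<^sup>2)"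
          by algebra
        finally show ?thesis
          unfolding sin_cos_squared_add by (simp add: power2_eq_square algebra_simps)
      qed
      have "c1 * (1 + exp u) \<le> norm (1 + exp w)" if u: "\<bar>u\<bar> \<le> \<eta>"
      proof -
        have "\<bar>\<alpha> * u\<bar> \<le> A * \<eta>"
          using \<alpha> u assms by (simp add: abs_mult mult_mono)
        then have v: "\<bar>v\<bar> \<le> pi - \<kappa> / 2"
          using w \<eta> by (simp add: u_def v_def)
        have "cos (pi - \<kappa> / 2) \<le> cos \<bar>v\<bar>"
          using v assms by (intro cos_monotone_0_pi_le) auto
        then have "- cos (\<kappa> / 2) \<le> cos v" by simp
        moreover have "cos (\<kappa> / 2) = 1 - 2 * c1\<^sup>2"
          using cos_double_sin[of "\<kappa>/4"] by (simp add: c1_def)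
        ultimately have cv: "1 - cos v \<le> 2 * (1 - c1\<^sup>2)" by simp
        have e: "4 * exp u \<le> (1 + exp u)\<^sup>2"
          using zero_le_power2[of "1 - exp u"] by (simp add: power2_eq_square algebra_simps)
        have "2 * exp u * (1 - cos v) \<le> 2 * exp u * (2 * (1 - c1\<^sup>2))"
          using cv by (intro mult_left_mono) auto
        also have "\<dots> = 4 * exp u * (1 - c1\<^sup>2)" by simp
        also have "\<dots> \<le> (1 + exp u)\<^sup>2 * (1 - c1\<^sup>2)"
        proof (rule mult_right_mono[OF e])
          show "0 \<le> 1 - c1\<^sup>2" by (simp add: c1_def abs_square_le_1 power2_eq_1_iff)
        qed
        finally have "(c1 * (1 + exp u))\<^sup>2 \<le> (norm (1 + exp w))\<^sup>2"
          unfolding nrm power_mult_distrib by (simp add: algebra_simps)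
        then show ?thesis by (rule power2_le_imp_le) simp
      qed
      moreover have "c2 * (1 + exp u) \<le> norm (1 + exp w)" if u: "\<bar>u\<bar> > \<eta>"
      proof -
        have "c2 * (1 + exp u) \<le> \<bar>exp u - 1\<bar>"
        proof (cases "u > 0")
          case True
          then have "exp (-u) \<le> exp (-\<eta>)" using u by simp
          then have "exp u * (1 - exp (-\<eta>)) \<le> exp u * (1 - exp (-u))" by simp
          also have "\<dots> = exp u - 1" by (simp add: algebra_simps exp_minus)
          finally have "2 * c2 * exp u \<le> exp u - 1" unfolding c2' by (simp add: mult.commute)
          moreover have "c2 * 1 \<le> c2 * exp u" using c2 True by (intro mult_left_mono) auto
          ultimately show ?thesis using True by (simp add: algebra_simps)
        next
          case False
          then have "exp u \<le> exp (-\<eta>)" using u by simp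
          then have "2 * c2 \<le> 1 - exp u" by (simp add: c2_def)
          moreover have "c2 * exp u \<le> c2 * 1" using c2 False by (intro mult_left_mono) auto
          ultimately show ?thesis using False by (simp add: algebra_simps)
        qed
        also have "\<dots> \<le> norm (1 + exp w)"
          using norm_triangle_ineq3[of "exp w" "-1"] by (simp add: u_def add.commute)
        finally show ?thesis .
      qed
      moreover have "min c1 c2 * (1 + exp u) \<le> c1 * (1 + exp u)"
          "min c1 c2 * (1 + exp u) \<le> c2 * (1 + exp u)"
        by (auto intro!: mult_right_mono add_nonneg_nonneg)
      ultimately show "min c1 c2 * (1 + exp (Re w)) \<le> norm (1 + exp w)"
        unfolding u_def[symmetric] by (meson not_le order_trans)
    qed (use c1 c2 in auto)
  qed
qed

text \<open>Far from the imaginary axis the estimate of \<open>one_plus_exp_lower_bound\<close> holds for every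
  imaginary part; this controls the vertical sides of rectangular contours.\<close>

lemma one_plus_exp_ge_far:
  assumes "\<bar>Re x\<bar> \<ge> 1"
  shows "1 + exp (Re x) \<le> 4 * norm (1 + exp x)"
proof -
  have e2: "exp 1 \<ge> (2::real)" using exp_ge_add_one_self[of 1] by simp
  have "1 + exp (Re x) \<le> 4 * \<bar>exp (Re x) - 1\<bar>"
  proof (cases "Re x \<ge> 0")
    case True
    then have "exp 1 \<le> exp (Re x)" using assms by simp
    then have "exp (Re x) \<ge> 2" using e2 by linarith
    then have "1 + exp (Re x) \<le> 4 * (exp (Re x) - 1)" by simp
    also have "\<dots> \<le> 4 * \<bar>exp (Re x) - 1\<bar>" by (intro mult_left_mono abs_ge_self) auto
    finally show ?thesis .
  next
    case False
    then have "exp (Re x) \<le> exp (- 1)" using assms by simp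
    also have "\<dots> \<le> 1 / 2" using e2 by (simp add: exp_minus field_simps)
    finally have "1 + exp (Re x) \<le> 4 * (1 - exp (Re x))" by simp
    also have "1 - exp (Re x) \<le> \<bar>exp (Re x) - 1\<bar>"
      by (metis abs_ge_minus_self minus_diff_eq)
    finally show ?thesis by simp
  qed
  also have "\<bar>exp (Re x) - 1\<bar> \<le> norm (1 + exp x)"
    using norm_triangle_ineq3[of "exp x" "-1"] by (simp add: add.commute)
  finally show ?thesis by simp
qed

lemma norm_one_plus_exp_of_real: "norm (1 + exp (complex_of_real t)) = 1 + exp t"
proof -
  have "1 + exp (complex_of_real t) = complex_of_real (1 + exp t)" by (simp add: exp_of_real)
  then show ?thesis by (metis norm_of_real abs_of_pos add_pos_pos exp_gt_zero zero_less_one)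
qed

lemma one_plus_exp_of_real_nonzero: "1 + exp (complex_of_real t) \<noteq> 0"
  using norm_one_plus_exp_of_real[of t] add_pos_pos[OF zero_less_one exp_gt_zero[of t]] by auto

lemma fermi_product_lower_bound:
  fixes m b M x :: real
  assumes "0 < m" "m \<le> 1" "m \<le> b" "0 \<le> M"
  shows "exp (m * \<bar>x\<bar> - M) \<le> (1 + exp (- M - b * x)) * (1 + exp x)"
proof (cases "x \<ge> 0")
  case True
  have "m * x - M \<le> x" using assms True by (smt (verit) mult_left_le_one_le mult_right_mono)
  then have "exp (m * \<bar>x\<bar> - M) \<le> exp x" using True by simp
  also have "\<dots> \<le> (1 + exp (- M - b * x)) * (1 + exp x)" by (simp add: algebra_simps add_nonneg_nonneg)
  finally show ?thesis .
next
  case False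
  have "m * (-x) \<le> b * (-x)" using assms False by (intro mult_right_mono) auto
  then have "exp (m * \<bar>x\<bar> - M) \<le> exp (- M - b * x)" using False by simp
  also have "\<dots> \<le> (1 + exp (- M - b * x)) * (1 + exp x)" by (simp add: algebra_simps add_nonneg_nonneg)
  finally show ?thesis .
qed

text \<open>The form in which the integrand of \<open>F_int\<close> is estimated: one factor of the denominator grows at
  \<open>+\<infinity>\<close>, the other at \<open>-\<infinity>\<close>.\<close>

lemma inverse_fermi_product_le:
  fixes m b M x c :: real and u v :: complex
  assumes m: "0 < m" "m \<le> 1" "m \<le> b" "0 \<le> M" and c: "c > 0"
    and uv: "c * ((1 + exp (- M - b * x)) * (1 + exp x)) \<le> norm (u * v)"
  shows "norm (1 / (u * v)) \<le> exp M / c * exp (- (m * \<bar>x\<bar>))"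
proof -
  have "c * exp (m * \<bar>x\<bar> - M) \<le> c * ((1 + exp (- M - b * x)) * (1 + exp x))"
    using fermi_product_lower_bound[OF m] c by (intro mult_left_mono) auto
  also note uv
  finally have "norm (1 / (u * v)) \<le> 1 / (c * exp (m * \<bar>x\<bar> - M))"
    unfolding norm_divide norm_one by (rule frac_le[rotated 3]) (use c in auto)
  also have "\<dots> = exp M / c * exp (- (m * \<bar>x\<bar>))"
    by (simp add: exp_diff exp_minus field_simps)
  finally show ?thesis .
qed

abbreviation F_kernel :: "complex \<Rightarrow> complex \<Rightarrow> real \<Rightarrow> complex" where
  "F_kernel z \<tau> x \<equiv> 1 / ((1 + exp (z + \<i> * \<tau> * complex_of_real x)) * (1 + exp (complex_of_real x)))"

text \<open>The meaning of \<open>stripS\<close>: along the line \<open>z + \<i> \<tau> x\<close> the quantity \<open>Re (w * cnj \<tau>)\<close> is constant,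
  and at a zero of \<open>1 + exp w\<close> it is an odd multiple of \<open>\<pi> Im \<tau>\<close>.\<close>

lemma one_plus_exp_strip_nonzero:
  assumes "Im \<tau> > 0" "z \<in> stripS \<tau>"
  shows "1 + exp (z + \<i> * \<tau> * complex_of_real x) \<noteq> 0"
proof
  define w where "w = z + \<i> * \<tau> * complex_of_real x"
  assume "1 + exp (z + \<i> * \<tau> * complex_of_real x) = 0"
  then have "exp w = - 1" by (simp add: w_def add_eq_0_iff)
  then obtain n :: int where n: "w = \<i> * of_real pi * of_int (2 * n + 1)"
    unfolding exp_eq_minus_one_iff by blast
  have "Re (w * cnj \<tau>) = (2 * of_int n + 1) * (pi * Im \<tau>)"
    unfolding n by (simp add: algebra_simps)
  moreover have "Re (w * cnj \<tau>) = Re (z * cnj \<tau>)"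
    by (simp add: w_def algebra_simps)
  ultimately have "\<bar>(2 * of_int n + 1) * (pi * Im \<tau>)\<bar> < pi * Im \<tau>"
    using assms(2) unfolding stripS_def mem_Collect_eq by metis
  then have "\<bar>2 * of_int n + 1\<bar> * (pi * Im \<tau>) < 1 * (pi * Im \<tau>)"
    using assms(1) by (simp only: abs_mult) simp
  then have "\<bar>2 * real_of_int n + 1\<bar> < 1"
    using assms by (subst (asm) mult_less_cancel_right) auto
  then have "\<bar>2 * n + 1\<bar> < 1" by linarith
  then show False by presburger
qed

lemma open_stripS: "open (stripS \<tau>)"
  unfolding stripS_def by (intro open_Collect_less continuous_intros)

lemma open_regionP: "open (regionP \<tau>)"
  unfolding regionP_def by (intro open_Int open_stripS open_Collect_less continuous_intros)

lemma convex_abs_linear_less: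
  fixes h :: "'a::real_vector \<Rightarrow> real"
  assumes "linear h"
  shows "convex {z. \<bar>h z\<bar> < c}"
proof -
  have "{z. \<bar>h z\<bar> < c} = h -` {-c<..<c}" by auto
  then show ?thesis using assms by (simp add: convex_linear_vimage)
qed

lemma convex_stripS: "convex (stripS \<tau>)"
  unfolding stripS_def
  by (rule convex_abs_linear_less) (auto intro!: linearI simp: algebra_simps)

lemma convex_regionP: "convex (regionP \<tau>)"
  unfolding regionP_def
  by (intro convex_Int convex_stripS convex_abs_linear_less) (auto intro!: linearI)

text \<open>Near \<open>(z\<^sub>0, \<tau>\<^sub>0)\<close> all constants entering \<open>one_plus_exp_lower_bound\<close> can be chosen uniformly, since
  they depend continuously on \<open>(z, \<tau>)\<close>.\<close>

lemma F_kernel_locally_dominated: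
  assumes "Im \<tau>\<^sub>0 > 0" "z\<^sub>0 \<in> stripS \<tau>\<^sub>0"
  shows "\<exists>C m. m > 0 \<and> (\<forall>\<^sub>F p in nhds (z\<^sub>0, \<tau>\<^sub>0). \<forall>x. norm (F_kernel (fst p) (snd p) x) \<le> C * exp (- (m * \<bar>x\<bar>)))"
proof -
  define s where "s = (\<lambda>p::complex \<times> complex. \<bar>Re (fst p * cnj (snd p)) / Im (snd p)\<bar>)"
  define q where "q = (\<lambda>p::complex \<times> complex. \<bar>Re (snd p) / Im (snd p)\<bar>)"
  define \<kappa> where "\<kappa> = (pi - s (z\<^sub>0, \<tau>\<^sub>0)) / 2"
  define A where "A = q (z\<^sub>0, \<tau>\<^sub>0) + 1"
  define M where "M = \<bar>Re z\<^sub>0\<bar> + 1"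
  define m where "m = min 1 (Im \<tau>\<^sub>0 / 2)"
  have \<kappa>: "\<kappa> > 0" using assms by (simp add: \<kappa>_def s_def stripS_def field_simps)
  have A: "A \<ge> 0" by (simp add: A_def q_def)
  have M: "M \<ge> 0" by (simp add: M_def)
  have m: "m > 0" "m \<le> 1" using assms by (simp_all add: m_def)
  obtain c where c: "c > 0" "\<And>w \<alpha>. \<bar>\<alpha>\<bar> \<le> A \<Longrightarrow> \<bar>Im w + \<alpha> * Re w\<bar> \<le> pi - \<kappa> \<Longrightarrow> c * (1 + exp (Re w)) \<le> norm (1 + exp w)"
    using one_plus_exp_lower_bound[OF \<kappa> A] by metis
  have T: "(s \<longlongrightarrow> s (z\<^sub>0, \<tau>\<^sub>0)) (nhds (z\<^sub>0, \<tau>\<^sub>0))" "(q \<longlongrightarrow> q (z\<^sub>0, \<tau>\<^sub>0)) (nhds (z\<^sub>0, \<tau>\<^sub>0))"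
    "((\<lambda>p. Re (fst p)) \<longlongrightarrow> Re z\<^sub>0) (nhds (z\<^sub>0, \<tau>\<^sub>0))"
    "((\<lambda>p. Im (snd p)) \<longlongrightarrow> Im \<tau>\<^sub>0) (nhds (z\<^sub>0, \<tau>\<^sub>0))"
    unfolding s_def q_def using assms
    by (auto intro!: tendsto_eq_intros filterlim_ident simp: nhds_prod[symmetric])
  have "s (z\<^sub>0, \<tau>\<^sub>0) < pi - \<kappa>" "q (z\<^sub>0, \<tau>\<^sub>0) < A" "- M < Re z\<^sub>0" "m < Im \<tau>\<^sub>0"
    using \<kappa> assms by (auto simp: \<kappa>_def A_def M_def m_def field_simps)
  note ev = eventually_conj[OF order_tendstoD(2)[OF T(1) this(1)] eventually_conj[OF order_tendstoD(2)[OF T(2) this(2)]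
    eventually_conj[OF order_tendstoD(1)[OF T(3) this(3)] order_tendstoD(1)[OF T(4) this(4)]]]]
  have "\<forall>\<^sub>F p in nhds (z\<^sub>0, \<tau>\<^sub>0). \<forall>x. norm (F_kernel (fst p) (snd p) x) \<le> exp M / c * exp (- (m * \<bar>x\<bar>))"
    using ev
  proof (rule eventually_mono, intro allI)
    fix p :: "complex \<times> complex" and x :: real
    assume p: "s p < pi - \<kappa> \<and> q p < A \<and> Re (fst p) > - M \<and> Im (snd p) > m"
    obtain z \<tau> where p_eq: "p = (z, \<tau>)" by (cases p)
    define w where "w = z + \<i> * \<tau> * complex_of_real x"
    define b where "b = Im \<tau>"
    have b: "b > m" "b > 0" using p m by (auto simp: b_def p_eq)
    have "Im w + Re \<tau> / Im \<tau> * Re w = Re (z * cnj \<tau>) / Im \<tau>"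
      using b by (simp add: w_def b_def field_simps)
    then have "c * (1 + exp (Re w)) \<le> norm (1 + exp w)"
      using p by (intro c(2)[of "Re \<tau> / Im \<tau>"]) (simp_all add: s_def q_def p_eq)
    moreover have "Re w \<ge> - M - b * x" using p by (simp add: w_def p_eq b_def)
    ultimately have w: "c * (1 + exp (- M - b * x)) \<le> norm (1 + exp w)"
      using c(1) by (smt (verit) exp_le_cancel_iff mult_left_mono)
    have "c * (1 + exp (- M - b * x)) * (1 + exp x) \<le> norm (1 + exp w) * norm (1 + exp (complex_of_real x))"
      unfolding norm_one_plus_exp_of_real using w by (intro mult_right_mono) (auto intro: add_nonneg_nonneg)
    then have "c * ((1 + exp (- M - b * x)) * (1 + exp x)) \<le> norm ((1 + exp w) * (1 + exp (complex_of_real x)))"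
      by (simp only: norm_mult mult.assoc)
    then have "norm (F_kernel z \<tau> x) \<le> exp M / c * exp (- (m * \<bar>x\<bar>))"
      unfolding w_def using m b M c(1) by (intro inverse_fermi_product_le[where b = b]) auto
    then show "norm (F_kernel (fst p) (snd p) x) \<le> exp M / c * exp (- (m * \<bar>x\<bar>))"
      by (simp add: p_eq)
  qed
  then show ?thesis using m(1) by blast
qed

lemma integrable_if_locally_dominated:
  fixes K :: "complex \<Rightarrow> complex \<Rightarrow> real \<Rightarrow> complex"
  assumes meas: "K z \<tau> \<in> borel_measurable lborel"
    and dom: "\<exists>C m. m > 0 \<and> (\<forall>\<^sub>F p in nhds (z, \<tau>). \<forall>x. norm (K (fst p) (snd p) x) \<le> C * exp (- (m * \<bar>x\<bar>)))"
  shows "integrable lborel (K z \<tau>)"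
proof -
  obtain C m where "m > 0" and
    ev: "\<forall>\<^sub>F p in nhds (z, \<tau>). \<forall>x. norm (K (fst p) (snd p) x) \<le> C * exp (- (m * \<bar>x\<bar>))"
    using dom by blast
  have b: "norm (K z \<tau> x) \<le> norm (C * exp (- (m * \<bar>x\<bar>)))" for x
    using eventually_nhds_x_imp_x[OF ev] by (auto intro: order_trans)
  show ?thesis
    by (rule Bochner_Integration.integrable_bound[OF _ meas AE_I2[OF b]])
      (use integrable_exp_minus_abs[OF \<open>m > 0\<close>] in auto)
qed

lemma holomorphic_integral_if_locally_dominated:
  fixes K :: "complex \<Rightarrow> complex \<Rightarrow> real \<Rightarrow> complex"
  assumes "open D" and hol: "\<zeta> holomorphic_on D" "\<theta> holomorphic_on D"
    and holK: "\<And>x. (\<lambda>w. K (\<zeta> w) (\<theta> w) x) holomorphic_on D"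
    and meas: "\<And>w. w \<in> D \<Longrightarrow> K (\<zeta> w) (\<theta> w) \<in> borel_measurable lborel"
    and dom: "\<And>w. w \<in> D \<Longrightarrow> \<exists>C m. m > 0 \<and>
      (\<forall>\<^sub>F p in nhds (\<zeta> w, \<theta> w). \<forall>x. norm (K (fst p) (snd p) x) \<le> C * exp (- (m * \<bar>x\<bar>)))"
  shows "(\<lambda>w. LBINT x. K (\<zeta> w) (\<theta> w) x) holomorphic_on D"
proof (rule holomorphic_parametric_integral[OF \<open>open D\<close> meas holK])
  fix w\<^sub>0 assume w0: "w\<^sub>0 \<in> D"
  obtain C m where "m > 0" and
    ev: "\<forall>\<^sub>F p in nhds (\<zeta> w\<^sub>0, \<theta> w\<^sub>0). \<forall>x. norm (K (fst p) (snd p) x) \<le> C * exp (- (m * \<bar>x\<bar>))"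
    using dom[OF w0] by blast
  have "isCont \<zeta> w\<^sub>0" "isCont \<theta> w\<^sub>0"
    using hol w0 \<open>open D\<close> by (auto simp: continuous_on_eq_continuous_at dest: holomorphic_on_imp_continuous_on)
  then have "((\<lambda>w. (\<zeta> w, \<theta> w)) \<longlongrightarrow> (\<zeta> w\<^sub>0, \<theta> w\<^sub>0)) (nhds w\<^sub>0)"
    unfolding isCont_def tendsto_at_iff_tendsto_nhds by (intro tendsto_Pair)
  then have "\<forall>\<^sub>F w in nhds w\<^sub>0. \<forall>x. norm (K (\<zeta> w) (\<theta> w) x) \<le> C * exp (- (m * \<bar>x\<bar>))"
    using ev by (auto simp: filterlim_iff dest: spec)
  then obtain r where "r > 0" "\<And>w x. dist w w\<^sub>0 < r \<Longrightarrow> norm (K (\<zeta> w) (\<theta> w) x) \<le> C * exp (- (m * \<bar>x\<bar>))"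
    unfolding eventually_nhds_metric by blast
  then show "\<exists>r>0. \<exists>g. integrable lborel g \<and>
      (\<forall>w\<in>D. dist w w\<^sub>0 < r \<longrightarrow> (\<forall>x. norm (K (\<zeta> w) (\<theta> w) x) \<le> g x))"
    using integrable_exp_minus_abs[OF \<open>m > 0\<close>]
    by (intro exI[of _ r] conjI exI[of _ "\<lambda>x. C * exp (- (m * \<bar>x\<bar>))"]) auto
qed

lemma F_kernel_integrable:
  assumes "Im \<tau> > 0" "z \<in> stripS \<tau>"
  shows "integrable lborel (F_kernel z \<tau>)"
  by (rule integrable_if_locally_dominated[OF _ F_kernel_locally_dominated[OF assms]]) simp

lemma F_int_holomorphic_on:
  assumes "open D" and hol: "\<zeta> holomorphic_on D" "\<theta> holomorphic_on D"
    and D: "\<And>w. w \<in> D \<Longrightarrow> Im (\<theta> w) > 0" "\<And>w. w \<in> D \<Longrightarrow> \<zeta> w \<in> stripS (\<theta> w)"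
  shows "(\<lambda>w. F_int (\<zeta> w) (\<theta> w)) holomorphic_on D"
  unfolding F_int_def
proof (rule holomorphic_integral_if_locally_dominated[where K = F_kernel, OF \<open>open D\<close> hol])
  show "(\<lambda>w. F_kernel (\<zeta> w) (\<theta> w) x) holomorphic_on D" for x
    using one_plus_exp_strip_nonzero[OF D] one_plus_exp_of_real_nonzero[of x]
    by (intro holomorphic_intros hol) auto
qed (use F_kernel_locally_dominated D in auto)

section \<open>Analytic continuation: inversion and reflection\<close>

lemma of_real_in_stripS_iff: "complex_of_real x \<in> stripS \<tau> \<longleftrightarrow> \<bar>x * Re \<tau>\<bar> < pi * Im \<tau>"
  by (simp add: stripS_def)

text \<open>For real \<open>z\<close> the condition \<open>z \<in> stripS \<tau>\<close> defines a convex cone in the variable \<open>\<tau>\<close> that contains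
  the positive imaginary axis. The first continuation reaches \<open>\<tau>\<^sub>0\<close> within this cone, for all
  \<open>z\<close> in a real interval around \<open>0\<close>; the second leads from this interval to \<open>z\<^sub>0\<close>. The set \<open>E\<close>
  allows for identities with a further restriction on \<open>\<tau>\<close>.\<close>

lemma identity_by_two_continuations:
  fixes f g :: "complex \<Rightarrow> complex \<Rightarrow> complex" and b\<^sub>0 :: real
  assumes E: "open E" "convex E" "\<And>\<tau>. \<tau> \<in> E \<Longrightarrow> Im \<tau> > 0" "\<tau>\<^sub>0 \<in> E" "\<i> * of_real b\<^sub>0 \<in> E"
    and U: "open U" "convex U" "0 \<in> U" "z\<^sub>0 \<in> U"
    and hz: "(\<lambda>z. f z \<tau>\<^sub>0) holomorphic_on U" "(\<lambda>z. g z \<tau>\<^sub>0) holomorphic_on U"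
    and h\<tau>: "\<And>x::real. f (of_real x) holomorphic_on (E \<inter> {\<tau>. of_real x \<in> stripS \<tau>})"
            "\<And>x::real. g (of_real x) holomorphic_on (E \<inter> {\<tau>. of_real x \<in> stripS \<tau>})"
    and eq: "\<And>x b::real. b > 0 \<Longrightarrow> \<i> * of_real b \<in> E \<Longrightarrow> f (of_real x) (\<i> * of_real b) = g (of_real x) (\<i> * of_real b)"
  shows "f z\<^sub>0 \<tau>\<^sub>0 = g z\<^sub>0 \<tau>\<^sub>0"
proof -
  have real_eq: "f (of_real x) \<tau>\<^sub>0 - g (of_real x) \<tau>\<^sub>0 = 0" if x: "complex_of_real x \<in> stripS \<tau>\<^sub>0" for x :: real
  proof (rule analytic_continuation[where f = "\<lambda>\<tau>. f (of_real x) \<tau> - g (of_real x) \<tau>"])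
    let ?D = "E \<inter> {\<tau>. complex_of_real x \<in> stripS \<tau>}"
    let ?I = "(\<lambda>b::real. \<i> * of_real b) ` {b. \<i> * of_real b \<in> E}"
    show "(\<lambda>\<tau>. f (of_real x) \<tau> - g (of_real x) \<tau>) holomorphic_on ?D"
      by (intro holomorphic_on_diff h\<tau>)
    show "open ?D"
      unfolding of_real_in_stripS_iff by (intro open_Int E open_Collect_less continuous_intros)
    have "{\<tau>. \<bar>x * Re \<tau>\<bar> < pi * Im \<tau>}
        = (\<lambda>\<tau>. x * Re \<tau> - pi * Im \<tau>) -` {..<0} \<inter> (\<lambda>\<tau>. - x * Re \<tau> - pi * Im \<tau>) -` {..<0}"
      by auto
    also have "convex \<dots>"
      by (intro convex_Int convex_linear_vimage) (auto intro!: linearI simp: algebra_simps)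
    finally show "connected ?D"
      unfolding of_real_in_stripS_iff by (intro convex_connected convex_Int E)
    show I: "?I \<subseteq> ?D"
      using E(3) by (force simp: of_real_in_stripS_iff)
    show "\<i> * of_real b\<^sub>0 \<in> ?D" using E I by blast
    show "(\<i> * of_real b\<^sub>0) islimpt ?I"
      unfolding islimpt_approachable
    proof (intro allI impI)
      fix e :: real assume "e > 0"
      obtain d where d: "d > 0" "ball (\<i> * of_real b\<^sub>0) d \<subseteq> E"
        using E open_contains_ball by blast
      define h where "h = min d e / 2"
      have h: "h > 0" "h < d" "h < e" using d \<open>e > 0\<close> by (auto simp: h_def)
      have dist: "dist (\<i> * of_real (b\<^sub>0 + h)) (\<i> * of_real b\<^sub>0) = h"
        using h by (simp add: dist_norm algebra_simps norm_mult)
      have "\<i> * of_real (b\<^sub>0 + h) \<in> ball (\<i> * of_real b\<^sub>0) d"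
        using dist h by (simp add: dist_commute)
      then have "\<i> * of_real (b\<^sub>0 + h) \<in> ?I" using d by blast
      moreover have "\<i> * of_real (b\<^sub>0 + h) \<noteq> \<i> * of_real b\<^sub>0" using h by simp
      ultimately show "\<exists>x'\<in>?I. x' \<noteq> \<i> * of_real b\<^sub>0 \<and> dist x' (\<i> * of_real b\<^sub>0) < e"
        using dist h by metis
    qed
    show "f (of_real x) \<tau> - g (of_real x) \<tau> = 0" if "\<tau> \<in> ?I" for \<tau>
      using that eq E(3) by force
    show "\<tau>\<^sub>0 \<in> ?D" using E x by simp
  qed
  have "f z\<^sub>0 \<tau>\<^sub>0 - g z\<^sub>0 \<tau>\<^sub>0 = 0"
  proof (rule analytic_continuation[where f = "\<lambda>z. f z \<tau>\<^sub>0 - g z \<tau>\<^sub>0"])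
    let ?R = "complex_of_real ` {x. of_real x \<in> U \<inter> stripS \<tau>\<^sub>0}"
    show "(\<lambda>z. f z \<tau>\<^sub>0 - g z \<tau>\<^sub>0) holomorphic_on U"
      by (intro holomorphic_on_diff hz)
    show "connected U" using U by (simp add: convex_connected)
    show "?R \<subseteq> U" by auto
    have "0 \<in> U \<inter> stripS \<tau>\<^sub>0" using U E by (simp add: stripS_def)
    then obtain d where d: "d > 0" "ball 0 d \<subseteq> U \<inter> stripS \<tau>\<^sub>0"
      using U open_stripS open_contains_ball by (metis open_Int)
    show "0 islimpt ?R"
      unfolding islimpt_approachable
    proof (intro allI impI)
      fix e :: real assume "e > 0"
      define h where "h = min d e / 2"
      have h: "h > 0" "h < d" "h < e" using d \<open>e > 0\<close> by (auto simp: h_def)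
      have "complex_of_real h \<in> ball 0 d" using h by simp
      then have "complex_of_real h \<in> ?R" using d by blast
      then show "\<exists>x'\<in>?R. x' \<noteq> 0 \<and> dist x' 0 < e"
        using h by (intro bexI[of _ "complex_of_real h"]) auto
    qed
    show "f z \<tau>\<^sub>0 - g z \<tau>\<^sub>0 = 0" if "z \<in> ?R" for z
      using that real_eq by auto
  qed (use U in auto)
  then show ?thesis by simp
qed

text \<open>Thus \<open>regionP \<tau>\<close> is where both sides of the inversion formula are given by convergent integrals.\<close>

lemma stripS_inversion:
  assumes "Im \<tau> > 0"
  shows "\<i> * z / \<tau> \<in> stripS (- (1 / \<tau>)) \<longleftrightarrow> \<bar>Im z\<bar> < pi * Im \<tau>"
proof -
  define N where "N = (Re \<tau>)\<^sup>2 + (Im \<tau>)\<^sup>2"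
  have N: "N > 0" using assms by (simp add: N_def sum_power2_gt_zero_iff)
  have \<tau>: "\<tau> * cnj \<tau> = of_real N" by (simp add: N_def complex_mult_cnj)
  have "\<tau> \<noteq> 0" using assms by auto
  have "\<i> * z / \<tau> * cnj (- (1 / \<tau>)) = - (\<i> * z / (\<tau> * cnj \<tau>))"
    by simp
  also have "Re \<dots> = Im z / N" unfolding \<tau> by simp
  finally have 1: "Re (\<i> * z / \<tau> * cnj (- (1 / \<tau>))) = Im z / N" .
  have 2: "Im (- (1 / \<tau>)) = Im \<tau> / N"
    by (simp add: Im_divide N_def)
  show ?thesis unfolding stripS_def mem_Collect_eq 1 2 using N by (simp add: field_simps)
qed

lemma F_int_inversion_imaginary:
  fixes x b :: real
  assumes "b > 0"
  shows "F_int (of_real x) (\<i> * of_real b)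
       = \<i> / (\<i> * of_real b) * F_int (\<i> * of_real x / (\<i> * of_real b)) (- (1 / (\<i> * of_real b)))"
proof -
  have "F_int (\<i> * of_real x / (\<i> * of_real b)) (- (1 / (\<i> * of_real b)))
      = (LBINT u. 1 / ((1 + exp (of_real ((x - u) / b))) * (1 + exp (complex_of_real u))))"
    unfolding F_int_def using assms
    by (intro Bochner_Integration.integral_cong refl) (simp add: field_simps)
  also have "\<dots> = of_real b * (LBINT u. 1 / ((1 + exp (of_real ((x - (x + (-b) * u)) / b))) * (1 + exp (complex_of_real (x + (-b) * u)))))"
    using assms by (subst lborel_integral_real_affine[where c = "-b" and t = x]) (auto simp: scaleR_conv_of_real)
  also have "(LBINT u. 1 / ((1 + exp (of_real ((x - (x + (-b) * u)) / b))) * (1 + exp (complex_of_real (x + (-b) * u)))))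
      = F_int (of_real x) (\<i> * of_real b)"
    unfolding F_int_def using assms
    by (intro Bochner_Integration.integral_cong refl) (simp add: field_simps)
  finally show ?thesis using assms by simp
qed

theorem F_int_inversion:
  assumes "Im \<tau> > 0" "z \<in> regionP \<tau>"
  shows "F_int z \<tau> = \<i> / \<tau> * F_int (\<i> * z / \<tau>) (- (1 / \<tau>))"
proof (rule identity_by_two_continuations[where E = "{\<tau>. Im \<tau> > 0}" and U = "regionP \<tau>" and b\<^sub>0 = 1
      and g = "\<lambda>z \<tau>. \<i> / \<tau> * F_int (\<i> * z / \<tau>) (- (1 / \<tau>))"])
  have inv: "Im (- (1 / \<sigma>)) > 0" if "Im \<sigma> > 0" for \<sigma> :: complex
    using that by (simp add: Im_divide sum_power2_gt_zero_iff)
  show "open {\<tau>. Im \<tau> > 0}" by (simp add: open_halfspace_Im_gt)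
  show "convex {\<tau>. Im \<tau> > 0}" by (simp add: convex_halfspace_Im_gt)
  show "0 \<in> regionP \<tau>" using assms by (simp add: regionP_def stripS_def)
  show "(\<lambda>z. F_int z \<tau>) holomorphic_on regionP \<tau>"
    using assms by (intro F_int_holomorphic_on open_regionP holomorphic_intros) (auto simp: regionP_def)
  show "(\<lambda>z. \<i> / \<tau> * F_int (\<i> * z / \<tau>) (- (1 / \<tau>))) holomorphic_on regionP \<tau>"
    using assms stripS_inversion inv
    by (intro holomorphic_intros F_int_holomorphic_on open_regionP) (auto simp: regionP_def)
  fix x :: real
  have op: "open ({\<tau>. Im \<tau> > 0} \<inter> {\<tau>. complex_of_real x \<in> stripS \<tau>})"
    unfolding of_real_in_stripS_iff
    by (intro open_Int open_Collect_less continuous_intros)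
  show "F_int (of_real x) holomorphic_on ({\<tau>. Im \<tau> > 0} \<inter> {\<tau>. of_real x \<in> stripS \<tau>})"
    by (intro F_int_holomorphic_on[OF op, of "\<lambda>_. of_real x" "\<lambda>\<tau>. \<tau>"] holomorphic_intros) auto
  show "(\<lambda>\<tau>. \<i> / \<tau> * F_int (\<i> * of_real x / \<tau>) (- (1 / \<tau>)))
      holomorphic_on ({\<tau>. Im \<tau> > 0} \<inter> {\<tau>. of_real x \<in> stripS \<tau>})"
    using stripS_inversion[of _ "of_real x"] inv
    by (intro holomorphic_intros F_int_holomorphic_on op) auto
qed (use assms open_regionP convex_regionP F_int_inversion_imaginary in auto)

text \<open>With the Fermi function \<open>A\<close>, the relation \<open>A (- v) = 1 - A v\<close> reduces the difference of the two
  integrands to \<open>A (x - b u) + A u - 1\<close>, which is the derivative of \<open>G\<close> below.\<close>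

lemma F_int_reflection_imaginary:
  fixes x b :: real
  assumes b: "b > 0"
  shows "F_int (of_real x) (\<i> * of_real b) = F_int (- of_real x) (\<i> * of_real b) - \<i> * of_real x / (\<i> * of_real b)"
proof -
  define A where "A = (\<lambda>v::real. 1 / (1 + exp v))"
  have pos: "1 + exp v > 0" for v :: real by (simp add: add_pos_pos)
  have A_minus: "A (- v) = 1 - A v" for v
    using pos[of v] by (simp add: A_def exp_minus field_simps)
  have kern: "F_kernel (of_real y) (\<i> * of_real b) u = complex_of_real (A (y - b * u) * A u)" for y u
  proof -
    have e: "of_real y + \<i> * (\<i> * of_real b) * complex_of_real u = of_real (y - b * u)"
      by simp
    show ?thesis unfolding A_def e exp_of_real by simp
  qed
  have int: "integrable lborel (\<lambda>u. A (y - b * u) * A u)" for y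
  proof -
    have "integrable lborel (F_kernel (of_real y) (\<i> * of_real b))"
      using b by (intro F_kernel_integrable) (auto simp: stripS_def)
    then show ?thesis unfolding kern by (subst (asm) complex_of_real_integrable_eq)
  qed
  have F: "F_int (of_real y) (\<i> * of_real b) = of_real (LBINT u. A (y - b * u) * A u)" for y
    unfolding F_int_def kern by (rule integral_complex_of_real)
  have refl: "(LBINT u. A (- x - b * u) * A u) = (LBINT u. A (- (x - b * u)) * A (- u))"
    by (subst lborel_integral_real_affine[where c = "-1" and t = 0]) auto
  have int': "integrable lborel (\<lambda>u. A (- (x - b * u)) * A (- u))"
    using lborel_integrable_real_affine[OF int[of "-x"], of "-1" 0] by simp
  define K where "K = (\<lambda>u. A (x - b * u) + A u - 1)"
  have K: "K u = A (x - b * u) * A u - A (- (x - b * u)) * A (- u)" for u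
    unfolding A_minus K_def by (simp add: algebra_simps)
  have intK: "integrable lborel K"
    unfolding K using int[of x] int' by simp
  \<comment> \<open>An antiderivative of \<open>K\<close> that tends to \<open>0\<close> at \<open>-\<infinity>\<close> and to \<open>- x / b\<close> at \<open>\<infinity>\<close>.\<close>
  define G where "G = (\<lambda>u. ln (1 + exp (b * u - x)) / b - ln (1 + exp u))"
  have "(LBINT u=-\<infinity>..\<infinity>. K u) = - x / b - 0"
  proof (rule interval_integral_FTC_integrable)
    fix u :: real
    have "(G has_real_derivative K u) (at u)"
      unfolding G_def K_def A_def
      by (rule derivative_eq_intros refl | use pos b in \<open>simp; fail\<close>)+
        (use pos[of u] pos[of "b * u - x"] pos[of "x - b * u"] b in
          \<open>simp add: exp_diff divide_simps; simp add: algebra_simps\<close>)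
    then show "(G has_vector_derivative K u) (at u)"
      by (simp add: has_real_derivative_iff_has_vector_derivative)
    show "isCont K u" unfolding K_def A_def
      using pos by (intro continuous_intros) (auto simp: less_imp_neq[symmetric])
  next
    show "set_integrable lborel (einterval (-\<infinity>) \<infinity>) K"
      using intK by (simp add: set_integrable_def)
    have "(G \<longlongrightarrow> 0) at_bot" unfolding G_def using b by real_asymp
    then show "((G \<circ> real_of_ereal) \<longlongrightarrow> 0) (at_right (-\<infinity>))"
      by (simp add: ereal_tendsto_simps)
    have "(G \<longlongrightarrow> - (x * inverse b)) at_top" unfolding G_def using b by real_asymp
    then have "(G \<longlongrightarrow> - x / b) at_top" by (simp add: divide_inverse)
    then show "((G \<circ> real_of_ereal) \<longlongrightarrow> - x / b) (at_left \<infinity>)"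
      by (simp add: ereal_tendsto_simps)
  qed simp
  then have "(LBINT u. K u) = - x / b"
    by (simp add: interval_lebesgue_integral_def set_lebesgue_integral_def)
  moreover have "(LBINT u. K u) = (LBINT u. A (x - b * u) * A u) - (LBINT u. A (- x - b * u) * A u)"
    unfolding K refl using int[of x] int' by (rule Bochner_Integration.integral_diff)
  ultimately have "(LBINT u. A (x - b * u) * A u) = (LBINT u. A (- x - b * u) * A u) - x / b"
    by simp
  then show ?thesis
    using F[of x] F[of "-x"] b by simp
qed

lemma uminus_in_stripS_iff [simp]: "- z \<in> stripS \<tau> \<longleftrightarrow> z \<in> stripS \<tau>"
  by (simp only: stripS_def mem_Collect_eq mult_minus_left uminus_complex.simps abs_minus_cancel)

theorem F_int_reflection:
  assumes "Im \<tau> > 0" "z \<in> stripS \<tau>"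
  shows "F_int z \<tau> = F_int (- z) \<tau> - \<i> * z / \<tau>"
proof (rule identity_by_two_continuations[where E = "{\<tau>. Im \<tau> > 0}" and U = "stripS \<tau>" and b\<^sub>0 = 1
      and g = "\<lambda>z \<tau>. F_int (- z) \<tau> - \<i> * z / \<tau>"])
  show "open {\<tau>. Im \<tau> > 0}" by (simp add: open_halfspace_Im_gt)
  show "convex {\<tau>. Im \<tau> > 0}" by (simp add: convex_halfspace_Im_gt)
  show "0 \<in> stripS \<tau>" using assms by (simp add: stripS_def)
  show "(\<lambda>z. F_int z \<tau>) holomorphic_on stripS \<tau>"
    using assms by (intro F_int_holomorphic_on open_stripS holomorphic_intros) auto
  show "(\<lambda>z. F_int (- z) \<tau> - \<i> * z / \<tau>) holomorphic_on stripS \<tau>"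
    using assms by (intro holomorphic_intros F_int_holomorphic_on open_stripS) auto
  fix x :: real
  have op: "open ({\<tau>. Im \<tau> > 0} \<inter> {\<tau>. complex_of_real x \<in> stripS \<tau>})"
    unfolding of_real_in_stripS_iff
    by (intro open_Int open_Collect_less continuous_intros)
  show "F_int (of_real x) holomorphic_on ({\<tau>. Im \<tau> > 0} \<inter> {\<tau>. of_real x \<in> stripS \<tau>})"
    by (intro F_int_holomorphic_on[OF op, of "\<lambda>_. of_real x" "\<lambda>\<tau>. \<tau>"] holomorphic_intros) auto
  show "(\<lambda>\<tau>. F_int (- of_real x) \<tau> - \<i> * of_real x / \<tau>)
      holomorphic_on ({\<tau>. Im \<tau> > 0} \<inter> {\<tau>. of_real x \<in> stripS \<tau>})"
    by (intro holomorphic_intros F_int_holomorphic_on op) auto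
qed (use assms open_stripS convex_stripS F_int_reflection_imaginary in auto)

section \<open>The multiplication formula\<close>

text \<open>Expanding \<open>1 / (1 + X \<omega> k)\<close> as a finite geometric sum over the common denominator \<open>1 + X ^ n\<close>, the
  sum over \<open>k\<close> annihilates all powers of \<open>X\<close> except the constant one, because the \<open>\<omega> k\<close> differ by
  \<open>n\<close>-th roots of unity.\<close>

lemma partial_fraction_roots_of_minus_one:
  fixes X :: complex and n :: nat
  assumes n: "n > 0" and nz: "\<And>k. k < n \<Longrightarrow> 1 + X * exp (of_real pi * \<i> * (of_nat n - 2 * of_nat k - 1) / of_nat n) \<noteq> 0"
  shows "1 / (1 + X ^ n)
       = 1 / of_nat n * (\<Sum>k<n. 1 / (1 + X * exp (of_real pi * \<i> * (of_nat n - 2 * of_nat k - 1) / of_nat n)))"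
proof -
  define \<omega> where "\<omega> = (\<lambda>k::nat. exp (of_real pi * \<i> * (of_nat n - 2 * of_nat k - 1) / of_nat n))"
  define \<zeta> where "\<zeta> = exp (- (2 * of_real pi * \<i> / of_nat n))"
  have \<omega>: "\<omega> k = \<omega> 0 * \<zeta> ^ k" for k
    unfolding \<omega>_def \<zeta>_def exp_of_nat_mult[symmetric] exp_add[symmetric]
    by (rule arg_cong[of _ _ exp]) (use n in \<open>simp add: field_simps\<close>)
  have \<omega>n: "\<omega> k ^ n = - ((-1) ^ n)" for k
  proof -
    have "\<omega> k ^ n = exp (of_nat n * (\<i> * of_real pi) - of_nat (2 * k) * (\<i> * of_real pi) - \<i> * of_real pi)"
      unfolding \<omega>_def exp_of_nat_mult[symmetric]
      by (rule arg_cong[of _ _ exp]) (use n in \<open>simp add: field_simps\<close>)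
    also have "\<dots> = exp (\<i> * of_real pi) ^ n / exp (\<i> * of_real pi) ^ (2 * k) / exp (\<i> * of_real pi)"
      unfolding exp_diff exp_of_nat_mult ..
    finally show ?thesis by simp
  qed
  have \<zeta>n: "\<zeta> ^ n = 1"
    unfolding \<zeta>_def exp_of_nat_mult[symmetric] using n by (simp add: exp_minus)
  have \<zeta>j: "\<zeta> ^ j \<noteq> 1" if "0 < j" "j < n" for j
  proof
    assume "\<zeta> ^ j = 1"
    then have "exp (- (2 * of_real pi * \<i> / of_nat n) * of_nat j) = 1"
      unfolding \<zeta>_def exp_of_nat_mult[symmetric] by (simp add: mult.commute)
    then obtain l :: int where l: "Im (- (2 * of_real pi * \<i> / of_nat n) * of_nat j) = of_int (2 * l) * pi"
      unfolding exp_eq_1 by blast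
    have "Im (- (2 * of_real pi * \<i> / of_nat n) * of_nat j) = - (2 * pi * of_nat j / of_nat n)"
      by simp
    with l have "pi * (- real j) = pi * (of_int l * real n)" using n by (simp add: field_simps)
    then have "- real j = of_int l * real n" by (simp only: mult_cancel_left pi_neq_zero simp_thms)
    then have "real_of_int (- int j) = real_of_int (l * int n)" by simp
    then have "- int j = l * int n" by (simp only: of_int_eq_iff)
    then have "int n dvd int j" by (metis dvd_minus_iff dvd_triv_right)
    then show False using that by (simp add: nat_dvd_not_less)
  qed
  have sum_\<omega>: "(\<Sum>k<n. \<omega> k ^ j) = (if j = 0 then of_nat n else 0)" if "j < n" for j
  proof (cases "j = 0")
    case False
    have "(\<Sum>k<n. \<omega> k ^ j) = \<omega> 0 ^ j * (\<Sum>k<n. (\<zeta> ^ j) ^ k)"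
      unfolding sum_distrib_left by (intro sum.cong refl) (subst \<omega>, simp add: power_mult_distrib power_commutes flip: power_mult, simp add: mult.commute)
    moreover have "(1 - \<zeta> ^ j) * (\<Sum>k<n. (\<zeta> ^ j) ^ k) = 1 - (\<zeta> ^ j) ^ n"
      by (rule one_diff_power_eq[symmetric])
    moreover have "(\<zeta> ^ j) ^ n = 1" by (metis \<zeta>n power_mult mult.commute power_one)
    ultimately show ?thesis using \<zeta>j[of j] False that by auto
  qed simp
  have Y: "(1 + X * \<omega> k) * (\<Sum>j<n. (- (X * \<omega> k)) ^ j) = 1 + X ^ n" for k
  proof -
    have "(- (X * \<omega> k)) ^ n = (-1) ^ n * X ^ n * \<omega> k ^ n"
      by (simp add: power_minus[of "X * \<omega> k"] power_mult_distrib)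
    also have "\<dots> = - (X ^ n)" unfolding \<omega>n by (simp flip: power_mult_distrib)
    finally show ?thesis
      using one_diff_power_eq[of "- (X * \<omega> k)" n] by simp
  qed
  have nz': "1 + X * \<omega> k \<noteq> 0" if "k < n" for k using nz[OF that] by (simp add: \<omega>_def)
  show ?thesis
  proof (cases "1 + X ^ n = 0")
    case False
    have "(\<Sum>k<n. 1 / (1 + X * \<omega> k)) = (\<Sum>k<n. (\<Sum>j<n. (- (X * \<omega> k)) ^ j) / (1 + X ^ n))"
    proof (rule sum.cong[OF refl])
      fix k assume "k \<in> {..<n}"
      then have k: "k < n" by simp
      show "1 / (1 + X * \<omega> k) = (\<Sum>j<n. (- (X * \<omega> k)) ^ j) / (1 + X ^ n)"
        unfolding frac_eq_eq[OF nz'[OF k] False] using Y[of k] by (simp add: mult.commute)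
    qed
    also have "\<dots> = (\<Sum>j<n. (- X) ^ j * (\<Sum>k<n. \<omega> k ^ j)) / (1 + X ^ n)"
      unfolding sum_divide_distrib[symmetric] sum_distrib_left
      by (subst sum.swap) (simp flip: power_mult_distrib)
    also have "(\<Sum>j<n. (- X) ^ j * (\<Sum>k<n. \<omega> k ^ j)) = (\<Sum>j<n. if j = 0 then of_nat n else 0)"
      using sum_\<omega> by (intro sum.cong refl) simp
    also have "\<dots> = of_nat n" using n by simp
    finally show ?thesis using n by (simp add: \<omega>_def)
  next
    case True
    have "(\<Sum>j<n. (- (X * \<omega> k)) ^ j) = 0" if "k < n" for k
      using Y[of k] nz'[OF that] True by simp
    then have "0 = (\<Sum>k<n. \<Sum>j<n. (- (X * \<omega> k)) ^ j)" by simp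
    also have "(\<Sum>k<n. \<Sum>j<n. (- (X * \<omega> k)) ^ j) = (\<Sum>j<n. (- X) ^ j * (\<Sum>k<n. \<omega> k ^ j))"
      unfolding sum_distrib_left by (subst sum.swap) (simp flip: power_mult_distrib)
    also have "\<dots> = (\<Sum>j<n. if j = 0 then of_nat n else 0)"
      using sum_\<omega> by (intro sum.cong refl) simp
    also have "\<dots> = of_nat n" using n by simp
    finally show ?thesis using n by simp
  qed
qed

theorem F_int_multiplication:
  fixes n :: nat
  assumes "Im \<tau> > 0" "z \<in> stripS \<tau>" "n > 0"
  shows "F_int z (of_nat n * \<tau>) =
          1 / of_nat n * (\<Sum>k = 0..n - 1.
             F_int (1 / of_nat n * (z + of_real pi * \<i> * (of_nat n - 2 * of_nat k - 1))) \<tau>)"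
proof -
  define y where "y = (\<lambda>k::nat. 1 / of_nat n * (z + of_real pi * \<i> * (of_nat n - 2 * of_nat k - 1)))"
  have range: "{0..n - 1} = {..<n}" using assms by auto
  have y: "y k \<in> stripS \<tau>" if "k < n" for k
  proof -
    have e: "Re (y k * cnj \<tau>) = (Re (z * cnj \<tau>) + (real n - 2 * real k - 1) * (pi * Im \<tau>)) / real n"
      using assms by (simp add: y_def field_simps)
    have "\<bar>real n - 2 * real k - 1\<bar> \<le> real n - 1" using that by auto
    then have "\<bar>(real n - 2 * real k - 1) * (pi * Im \<tau>)\<bar> \<le> (real n - 1) * (pi * Im \<tau>)"
      using assms(1) by (simp add: abs_mult mult_right_mono)
    then have "\<bar>Re (z * cnj \<tau>) + (real n - 2 * real k - 1) * (pi * Im \<tau>)\<bar> < real n * (pi * Im \<tau>)"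
      using assms(2) unfolding stripS_def mem_Collect_eq left_diff_distrib by linarith
    then show ?thesis
      unfolding stripS_def mem_Collect_eq e using assms(3) by (simp add: abs_divide field_simps)
  qed
  have kern: "F_kernel z (of_nat n * \<tau>) x = 1 / of_nat n * (\<Sum>k<n. F_kernel (y k) \<tau> x)" for x
  proof -
    define X where "X = exp (z / of_nat n + \<i> * \<tau> * of_real x)"
    have X: "exp (y k + \<i> * \<tau> * of_real x) = X * exp (of_real pi * \<i> * (of_nat n - 2 * of_nat k - 1) / of_nat n)" for k
      unfolding X_def y_def exp_add[symmetric] by (rule arg_cong[of _ _ exp]) (simp add: add_divide_distrib)
    have Xn: "exp (z + \<i> * (of_nat n * \<tau>) * of_real x) = X ^ n"
      unfolding X_def exp_of_nat_mult[symmetric]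
      by (rule arg_cong[of _ _ exp]) (use assms(3) in \<open>simp add: field_simps\<close>)
    have "F_kernel z (of_nat n * \<tau>) x = 1 / (1 + X ^ n) * (1 / (1 + exp (of_real x)))"
      unfolding Xn by simp
    also have "1 / (1 + X ^ n) = 1 / of_nat n * (\<Sum>k<n. 1 / (1 + exp (y k + \<i> * \<tau> * of_real x)))"
      unfolding X using one_plus_exp_strip_nonzero[OF assms(1) y, of _ x]
      by (intro partial_fraction_roots_of_minus_one assms(3)) (simp add: X)
    finally show ?thesis
      by (simp add: sum_divide_distrib mult_ac)
  qed
  have "F_int z (of_nat n * \<tau>) = (LBINT x. 1 / of_nat n * (\<Sum>k<n. F_kernel (y k) \<tau> x))"
    unfolding F_int_def kern ..
  also have "\<dots> = 1 / of_nat n * (\<Sum>k<n. F_int (y k) \<tau>)"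
    unfolding F_int_def using F_kernel_integrable[OF assms(1) y]
    by (subst integral_mult_right_zero, subst Bochner_Integration.integral_sum) auto
  finally show ?thesis unfolding range y_def .
qed

section \<open>Residues in a horizontal strip\<close>

lemma contour_integral_horizontal:
  fixes c R :: real
  assumes "R > 0"
  shows "contour_integral (linepath (Complex (- R) c) (Complex R c)) f
       = integral {-R..R} (\<lambda>t. f (of_real t + \<i> * of_real c))"
proof -
  have "linepath (Complex (- R) c) (Complex R c) x = linepath (of_real (-R)) (of_real R) x + \<i> * of_real c" for x
    by (simp add: linepath_def complex_eq_iff algebra_simps)
  moreover have "Complex R c - Complex (- R) c = of_real R - of_real (-R)"
    by (simp add: complex_eq_iff)
  ultimately have "contour_integral (linepath (Complex (- R) c) (Complex R c)) f
      = contour_integral (linepath (of_real (-R)) (of_real R)) (\<lambda>x. f (x + \<i> * of_real c))"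
    by (simp add: contour_integral_integral vector_derivative_linepath_at)
  also have "\<dots> = integral {-R..R} (\<lambda>t. f (of_real t + \<i> * of_real c))"
    using assms by (subst contour_integral_linepath_Reals_eq) auto
  finally show ?thesis .
qed

lemma integral_symmetric_interval_tendsto:
  fixes g :: "real \<Rightarrow> complex"
  assumes g: "integrable lborel g"
  shows "((\<lambda>R. integral {-R..R} g) \<longlongrightarrow> (LBINT t. g t)) at_top"
proof -
  have "((\<lambda>R. LBINT t. indicator {-R..R} t *\<^sub>R g t) \<longlongrightarrow> (LBINT t. g t)) at_top"
  proof (rule integral_dominated_convergence_at_top[where w = "\<lambda>t. norm (g t)"])
    show "AE t in lborel. ((\<lambda>R. indicator {-R..R} t *\<^sub>R g t) \<longlongrightarrow> g t) at_top"
    proof (rule AE_I2)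
      fix t :: real
      have "\<forall>\<^sub>F R in at_top. indicator {-R..R} t *\<^sub>R g t = g t"
        using eventually_ge_at_top[of "\<bar>t\<bar>"] by eventually_elim (auto simp: indicator_def)
      then show "((\<lambda>R. indicator {-R..R} t *\<^sub>R g t) \<longlongrightarrow> g t) at_top"
        by (rule tendsto_eventually)
    qed
    show "\<forall>\<^sub>F R in at_top. AE t in lborel. norm (indicator {-R..R} t *\<^sub>R g t) \<le> norm (g t)"
      by (intro always_eventually allI AE_I2) (auto simp: indicator_def)
  qed (use g in auto)
  moreover have "(LBINT t. indicator {-R..R} t *\<^sub>R g t) = integral {-R..R} g" for R
  proof -
    have "set_integrable lborel {-R..R} g"
      unfolding set_integrable_def using g by (intro integrable_mult_indicator) auto
    from set_borel_integral_eq_integral(2)[OF this] show ?thesis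
      by (simp add: set_lebesgue_integral_def)
  qed
  ultimately show ?thesis by simp
qed

text \<open>The residue theorem for rectangles of width tending to infinity; the exponential decay removes the
  vertical sides. The strip \<open>\<alpha> < Im x < \<beta>\<close> is slightly larger than the region between the two lines,
  so that \<open>f\<close> may have further poles outside it.\<close>

theorem strip_residue_theorem:
  fixes f :: "complex \<Rightarrow> complex" and \<alpha> \<beta> c d m C R\<^sub>0 :: real
  assumes cd: "\<alpha> < c" "c < d" "d < \<beta>"
    and P: "finite P" "\<And>p. p \<in> P \<Longrightarrow> c < Im p \<and> Im p < d"
    and hol: "f holomorphic_on {x. \<alpha> < Im x \<and> Im x < \<beta>} - P"
    and m: "m > 0"
    and decay: "\<And>x. c \<le> Im x \<Longrightarrow> Im x \<le> d \<Longrightarrow> R\<^sub>0 \<le> \<bar>Re x\<bar> \<Longrightarrow> norm (f x) \<le> C * exp (- (m * \<bar>Re x\<bar>))"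
    and int: "integrable lborel (\<lambda>t. f (of_real t + \<i> * of_real c))"
             "integrable lborel (\<lambda>t. f (of_real t + \<i> * of_real d))"
  shows "(LBINT t. f (of_real t + \<i> * of_real c)) - (LBINT t. f (of_real t + \<i> * of_real d))
       = 2 * pi * \<i> * (\<Sum>p\<in>P. residue f p)"
proof -
  define S where "S = {x. \<alpha> < Im x \<and> Im x < \<beta>}"
  define V1 where "V1 = (\<lambda>R. contour_integral (linepath (Complex R c) (Complex R d)) f)"
  define V2 where "V2 = (\<lambda>R. contour_integral (linepath (Complex (-R) d) (Complex (-R) c)) f)"
  define B where "B = (\<lambda>c R. integral {-R..R} (\<lambda>t. f (of_real t + \<i> * of_real c)))"
  define K where "K = 2 * pi * \<i> * (\<Sum>p\<in>P. residue f p)"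
  have S: "open S" "connected S"
  proof -
    have S_eq: "S = {x. \<alpha> < Im x} \<inter> {x. Im x < \<beta>}" by (auto simp: S_def)
    show "open S" unfolding S_eq by (intro open_Int open_halfspace_Im_gt open_halfspace_Im_lt)
    show "connected S" unfolding S_eq
      by (intro convex_connected convex_Int convex_halfspace_Im_gt convex_halfspace_Im_lt)
  qed
  define R\<^sub>1 where "R\<^sub>1 = Max (insert 0 (insert R\<^sub>0 ((\<lambda>p. \<bar>Re p\<bar>) ` P)))"
  have R1: "0 \<le> R\<^sub>1" "R\<^sub>0 \<le> R\<^sub>1" "\<And>p. p \<in> P \<Longrightarrow> \<bar>Re p\<bar> \<le> R\<^sub>1"
    using P(1) by (auto simp: R\<^sub>1_def simp del: Max_insert intro!: Max_ge)
  have cont: "continuous_on (S - P) f"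
    using hol holomorphic_on_imp_continuous_on S_def by blast
  have seg: "closed_segment (Complex (-R) c) (Complex R c) \<subseteq> S - P"
      "closed_segment (Complex R c) (Complex R d) \<subseteq> S - P"
      "closed_segment (Complex R d) (Complex (-R) d) \<subseteq> S - P"
      "closed_segment (Complex (-R) d) (Complex (-R) c) \<subseteq> S - P" if R: "R > R\<^sub>1" for R
    using P(2) R1 R cd
    by (force simp: S_def closed_segment_same_Re closed_segment_same_Im closed_segment_eq_real_ivl split: if_splits)+
  have ci: "f contour_integrable_on (linepath (Complex (-R) c) (Complex R c))"
      "f contour_integrable_on (linepath (Complex R c) (Complex R d))"
      "f contour_integrable_on (linepath (Complex R d) (Complex (-R) d))"
      "f contour_integrable_on (linepath (Complex (-R) d) (Complex (-R) c))" if R: "R > R\<^sub>1" for R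
    using seg[OF R] continuous_on_subset[OF cont]
    by (auto intro!: contour_integrable_continuous_linepath)
  have eq: "B c R - B d R = K - V1 R - V2 R" if R: "R > R\<^sub>1" for R
  proof -
    let ?g = "rectpath (Complex (-R) c) (Complex R d)"
    have R0: "R > 0" using R R1 by simp
    have img: "path_image ?g \<subseteq> S - P"
      using seg[OF R] by (auto simp: rectpath_def Let_def path_image_join)
    have "contour_integral ?g f = 2 * pi * \<i> * (\<Sum>p\<in>P. winding_number ?g p * residue f p)"
    proof (rule Residue_theorem[OF S P(1)])
      show "f holomorphic_on S - P" using hol by (simp add: S_def)
      show "\<forall>z. z \<notin> S \<longrightarrow> winding_number ?g z = 0"
        using cd R0 by (intro allI impI winding_number_rectpath_outside) (auto simp: S_def in_cbox_complex_iff)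
    qed (use img in auto)
    also have "(\<Sum>p\<in>P. winding_number ?g p * residue f p) = (\<Sum>p\<in>P. residue f p)"
    proof (rule sum.cong[OF refl])
      fix p assume p: "p \<in> P"
      have "p \<in> box (Complex (-R) c) (Complex R d)"
        using P(2)[OF p] R1(3)[OF p] R by (auto simp: in_box_complex_iff)
      then show "winding_number ?g p * residue f p = residue f p"
        by (simp add: winding_number_rectpath)
    qed
    finally have "contour_integral ?g f = K" by (simp add: K_def)
    moreover have "contour_integral ?g f = contour_integral (linepath (Complex (-R) c) (Complex R c)) f
        + (V1 R + (contour_integral (linepath (Complex R d) (Complex (-R) d)) f + V2 R))"
      unfolding rectpath_def Let_def V1_def V2_def using ci[OF R]
      by (simp add: contour_integrable_join)
    moreover have "contour_integral (linepath (Complex R d) (Complex (-R) d)) f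
        = - contour_integral (linepath (Complex (-R) d) (Complex R d)) f"
      using contour_integral_reversepath[of "linepath (Complex (-R) d) (Complex R d)" f] by simp
    ultimately show ?thesis
      using contour_integral_horizontal[OF R0, of _ f] by (simp add: B_def algebra_simps)
  qed
  have "((\<lambda>R. C * exp (- (m * R)) * (d - c)) \<longlongrightarrow> C * 0 * (d - c)) at_top"
    using m by (intro tendsto_intros filterlim_compose[OF exp_at_bot]
      filterlim_compose[OF filterlim_uminus_at_bot_at_top]
      filterlim_tendsto_pos_mult_at_top[OF tendsto_const _ filterlim_ident])
  then have small: "((\<lambda>R. C * exp (- (m * R)) * (d - c)) \<longlongrightarrow> 0) at_top" by simp
  have bd: "norm (V1 R) \<le> C * exp (- (m * R)) * (d - c)" "norm (V2 R) \<le> C * exp (- (m * R)) * (d - c)"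
    if R: "R > R\<^sub>1" for R
  proof -
    have Rp: "\<bar>R\<bar> = R" "R\<^sub>0 \<le> R" using R R1 by auto
    have C: "0 \<le> C * exp (- (m * R))"
      using decay[of "Complex R c"] cd Rp by (simp add: order_trans[OF norm_ge_zero])
    have n: "norm (Complex R d - Complex R c) = d - c" "norm (Complex (-R) c - Complex (-R) d) = d - c"
      using cd by (simp_all add: complex_diff cmod_def)
    have bx: "norm (f x) \<le> C * exp (- (m * R))" if "\<bar>Re x\<bar> = R" "c \<le> Im x" "Im x \<le> d" for x
      using decay[of x] that Rp by metis
    show "norm (V1 R) \<le> C * exp (- (m * R)) * (d - c)"
      unfolding V1_def n(1)[symmetric]
      by (rule contour_integral_bound_linepath[OF ci(2)[OF R] C])
        (rule bx; use Rp cd in \<open>auto simp: closed_segment_same_Re closed_segment_eq_real_ivl split: if_splits\<close>)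
    show "norm (V2 R) \<le> C * exp (- (m * R)) * (d - c)"
      unfolding V2_def n(2)[symmetric]
      by (rule contour_integral_bound_linepath[OF ci(4)[OF R] C])
        (rule bx; use Rp cd in \<open>auto simp: closed_segment_same_Re closed_segment_eq_real_ivl split: if_splits\<close>)
  qed
  have V: "(V1 \<longlongrightarrow> 0) at_top" "(V2 \<longlongrightarrow> 0) at_top"
    using bd by (auto intro!: Lim_null_comparison[OF _ small] eventually_mono[OF eventually_gt_at_top[of R\<^sub>1]])
  have "((\<lambda>R. K - V1 R - V2 R) \<longlongrightarrow> K - 0 - 0) at_top"
    by (intro tendsto_diff V tendsto_const)
  then have "((\<lambda>R. B c R - B d R) \<longlongrightarrow> K) at_top"
    using eventually_mono[OF eventually_gt_at_top[of R\<^sub>1] eq[symmetric]]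
    by (simp add: Lim_transform_eventually)
  moreover have "((\<lambda>R. B c R - B d R) \<longlongrightarrow>
      (LBINT t. f (of_real t + \<i> * of_real c)) - (LBINT t. f (of_real t + \<i> * of_real d))) at_top"
    unfolding B_def by (intro tendsto_diff integral_symmetric_interval_tendsto int)
  ultimately show ?thesis
    unfolding K_def by (rule tendsto_unique[OF trivial_limit_at_top_linorder, symmetric])
qed

section \<open>The representation by hyperbolic sines\<close>

text \<open>The decay rates of the integrand of \<open>fermi_laplace_transform\<close> at the two ends are \<open>\<sigma>\<close> and
  \<open>1 - \<sigma>\<close>.\<close>

lemma exp_div_one_plus_exp_le:
  fixes \<sigma> t :: real
  assumes "0 < \<sigma>" "\<sigma> < 1"
  shows "exp (\<sigma> * t) / (1 + exp t) \<le> exp (- (min \<sigma> (1 - \<sigma>) * \<bar>t\<bar>))"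
proof (cases "t \<ge> 0")
  case True
  have "min \<sigma> (1 - \<sigma>) * t \<le> (1 - \<sigma>) * t" using True by (intro mult_right_mono) auto
  then have "exp (\<sigma> * t) \<le> exp (- (min \<sigma> (1 - \<sigma>) * t) + t)" by (simp add: algebra_simps)
  also have "\<dots> = exp (- (min \<sigma> (1 - \<sigma>) * t)) * exp t" by (rule exp_add)
  also have "\<dots> \<le> exp (- (min \<sigma> (1 - \<sigma>) * t)) * (1 + exp t)" by (intro mult_left_mono) auto
  finally show ?thesis using True by (simp add: pos_divide_le_eq add_pos_pos)
next
  case False
  have "min \<sigma> (1 - \<sigma>) * (- t) \<le> \<sigma> * (- t)" using False by (intro mult_right_mono) auto
  then have "exp (\<sigma> * t) \<le> exp (min \<sigma> (1 - \<sigma>) * t)" by simp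
  also have "\<dots> \<le> exp (min \<sigma> (1 - \<sigma>) * t) * (1 + exp t)" by (simp add: algebra_simps)
  finally show ?thesis using False by (simp add: pos_divide_le_eq add_pos_pos)
qed

lemma fermi_laplace_integrable:
  fixes s :: complex
  assumes s: "0 < Re s" "Re s < 1"
  shows "integrable lborel (\<lambda>u. exp (s * of_real u) / (1 + exp (complex_of_real u)))"
proof (rule Bochner_Integration.integrable_bound)
  show "integrable lborel (\<lambda>t. exp (- (min (Re s) (1 - Re s) * \<bar>t\<bar>)))"
    using s by (intro integrable_exp_minus_abs) auto
  show "AE u in lborel. norm (exp (s * of_real u) / (1 + exp (complex_of_real u)))
      \<le> norm (exp (- (min (Re s) (1 - Re s) * \<bar>u\<bar>)))"
    using exp_div_one_plus_exp_le[OF s]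
    by (intro AE_I2) (simp only: norm_divide norm_one_plus_exp_of_real norm_exp_eq_Re, simp)
qed simp

text \<open>The integrand is multiplied by the constant \<open>exp (2 \<pi> \<i> s)\<close> when the line of integration is moved up
  by \<open>2 \<pi>\<close>, and the only pole passed is \<open>\<i> \<pi>\<close>.\<close>

lemma fermi_laplace_transform:
  fixes s :: complex
  assumes s: "0 < Re s" "Re s < 1"
  shows "(LBINT u. exp (s * of_real u) / (1 + exp (complex_of_real u))) = of_real pi / sin (of_real pi * s)"
proof -
  define f where "f = (\<lambda>x. exp (s * x) / (1 + exp x))"
  define I where "I = (LBINT u. f (of_real u))"
  define p where "p = \<i> * complex_of_real pi"
  have p: "exp p = - 1" by (simp add: p_def)
  have int: "integrable lborel (\<lambda>u. f (of_real u))"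
    unfolding f_def using fermi_laplace_integrable[OF s] .
  have shift: "f (of_real u + \<i> * of_real (2 * pi)) = exp (2 * of_real pi * \<i> * s) * f (of_real u)" for u
  proof -
    have "exp (of_real u + \<i> * of_real (2 * pi)) = exp (complex_of_real u)"
    proof -
      have "exp (\<i> * of_real (2 * pi)) = 1"
        using exp_two_pi_i by (simp only: of_real_mult of_real_numeral mult_ac)
      then show ?thesis by (simp add: exp_add)
    qed
    moreover have "exp (s * (of_real u + \<i> * of_real (2 * pi))) = exp (2 * of_real pi * \<i> * s) * exp (s * of_real u)"
      unfolding exp_add[symmetric] by (rule arg_cong[of _ _ exp]) (simp add: algebra_simps)
    ultimately show ?thesis by (simp add: f_def)
  qed
  have nz: "1 + exp x \<noteq> 0" if x: "- pi < Im x" "Im x < 3 * pi" "x \<noteq> p" for x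
  proof
    assume "1 + exp x = 0"
    then have "exp x = -1" by (simp add: add_eq_0_iff)
    then obtain n :: int where n: "x = \<i> * of_real pi * of_int (2 * n + 1)"
      unfolding exp_eq_minus_one_iff by blast
    have "Im x = pi * of_int (2 * n + 1)" by (simp add: n)
    then have "- 1 * pi < of_int (2 * n + 1) * pi" "of_int (2 * n + 1) * pi < 3 * pi"
      using x by (simp_all add: mult.commute)
    then have "- 1 < real_of_int (2 * n + 1)" "real_of_int (2 * n + 1) < 3"
      by (simp_all only: mult_less_cancel_right_pos[OF pi_gt_zero])
    then have "n = 0" by linarith
    then show False using n x(3) by (simp add: p_def)
  qed
  have res: "residue f p = - exp (s * p)"
  proof -
    have "residue f p = exp (s * p) / exp p" unfolding f_def
      by (rule residue_simple_pole_deriv[where s = UNIV])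
        (auto intro!: holomorphic_intros derivative_eq_intros simp: p)
    then show ?thesis by (simp add: p)
  qed
  have "(LBINT u. f (of_real u + \<i> * of_real 0)) - (LBINT u. f (of_real u + \<i> * of_real (2 * pi)))
      = 2 * pi * \<i> * (\<Sum>p\<in>{p}. residue f p)"
  proof (rule strip_residue_theorem[where \<alpha> = "- pi" and \<beta> = "3 * pi" and R\<^sub>0 = 1
        and m = "min (Re s) (1 - Re s)" and C = "4 * exp (2 * pi * \<bar>Im s\<bar>)"])
    show "f holomorphic_on {x. - pi < Im x \<and> Im x < 3 * pi} - {p}"
      unfolding f_def using nz by (intro holomorphic_intros) auto
    fix x :: complex assume x: "0 \<le> Im x" "Im x \<le> 2 * pi" "1 \<le> \<bar>Re x\<bar>"
    have "- (Im s * Im x) \<le> \<bar>Im s\<bar> * Im x" using x by (metis abs_ge_minus_self minus_mult_left mult_right_mono)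
    also have "\<dots> \<le> \<bar>Im s\<bar> * (2 * pi)" using x by (intro mult_left_mono) auto
    finally have e: "exp (Re (s * x)) \<le> exp (2 * pi * \<bar>Im s\<bar>) * exp (Re s * Re x)"
      unfolding exp_add[symmetric] by (simp add: algebra_simps)
    have pos: "0 < 1 + exp (Re x)" by (simp add: add_pos_pos)
    have "norm (f x) \<le> (exp (2 * pi * \<bar>Im s\<bar>) * exp (Re s * Re x)) / ((1 + exp (Re x)) / 4)"
      unfolding f_def norm_divide norm_exp_eq_Re
      using e one_plus_exp_ge_far[OF x(3)] pos by (intro frac_le) auto
    also have "\<dots> = 4 * exp (2 * pi * \<bar>Im s\<bar>) * (exp (Re s * Re x) / (1 + exp (Re x)))" by simp
    also have "\<dots> \<le> 4 * exp (2 * pi * \<bar>Im s\<bar>) * exp (- (min (Re s) (1 - Re s) * \<bar>Re x\<bar>))"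
      by (intro mult_left_mono exp_div_one_plus_exp_le s) auto
    finally show "norm (f x) \<le> 4 * exp (2 * pi * \<bar>Im s\<bar>) * exp (- (min (Re s) (1 - Re s) * \<bar>Re x\<bar>))" .
  next
    show "integrable lborel (\<lambda>t. f (of_real t + \<i> * of_real (2 * pi)))"
      unfolding shift using int by simp
  qed (use int s in \<open>auto simp: p_def\<close>)
  then have "I - exp (2 * of_real pi * \<i> * s) * I = - (2 * pi * \<i> * exp (s * p))"
    unfolding shift by (simp add: I_def res)
  moreover have "exp (2 * of_real pi * \<i> * s) = exp (s * p) * exp (s * p)"
    unfolding exp_add[symmetric] by (simp add: p_def algebra_simps)
  ultimately have "exp (s * p) * ((exp (- (s * p)) - exp (s * p)) * I) = exp (s * p) * (- (2 * pi * \<i>))"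
    by (simp add: algebra_simps flip: exp_add)
  then have "(exp (- (s * p)) - exp (s * p)) * I = - (2 * pi * \<i>)"
    by (simp only: mult_cancel_left exp_not_eq_zero simp_thms)
  moreover have "exp (- (s * p)) - exp (s * p) = - (2 * \<i> * sin (of_real pi * s))"
  proof -
    have "sin (of_real pi * s) = (exp (s * p) - exp (- (s * p))) / (2 * \<i>)"
      by (simp add: sin_exp_eq p_def mult_ac)
    then have "2 * \<i> * sin (of_real pi * s) = exp (s * p) - exp (- (s * p))" by simp
    then show ?thesis by simp
  qed
  ultimately have "- (2 * \<i> * sin (of_real pi * s)) * I = - (2 * pi * \<i>)" by simp
  then have "(2 * \<i>) * (sin (of_real pi * s) * I) = (2 * \<i>) * of_real pi" by (simp add: mult_ac)
  then have k: "sin (of_real pi * s) * I = of_real pi" by simp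
  then have "sin (of_real pi * s) \<noteq> 0" by auto
  then have "I = of_real pi / sin (of_real pi * s)" using k by (simp add: field_simps)
  then show ?thesis by (simp add: I_def f_def)
qed

text \<open>Estimates of \<open>1 + exp w\<close> become estimates of \<open>sinh y\<close> through
  \<open>2 sinh y = exp y * (1 + exp (\<i> \<pi> - 2 y))\<close>.\<close>

lemma norm_sinh_ge:
  fixes y :: complex and c :: real
  defines "w \<equiv> - 2 * y + \<i> * of_real pi"
  assumes "c \<ge> 0" and c: "c * (1 + exp (Re w)) \<le> norm (1 + exp w)"
  shows "c / 2 * exp \<bar>Re y\<bar> \<le> norm (sinh y)"
proof -
  have ew: "exp w = - exp (- 2 * y)" unfolding w_def exp_add by simp
  have "c * (1 + exp (- 2 * Re y)) * exp (Re y) \<le> norm (1 + exp w) * exp (Re y)"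
    using c by (intro mult_right_mono) (simp_all add: w_def)
  also have "norm (1 + exp w) * exp (Re y) = norm (exp y * (1 + exp w))"
    by (simp add: norm_mult)
  also have "exp y * (1 + exp w) = 2 * sinh y"
    unfolding ew sinh_field_def by (simp add: algebra_simps flip: exp_add)
  finally have "c * ((1 + exp (- 2 * Re y)) * exp (Re y)) \<le> 2 * norm (sinh y)"
    by (simp add: norm_mult mult.assoc)
  moreover have "(1 + exp (- 2 * Re y)) * exp (Re y) = exp (Re y) + exp (- Re y)"
    by (simp add: algebra_simps flip: exp_add)
  moreover have "exp \<bar>Re y\<bar> \<le> exp (Re y) + exp (- Re y)" by (simp add: abs_if)
  then have "c * exp \<bar>Re y\<bar> \<le> c * (exp (Re y) + exp (- Re y))" using \<open>c \<ge> 0\<close> by (rule mult_left_mono)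
  ultimately show ?thesis by simp
qed

lemma sinh_lower_bound:
  fixes \<kappa> A :: real
  assumes "0 < \<kappa>" "0 \<le> A"
  obtains c where "c > 0"
    "\<And>y \<alpha>. \<bar>\<alpha>\<bar> \<le> A \<Longrightarrow> \<bar>pi - 2 * (Im y + \<alpha> * Re y)\<bar> \<le> pi - \<kappa> \<Longrightarrow> c * exp \<bar>Re y\<bar> \<le> norm (sinh (y::complex))"
proof -
  obtain c where c: "c > 0" "\<And>w \<alpha>. \<bar>\<alpha>\<bar> \<le> A \<Longrightarrow> \<bar>Im w + \<alpha> * Re w\<bar> \<le> pi - \<kappa> \<Longrightarrow> c * (1 + exp (Re w)) \<le> norm (1 + exp w)"
    using one_plus_exp_lower_bound[OF assms] by metis
  show thesis
  proof (rule that[of "c / 2"])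
    fix y :: complex and \<alpha> :: real
    assume a: "\<bar>\<alpha>\<bar> \<le> A" "\<bar>pi - 2 * (Im y + \<alpha> * Re y)\<bar> \<le> pi - \<kappa>"
    show "c / 2 * exp \<bar>Re y\<bar> \<le> norm (sinh y)"
      using a c(1) by (intro norm_sinh_ge c(2)[of \<alpha>]) (simp_all add: algebra_simps)
  qed (use c in auto)
qed

lemma sinh_lower_bound_on_line:
  fixes \<epsilon> :: real
  assumes "0 < \<epsilon>" "\<epsilon> < pi"
  obtains c where "c > 0" "\<And>t. c * exp \<bar>t\<bar> \<le> norm (sinh (complex_of_real t + \<i> * of_real \<epsilon>))"
proof -
  define \<kappa> where "\<kappa> = pi - \<bar>pi - 2 * \<epsilon>\<bar>"
  have \<kappa>: "\<kappa> > 0" using assms by (simp add: \<kappa>_def)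
  obtain c where c: "c > 0" "\<And>y \<alpha>. \<bar>\<alpha>\<bar> \<le> 0 \<Longrightarrow> \<bar>pi - 2 * (Im y + \<alpha> * Re y)\<bar> \<le> pi - \<kappa> \<Longrightarrow> c * exp \<bar>Re y\<bar> \<le> norm (sinh (y::complex))"
    using sinh_lower_bound[OF \<kappa>, of 0] by auto
  show thesis
    by (rule that[OF c(1)]) (use c(2)[of 0 "complex_of_real _ + \<i> * of_real \<epsilon>"] in \<open>simp add: \<kappa>_def\<close>)
qed

lemma holomorphic_on_sinh':
  fixes f :: "complex \<Rightarrow> complex"
  shows "f holomorphic_on A \<Longrightarrow> (\<lambda>x. sinh (f x)) holomorphic_on A"
  unfolding sinh_field_def by (intro holomorphic_intros) auto

text \<open>The integrand is multiplied by \<open>- exp y\<close> when the line of integration is moved down by \<open>\<pi>\<close>, and the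
  only pole passed is \<open>0\<close>, with residue \<open>1\<close>.\<close>

lemma fermi_fourier:
  fixes y \<epsilon> :: real
  assumes \<epsilon>: "0 < \<epsilon>" "\<epsilon> < pi"
  defines "f \<equiv> \<lambda>x. exp (\<i> * x * of_real y / of_real pi) / sinh x"
  shows "integrable lborel (\<lambda>t. f (of_real t + \<i> * of_real \<epsilon>))"
    and "1 / (1 + exp (complex_of_real y)) = \<i> / (2 * of_real pi) * (LBINT t. f (of_real t + \<i> * of_real \<epsilon>))"
proof -
  define I where "I = (LBINT t. f (of_real t + \<i> * of_real \<epsilon>))"
  have numer: "norm (exp (\<i> * x * of_real y / of_real pi)) \<le> exp \<bar>y\<bar>" if "\<bar>Im x\<bar> \<le> pi" for x
  proof -
    have "Re (\<i> * x * of_real y / of_real pi) = - (Im x * y / pi)" by simp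
    also have "\<dots> \<le> \<bar>Im x / pi\<bar> * \<bar>y\<bar>" by (metis abs_ge_minus_self abs_mult times_divide_eq_left)
    also have "\<dots> \<le> 1 * \<bar>y\<bar>" using that by (intro mult_right_mono) auto
    finally show ?thesis by simp
  qed
  show int: "integrable lborel (\<lambda>t. f (of_real t + \<i> * of_real \<epsilon>))"
  proof -
    obtain c where c: "c > 0" "\<And>t. c * exp \<bar>t\<bar> \<le> norm (sinh (complex_of_real t + \<i> * of_real \<epsilon>))"
      using sinh_lower_bound_on_line[OF \<epsilon>] by blast
    show ?thesis
    proof (rule Bochner_Integration.integrable_bound)
      show "integrable lborel (\<lambda>t. exp \<bar>y\<bar> / c * exp (- (1 * \<bar>t\<bar>)))"
        by (intro integrable_mult_right integrable_exp_minus_abs) auto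
      show "AE t in lborel. norm (f (of_real t + \<i> * of_real \<epsilon>)) \<le> norm (exp \<bar>y\<bar> / c * exp (- (1 * \<bar>t\<bar>)))"
      proof (rule AE_I2)
        fix t :: real
        have "norm (f (of_real t + \<i> * of_real \<epsilon>)) \<le> exp \<bar>y\<bar> / (c * exp \<bar>t\<bar>)"
          unfolding f_def norm_divide using c \<epsilon> by (intro frac_le numer) auto
        also have "\<dots> = exp \<bar>y\<bar> / c * exp (- (1 * \<bar>t\<bar>))"
          by (simp add: exp_minus divide_inverse)
        finally show "norm (f (of_real t + \<i> * of_real \<epsilon>)) \<le> norm (exp \<bar>y\<bar> / c * exp (- (1 * \<bar>t\<bar>)))"
          unfolding real_norm_def by linarith
      qed
    qed (simp add: f_def sinh_field_def)
  qed
  have shift: "f (of_real t + \<i> * of_real (\<epsilon> - pi)) = - exp (of_real y) * f (of_real t + \<i> * of_real \<epsilon>)" for t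
  proof -
    define x where "x = of_real t + \<i> * of_real \<epsilon>"
    have x: "of_real t + \<i> * of_real (\<epsilon> - pi) = x - \<i> * of_real pi"
      by (simp add: x_def algebra_simps)
    have "exp (\<i> * (x - \<i> * of_real pi) * of_real y / of_real pi) = exp (of_real y) * exp (\<i> * x * of_real y / of_real pi)"
      unfolding exp_add[symmetric] by (rule arg_cong[of _ _ exp]) (simp add: field_simps)
    moreover have "sinh (x - \<i> * of_real pi) = - sinh x"
      by (simp add: sinh_field_def exp_diff exp_add exp_minus field_simps)
    ultimately show ?thesis unfolding x x_def[symmetric] f_def by simp
  qed
  have nz: "sinh x \<noteq> 0" if x: "- pi < Im x" "Im x < pi" "x \<noteq> 0" for x
  proof
    assume "sinh x = 0"
    then have "exp x = exp (- x)" by (simp add: sinh_field_def)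
    then obtain n :: int where n: "x = - x + (of_int (2 * n) * pi) * \<i>"
      unfolding exp_eq by blast
    then have "2 * x = 2 * (of_int n * of_real pi * \<i>)" by (simp add: eq_neg_iff_add_eq_0 algebra_simps)
    then have n: "x = of_int n * of_real pi * \<i>" by simp
    then have "Im x = of_int n * pi" by simp
    then have "- 1 * pi < of_int n * pi" "of_int n * pi < 1 * pi"
      using x by simp_all
    then have "- 1 < real_of_int n" "real_of_int n < 1"
      by (simp_all only: mult_less_cancel_right_pos[OF pi_gt_zero])
    then have "n = 0" by linarith
    then show False using n x(3) by simp
  qed
  have res: "residue f 0 = 1"
  proof -
    have "residue f 0 = exp (\<i> * 0 * of_real y / of_real pi) / 1" unfolding f_def
      by (rule residue_simple_pole_deriv[where s = UNIV])
        (auto intro!: holomorphic_on_sinh' holomorphic_intros derivative_eq_intros)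
    then show ?thesis by simp
  qed
  have "(LBINT t. f (of_real t + \<i> * of_real (\<epsilon> - pi))) - (LBINT t. f (of_real t + \<i> * of_real \<epsilon>))
      = 2 * pi * \<i> * (\<Sum>p\<in>{0}. residue f p)"
  proof (rule strip_residue_theorem[where \<alpha> = "- pi" and \<beta> = pi and R\<^sub>0 = 1 and m = 1 and C = "8 * exp \<bar>y\<bar>"])
    show "f holomorphic_on {x. - pi < Im x \<and> Im x < pi} - {0}"
      unfolding f_def using nz by (intro holomorphic_on_sinh' holomorphic_intros) auto
    fix x :: complex assume x: "\<epsilon> - pi \<le> Im x" "Im x \<le> \<epsilon>" "1 \<le> \<bar>Re x\<bar>"
    have A: "1 / 4 / 2 * exp \<bar>Re x\<bar> \<le> norm (sinh x)"
    proof (rule norm_sinh_ge)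
      have "1 \<le> \<bar>Re (- 2 * x + \<i> * of_real pi)\<bar>" using x(3) by simp
      have quarter: "1 / 4 * a \<le> b" if "a \<le> 4 * b" for a b :: real using that by simp
      show "1 / 4 * (1 + exp (Re (- 2 * x + \<i> * of_real pi))) \<le> norm (1 + exp (- 2 * x + \<i> * of_real pi))"
        by (rule quarter[OF one_plus_exp_ge_far]) fact
    qed simp
    have B: "\<bar>Im x\<bar> \<le> pi" using x(1,2) \<epsilon> by linarith
    have "norm (f x) \<le> exp \<bar>y\<bar> / (1 / 4 / 2 * exp \<bar>Re x\<bar>)"
      unfolding f_def norm_divide by (rule frac_le[OF _ numer[OF B] _ A]) auto
    also have "\<dots> = 8 * exp \<bar>y\<bar> * inverse (exp \<bar>Re x\<bar>)"
      by (simp only: divide_inverse inverse_mult_distrib) simp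
    also have "inverse (exp \<bar>Re x\<bar>) = exp (- (1 * \<bar>Re x\<bar>))"
      by (simp only: exp_minus mult_1_left)
    finally show "norm (f x) \<le> 8 * exp \<bar>y\<bar> * exp (- (1 * \<bar>Re x\<bar>))" .
  next
    show "integrable lborel (\<lambda>t. f (of_real t + \<i> * of_real (\<epsilon> - pi)))"
      unfolding shift using int by simp
  qed (use int \<epsilon> in auto)
  then have I: "- exp (of_real y) * I - I = 2 * of_real pi * \<i>"
    unfolding shift by (simp add: I_def res)
  have "(1 + exp (complex_of_real y)) * I = - (- exp (of_real y) * I - I)"
    by (simp add: algebra_simps)
  also note I
  finally have "\<i> / (2 * of_real pi) * ((1 + exp (complex_of_real y)) * I) = 1" by simp
  then show "1 / (1 + exp (complex_of_real y)) = \<i> / (2 * of_real pi) * I"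
    using one_plus_exp_of_real_nonzero[of y] by (simp add: divide_eq_eq mult_ac)
qed

text \<open>Here \<open>x - b * u\<close> is real for all \<open>u\<close>, so that the Fourier integral applies to the first
  factor of the integrand. After exchanging the integrations, the integral over \<open>u\<close> is a Laplace
  transform as computed in \<open>fermi_laplace_transform\<close>, and it produces the second hyperbolic sine.\<close>

lemma F_int_sinh_imaginary:
  fixes x b \<epsilon> :: real
  assumes b: "b > 0" and \<epsilon>: "0 < \<epsilon>" "\<epsilon> < pi" "\<epsilon> * b < pi"
  shows "F_int (of_real x) (\<i> * of_real b)
       = 1 / 2 * (LBINT t. sinh_integrand (\<i> * of_real b) (of_real x) (of_real t + \<i> * of_real \<epsilon>))"
proof -
  define X where "X = (\<lambda>t::real. complex_of_real t + \<i> * of_real \<epsilon>)"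
  define g where "g = (\<lambda>t. exp (\<i> * X t * of_real x / of_real pi) / sinh (X t))"
  define s where "s = (\<lambda>t. - \<i> * X t * of_real b / of_real pi)"
  define h where "h = (\<lambda>t u. exp (s t * of_real u) / (1 + exp (complex_of_real u)))"
  have Re_s: "Re (s t) = \<epsilon> * b / pi" for t by (simp add: s_def X_def)
  have s01: "0 < Re (s t)" "Re (s t) < 1" for t
    unfolding Re_s using b \<epsilon> by (simp_all add: field_simps)
  obtain c where c: "c > 0" "\<And>t. c * exp \<bar>t\<bar> \<le> norm (sinh (X t))"
    using sinh_lower_bound_on_line[OF \<epsilon>(1,2)] unfolding X_def by blast
  have Xnz: "sinh (X t) \<noteq> 0" for t using c(2)[of t] mult_pos_pos[OF c(1) exp_gt_zero[of "\<bar>t\<bar>"]] by auto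
  have g_int: "integrable lborel g"
    using fermi_fourier(1)[OF \<epsilon>(1,2), of x] by (simp add: g_def X_def)
  have split: "exp (\<i> * X t * of_real (x - b * u) / of_real pi) / sinh (X t) * (1 / (1 + exp (complex_of_real u))) = g t * h t u" for t u
  proof -
    have "exp (\<i> * X t * of_real (x - b * u) / of_real pi) = exp (\<i> * X t * of_real x / of_real pi) * exp (s t * of_real u)"
      unfolding exp_add[symmetric] by (rule arg_cong[of _ _ exp]) (simp add: s_def field_simps)
    then show ?thesis by (simp add: g_def h_def)
  qed
  have kern: "F_kernel (of_real x) (\<i> * of_real b) u = \<i> / (2 * of_real pi) * (LBINT t. g t * h t u)" for u
  proof -
    have "of_real x + \<i> * (\<i> * of_real b) * complex_of_real u = of_real (x - b * u)" by simp
    then have "F_kernel (of_real x) (\<i> * of_real b) u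
        = 1 / (1 + exp (complex_of_real (x - b * u))) * (1 / (1 + exp (complex_of_real u)))" by simp
    also have "\<dots> = \<i> / (2 * of_real pi) * ((LBINT t. exp (\<i> * X t * of_real (x - b * u) / of_real pi) / sinh (X t)) * (1 / (1 + exp (complex_of_real u))))"
      using fermi_fourier(2)[OF \<epsilon>(1,2), of "x - b * u"] by (simp only: X_def mult.assoc)
    also have "(LBINT t. exp (\<i> * X t * of_real (x - b * u) / of_real pi) / sinh (X t)) * (1 / (1 + exp (complex_of_real u)))
        = (LBINT t. g t * h t u)"
      unfolding split[symmetric] by (rule integral_mult_left_zero[symmetric])
    finally show ?thesis .
  qed
  have h_norm: "norm (h t u) = exp (\<epsilon> * b / pi * u) / (1 + exp u)" for t u
    unfolding h_def norm_divide norm_one_plus_exp_of_real norm_exp_eq_Re by (simp add: Re_s)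
  have h_int: "integrable lborel (h t)" for t
    unfolding h_def using fermi_laplace_integrable[OF s01] .
  have meas: "(\<lambda>(t, u). g t * h t u) \<in> borel_measurable (lborel \<Otimes>\<^sub>M lborel)"
  proof -
    have "continuous_on UNIV (\<lambda>p. g (fst p) * h (fst p) (snd p))"
      unfolding g_def h_def s_def using Xnz one_plus_exp_of_real_nonzero
      by (intro continuous_intros) (auto simp: X_def intro!: continuous_intros)
    then show ?thesis
      unfolding lborel_prod by (simp add: case_prod_beta' borel_measurable_continuous_onI)
  qed
  have "integrable (lborel \<Otimes>\<^sub>M lborel) (\<lambda>(t, u). g t * h t u)"
  proof (rule lborel_pair.Fubini_integrable[OF meas])
    show "integrable lborel (\<lambda>t. LBINT u. norm (case (t, u) of (t, u) \<Rightarrow> g t * h t u))"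
    proof -
      have "(LBINT u. norm (case (t, u) of (t, u) \<Rightarrow> g t * h t u))
          = norm (g t) * (LBINT u. exp (\<epsilon> * b / pi * u) / (1 + exp u))" for t
        by (simp only: prod.case norm_mult h_norm integral_mult_right_zero)
      then show ?thesis using g_int by simp
    qed
    show "AE t in lborel. integrable lborel (\<lambda>u. case (t, u) of (t, u) \<Rightarrow> g t * h t u)"
      using h_int by (intro AE_I2) simp
  qed
  then have fub: "(LBINT u. LBINT t. g t * h t u) = (LBINT t. LBINT u. g t * h t u)"
    by (rule lborel_pair.Fubini_integral)
  have inner: "(LBINT u. g t * h t u) = - (\<i> * of_real pi) * sinh_integrand (\<i> * of_real b) (of_real x) (X t)" for t
  proof -
    have "(LBINT u. g t * h t u) = g t * (LBINT u. h t u)"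
      by (rule integral_mult_right_zero)
    also have "\<dots> = g t * (of_real pi / sin (of_real pi * s t))"
      unfolding h_def fermi_laplace_transform[OF s01] ..
    also have "of_real pi * s t = - (\<i> * (of_real b * X t))" by (simp add: s_def)
    also have "sin (- (\<i> * (of_real b * X t))) = - \<i> * sinh (of_real b * X t)"
      by (simp add: sinh_conv_sin)
    also have "sinh (of_real b * X t) = - sinh (\<i> * (\<i> * of_real b) * X t)"
      by (simp flip: sinh_minus)
    also have "of_real pi / (- \<i> * - sinh (\<i> * (\<i> * of_real b) * X t))
        = - (\<i> * of_real pi) / sinh (\<i> * (\<i> * of_real b) * X t)"
      by (simp add: divide_inverse)
    finally show ?thesis
      unfolding g_def sinh_integrand_def by (simp add: mult_ac)
  qed
  have "F_int (of_real x) (\<i> * of_real b) = \<i> / (2 * of_real pi) * (LBINT u. LBINT t. g t * h t u)"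
    unfolding F_int_def kern by (rule integral_mult_right_zero)
  also have "\<dots> = 1 / 2 * (LBINT t. sinh_integrand (\<i> * of_real b) (of_real x) (X t))"
    unfolding fub inner by simp
  finally show ?thesis by (simp add: X_def)
qed

lemma sinh_on_line_nonzero:
  fixes \<epsilon> t :: real
  assumes "0 < \<epsilon>" "\<epsilon> < pi"
  shows "sinh (complex_of_real t + \<i> * of_real \<epsilon>) \<noteq> 0"
proof -
  obtain c where c: "c > 0" "c * exp \<bar>t\<bar> \<le> norm (sinh (complex_of_real t + \<i> * of_real \<epsilon>))"
    using sinh_lower_bound_on_line[OF assms] by blast
  have "0 < norm (sinh (complex_of_real t + \<i> * of_real \<epsilon>))"
    by (rule less_le_trans[OF mult_pos_pos[OF c(1) exp_gt_zero] c(2)])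
  then show ?thesis by (simp only: zero_less_norm_iff not_False_eq_True)
qed

text \<open>In the coordinates of \<open>sinh_lower_bound\<close> with slope \<open>Re \<tau> / Im \<tau>\<close>, the line on which the second
  hyperbolic sine is evaluated is, up to sign, horizontal. The condition \<open>2 \<epsilon> \<bar>\<tau>\<bar>\<^sup>2 < \<pi> Im \<tau>\<close> says that
  its height lies below \<open>\<pi> / 2\<close>.\<close>

lemma rotated_line_height:
  fixes \<epsilon> t :: real and \<tau> :: complex
  assumes "Im \<tau> > 0"
  defines "y \<equiv> - (\<i> * \<tau> * (of_real t + \<i> * of_real \<epsilon>))"
  shows "Im y + Re \<tau> / Im \<tau> * Re y = \<epsilon> * (norm \<tau>)\<^sup>2 / Im \<tau>"
  using assms unfolding y_def cmod_power2 by (simp add: field_simps power2_eq_square)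

lemma sinh_rotated_nonzero:
  fixes \<epsilon> t :: real and \<tau> :: complex
  assumes "Im \<tau> > 0" "0 < \<epsilon>" "2 * \<epsilon> * (norm \<tau>)\<^sup>2 < pi * Im \<tau>"
  shows "sinh (\<i> * \<tau> * (of_real t + \<i> * of_real \<epsilon>)) \<noteq> 0"
proof -
  define y where "y = - (\<i> * \<tau> * (of_real t + \<i> * of_real \<epsilon>))"
  define S where "S = 2 * (\<epsilon> * (norm \<tau>)\<^sup>2 / Im \<tau>)"
  have "norm \<tau> > 0" using assms(1) by auto
  then have S: "0 < S" "S < pi" using assms by (simp_all add: S_def field_simps)
  then have "0 < pi - \<bar>pi - S\<bar>" by linarith
  from sinh_lower_bound[OF this, of "\<bar>Re \<tau> / Im \<tau>\<bar>"]
  obtain c where c: "c > 0" "\<And>y \<alpha>. \<bar>\<alpha>\<bar> \<le> \<bar>Re \<tau> / Im \<tau>\<bar> \<Longrightarrow>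
      \<bar>pi - 2 * (Im y + \<alpha> * Re y)\<bar> \<le> pi - (pi - \<bar>pi - S\<bar>) \<Longrightarrow> c * exp \<bar>Re y\<bar> \<le> norm (sinh (y::complex))"
    by (metis abs_ge_zero)
  have "c * exp \<bar>Re y\<bar> \<le> norm (sinh y)"
    using rotated_line_height[OF assms(1), of t \<epsilon>]
    by (intro c(2)[of "Re \<tau> / Im \<tau>"]) (simp_all add: y_def S_def)
  then have "0 < norm (sinh y)"
    by (rule less_le_trans[OF mult_pos_pos[OF c(1) exp_gt_zero]])
  then show ?thesis by (simp only: zero_less_norm_iff y_def sinh_minus neg_equal_0_iff_equal not_False_eq_True)
qed

text \<open>The factor \<open>exp (\<i> z x / \<pi>)\<close> grows at most like \<open>exp (Im \<tau> * \<bar>t\<bar>)\<close> because \<open>\<bar>Im z\<bar> < \<pi> Im \<tau>\<close>, and this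
  is compensated by the second hyperbolic sine; the first one provides the decay.\<close>

lemma sinh_integrand_locally_dominated:
  fixes \<epsilon> :: real and \<tau>\<^sub>0 z\<^sub>0 :: complex
  assumes \<epsilon>: "0 < \<epsilon>" "\<epsilon> < pi" "2 * \<epsilon> * (norm \<tau>\<^sub>0)\<^sup>2 < pi * Im \<tau>\<^sub>0"
    and \<tau>: "Im \<tau>\<^sub>0 > 0" and z: "\<bar>Im z\<^sub>0\<bar> < pi * Im \<tau>\<^sub>0"
  shows "\<exists>C m. m > 0 \<and> (\<forall>\<^sub>F p in nhds (z\<^sub>0, \<tau>\<^sub>0). \<forall>t.
    norm (sinh_integrand (snd p) (fst p) (of_real t + \<i> * of_real \<epsilon>)) \<le> C * exp (- (m * \<bar>t\<bar>)))"
proof -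
  define s where "s = (\<lambda>p::complex \<times> complex. \<bar>pi - 2 * (\<epsilon> * (norm (snd p))\<^sup>2 / Im (snd p))\<bar>)"
  define q where "q = (\<lambda>p::complex \<times> complex. \<bar>Re (snd p) / Im (snd p)\<bar>)"
  define r where "r = (\<lambda>p::complex \<times> complex. \<bar>Im (fst p)\<bar> - pi * Im (snd p))"
  define \<kappa> where "\<kappa> = (pi - s (z\<^sub>0, \<tau>\<^sub>0)) / 2"
  define A where "A = q (z\<^sub>0, \<tau>\<^sub>0) + 1"
  define M where "M = \<bar>Re z\<^sub>0\<bar> + 1"
  define N where "N = \<bar>Re \<tau>\<^sub>0\<bar> + 1"
  have \<kappa>: "\<kappa> > 0"
  proof -
    have "norm \<tau>\<^sub>0 > 0" using \<tau> by auto
    then have "0 < 2 * (\<epsilon> * (norm \<tau>\<^sub>0)\<^sup>2 / Im \<tau>\<^sub>0)" "2 * (\<epsilon> * (norm \<tau>\<^sub>0)\<^sup>2 / Im \<tau>\<^sub>0) < pi"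
      using \<epsilon> \<tau> by (simp_all add: field_simps)
    then have "s (z\<^sub>0, \<tau>\<^sub>0) < pi" unfolding s_def snd_conv by linarith
    then show ?thesis by (simp add: \<kappa>_def)
  qed
  have A: "A \<ge> 0" by (simp add: A_def q_def)
  obtain c1 where c1: "c1 > 0" "\<And>t. c1 * exp \<bar>t\<bar> \<le> norm (sinh (complex_of_real t + \<i> * of_real \<epsilon>))"
    using sinh_lower_bound_on_line[OF \<epsilon>(1,2)] by blast
  obtain c2 where c2: "c2 > 0" "\<And>y \<alpha>. \<bar>\<alpha>\<bar> \<le> A \<Longrightarrow> \<bar>pi - 2 * (Im y + \<alpha> * Re y)\<bar> \<le> pi - \<kappa> \<Longrightarrow> c2 * exp \<bar>Re y\<bar> \<le> norm (sinh (y::complex))"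
    using sinh_lower_bound[OF \<kappa> A] by metis
  have T: "(s \<longlongrightarrow> s (z\<^sub>0, \<tau>\<^sub>0)) (nhds (z\<^sub>0, \<tau>\<^sub>0))" "(q \<longlongrightarrow> q (z\<^sub>0, \<tau>\<^sub>0)) (nhds (z\<^sub>0, \<tau>\<^sub>0))"
    "(r \<longlongrightarrow> r (z\<^sub>0, \<tau>\<^sub>0)) (nhds (z\<^sub>0, \<tau>\<^sub>0))"
    "((\<lambda>p. \<bar>Re (fst p)\<bar>) \<longlongrightarrow> \<bar>Re z\<^sub>0\<bar>) (nhds (z\<^sub>0, \<tau>\<^sub>0))"
    "((\<lambda>p. \<bar>Re (snd p)\<bar>) \<longlongrightarrow> \<bar>Re \<tau>\<^sub>0\<bar>) (nhds (z\<^sub>0, \<tau>\<^sub>0))"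
    "((\<lambda>p. Im (snd p)) \<longlongrightarrow> Im \<tau>\<^sub>0) (nhds (z\<^sub>0, \<tau>\<^sub>0))"
    unfolding s_def q_def r_def using \<tau>
    by (auto intro!: tendsto_eq_intros filterlim_ident simp: nhds_prod[symmetric])
  have "s (z\<^sub>0, \<tau>\<^sub>0) < pi - \<kappa>" "q (z\<^sub>0, \<tau>\<^sub>0) < A" "r (z\<^sub>0, \<tau>\<^sub>0) < 0" "\<bar>Re z\<^sub>0\<bar> < M" "\<bar>Re \<tau>\<^sub>0\<bar> < N" "0 < Im \<tau>\<^sub>0"
    using \<kappa> \<tau> z by (auto simp: \<kappa>_def A_def M_def N_def r_def field_simps)
  note ev = eventually_conj[OF order_tendstoD(2)[OF T(1) this(1)] eventually_conj[OF order_tendstoD(2)[OF T(2) this(2)]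
    eventually_conj[OF order_tendstoD(2)[OF T(3) this(3)] eventually_conj[OF order_tendstoD(2)[OF T(4) this(4)]
    eventually_conj[OF order_tendstoD(2)[OF T(5) this(5)] order_tendstoD(1)[OF T(6) this(6)]]]]]]
  have "\<forall>\<^sub>F p in nhds (z\<^sub>0, \<tau>\<^sub>0). \<forall>t.
      norm (sinh_integrand (snd p) (fst p) (of_real t + \<i> * of_real \<epsilon>)) \<le> exp ((M + N) * \<epsilon>) / (c1 * c2) * exp (- (1 * \<bar>t\<bar>))"
    using ev
  proof (rule eventually_mono, intro allI)
    fix p :: "complex \<times> complex" and t :: real
    assume p: "s p < pi - \<kappa> \<and> q p < A \<and> r p < 0 \<and> \<bar>Re (fst p)\<bar> < M \<and> \<bar>Re (snd p)\<bar> < N \<and> 0 < Im (snd p)"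
    obtain z \<tau> where p_eq: "p = (z, \<tau>)" by (cases p)
    define X where "X = complex_of_real t + \<i> * of_real \<epsilon>"
    define b where "b = Im \<tau>"
    have b: "b > 0" using p by (simp add: b_def p_eq)
    define y where "y = - (\<i> * \<tau> * X)"
    have "c2 * exp \<bar>Re y\<bar> \<le> norm (sinh y)"
    proof (rule c2(2)[of "Re \<tau> / Im \<tau>"])
      show "\<bar>Re \<tau> / Im \<tau>\<bar> \<le> A" using p unfolding q_def p_eq snd_conv by linarith
      have h: "Im y + Re \<tau> / Im \<tau> * Re y = \<epsilon> * (norm \<tau>)\<^sup>2 / Im \<tau>"
        unfolding y_def X_def using b by (intro rotated_line_height) (simp add: b_def)
      show "\<bar>pi - 2 * (Im y + Re \<tau> / Im \<tau> * Re y)\<bar> \<le> pi - \<kappa>"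
        unfolding h using p unfolding s_def p_eq snd_conv by linarith
    qed
    then have sy: "c2 * exp \<bar>Re y\<bar> \<le> norm (sinh (\<i> * \<tau> * X))" by (simp add: y_def)
    have "b * \<bar>t\<bar> - N * \<epsilon> \<le> \<bar>Re y\<bar>"
    proof -
      have "Re y = Re \<tau> * \<epsilon> + b * t" by (simp add: y_def X_def b_def)
      moreover have "\<bar>Re \<tau> * \<epsilon>\<bar> \<le> N * \<epsilon>" using p \<epsilon> by (simp add: abs_mult p_eq)
      moreover have "\<bar>b * t\<bar> = b * \<bar>t\<bar>" using b by (simp add: abs_mult)
      ultimately show ?thesis by linarith
    qed
    then have "c2 * exp (b * \<bar>t\<bar> - N * \<epsilon>) \<le> c2 * exp \<bar>Re y\<bar>" using c2(1) by simp
    also note sy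
    finally have "(c1 * exp \<bar>t\<bar>) * (c2 * exp (b * \<bar>t\<bar> - N * \<epsilon>)) \<le> norm (sinh X) * norm (sinh (\<i> * \<tau> * X))"
      using c1(2)[of t] c1(1) c2(1) unfolding X_def by (intro mult_mono) auto
    then have den: "c1 * c2 * exp (\<bar>t\<bar> + b * \<bar>t\<bar> - N * \<epsilon>) \<le> norm (sinh X * sinh (\<i> * \<tau> * X))"
      by (simp add: norm_mult exp_add exp_diff mult_ac)
    have num: "Re (\<i> * z * X / of_real pi) \<le> M * \<epsilon> + b * \<bar>t\<bar>"
    proof -
      have "Re (\<i> * z * X / of_real pi) = - (Re z * \<epsilon>) / pi + - (Im z * t) / pi"
        by (simp add: X_def field_simps)
      also have "- (Re z * \<epsilon>) / pi \<le> M * \<epsilon>"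
      proof -
        have "- (Re z * \<epsilon>) \<le> \<bar>Re z\<bar> * \<epsilon>" using \<epsilon> by (metis abs_ge_minus_self minus_mult_left mult_right_mono less_imp_le)
        also have "\<dots> \<le> M * \<epsilon> * 1" using p \<epsilon> by (simp add: p_eq)
        also have "\<dots> \<le> M * \<epsilon> * pi" using \<epsilon> pi_gt3 by (intro mult_left_mono) (auto simp: M_def)
        finally show ?thesis by (simp only: pos_divide_le_eq[OF pi_gt_zero])
      qed
      also have "- (Im z * t) / pi \<le> b * \<bar>t\<bar>"
      proof -
        have "- (Im z * t) \<le> \<bar>Im z\<bar> * \<bar>t\<bar>" by (metis abs_ge_minus_self abs_mult)
        also have "\<dots> \<le> (pi * b) * \<bar>t\<bar>" using p by (intro mult_right_mono) (auto simp: p_eq r_def b_def)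
        finally show ?thesis by (simp only: pos_divide_le_eq[OF pi_gt_zero] mult_ac)
      qed
      finally show ?thesis by simp
    qed
    have "norm (sinh_integrand \<tau> z X) = exp (Re (\<i> * z * X / of_real pi)) / norm (sinh X * sinh (\<i> * \<tau> * X))"
      unfolding sinh_integrand_def norm_divide norm_exp_eq_Re ..
    also have "\<dots> \<le> exp (M * \<epsilon> + b * \<bar>t\<bar>) / (c1 * c2 * exp (\<bar>t\<bar> + b * \<bar>t\<bar> - N * \<epsilon>))"
      using num den c1(1) c2(1) by (intro frac_le) auto
    also have "\<dots> = exp (M * \<epsilon> + b * \<bar>t\<bar> - (\<bar>t\<bar> + b * \<bar>t\<bar> - N * \<epsilon>)) / (c1 * c2)"
    proof -
      have "exp a / (C * exp d) = exp (a - d) / C" for a d C :: real by (simp add: exp_diff)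
      then show ?thesis .
    qed
    also have "M * \<epsilon> + b * \<bar>t\<bar> - (\<bar>t\<bar> + b * \<bar>t\<bar> - N * \<epsilon>) = (M + N) * \<epsilon> + - (1 * \<bar>t\<bar>)"
      by (simp add: algebra_simps)
    also have "exp ((M + N) * \<epsilon> + - (1 * \<bar>t\<bar>)) = exp ((M + N) * \<epsilon>) * exp (- (1 * \<bar>t\<bar>))"
      by (rule exp_add)
    finally show "norm (sinh_integrand (snd p) (fst p) (of_real t + \<i> * of_real \<epsilon>))
        \<le> exp ((M + N) * \<epsilon>) / (c1 * c2) * exp (- (1 * \<bar>t\<bar>))"
      by (simp only: p_eq fst_conv snd_conv X_def times_divide_eq_left)
  qed
  then show ?thesis by (intro exI[of _ "exp ((M + N) * \<epsilon>) / (c1 * c2)"] exI[of _ 1]) simp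
qed

lemma sinh_integrand_measurable:
  "(\<lambda>t. sinh_integrand \<tau> z (of_real t + \<i> * of_real \<epsilon>)) \<in> borel_measurable lborel"
  unfolding sinh_integrand_def sinh_field_def by measurable

text \<open>For fixed \<open>\<epsilon>\<close> the admissible \<open>\<tau>\<close> form a disc that touches the real axis at \<open>0\<close>; this is the
  set \<open>E\<close> of the continuation argument.\<close>

theorem F_int_sinh_representation:
  fixes \<epsilon> :: real
  assumes \<tau>: "Im \<tau> > 0" and z: "z \<in> regionP \<tau>"
    and \<epsilon>: "0 < \<epsilon>" "\<epsilon> < pi" "2 * \<epsilon> * (norm \<tau>)\<^sup>2 < pi * Im \<tau>"
  shows "integrable lborel (\<lambda>t. sinh_integrand \<tau> z (of_real t + \<i> * of_real \<epsilon>))"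
    and "F_int z \<tau> = 1 / 2 * (LBINT t. sinh_integrand \<tau> z (of_real t + \<i> * of_real \<epsilon>))"
proof -
  let ?K = "\<lambda>z \<tau> t. sinh_integrand \<tau> z (of_real t + \<i> * of_real \<epsilon>)"
  show "integrable lborel (?K z \<tau>)"
    using z by (intro integrable_if_locally_dominated[where K = ?K] sinh_integrand_measurable
      sinh_integrand_locally_dominated \<epsilon> \<tau>) (auto simp: regionP_def)
  define E where "E = {\<tau>. 2 * \<epsilon> * (norm \<tau>)\<^sup>2 < pi * Im \<tau>}"
  \<comment> \<open>The centre of the disc \<open>E\<close> is \<open>\<i> \<rho>\<close>.\<close>
  define \<rho> where "\<rho> = pi / (4 * \<epsilon>)"
  have \<rho>: "\<rho> > 0" using \<epsilon> by (simp add: \<rho>_def)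
  have E_ball: "E = ball (\<i> * of_real \<rho>) \<rho>"
  proof -
    have "2 * \<epsilon> * (norm \<sigma>)\<^sup>2 < pi * Im \<sigma> \<longleftrightarrow> norm (\<i> * of_real \<rho> - \<sigma>) < \<rho>" for \<sigma>
    proof -
      have "norm (\<i> * of_real \<rho> - \<sigma>) < \<rho> \<longleftrightarrow> (norm (\<i> * of_real \<rho> - \<sigma>))\<^sup>2 < \<rho>\<^sup>2"
      proof
        show "norm (\<i> * of_real \<rho> - \<sigma>) < \<rho> \<Longrightarrow> (norm (\<i> * of_real \<rho> - \<sigma>))\<^sup>2 < \<rho>\<^sup>2"
          by (rule power_strict_mono) auto
        show "(norm (\<i> * of_real \<rho> - \<sigma>))\<^sup>2 < \<rho>\<^sup>2 \<Longrightarrow> norm (\<i> * of_real \<rho> - \<sigma>) < \<rho>"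
          by (rule power2_less_imp_less) (use \<rho> in auto)
      qed
      also have "(norm (\<i> * of_real \<rho> - \<sigma>))\<^sup>2 = \<rho>\<^sup>2 - 2 * \<rho> * Im \<sigma> + (norm \<sigma>)\<^sup>2"
        unfolding cmod_power2 by (simp add: power2_eq_square algebra_simps)
      also have "2 * \<rho> = pi / (2 * \<epsilon>)" by (simp add: \<rho>_def)
      also have "\<rho>\<^sup>2 - pi / (2 * \<epsilon>) * Im \<sigma> + (norm \<sigma>)\<^sup>2 < \<rho>\<^sup>2 \<longleftrightarrow> (norm \<sigma>)\<^sup>2 < pi * Im \<sigma> / (2 * \<epsilon>)"
        unfolding times_divide_eq_left by linarith
      also have "\<dots> \<longleftrightarrow> (norm \<sigma>)\<^sup>2 * (2 * \<epsilon>) < pi * Im \<sigma>"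
        by (rule pos_less_divide_eq) (use \<epsilon> in simp)
      finally have e: "norm (\<i> * of_real \<rho> - \<sigma>) < \<rho> \<longleftrightarrow> (norm \<sigma>)\<^sup>2 * (2 * \<epsilon>) < pi * Im \<sigma>" .
      show ?thesis unfolding e by (simp only: mult.commute)
    qed
    then show ?thesis unfolding E_def ball_def dist_norm by blast
  qed
  have E_pos: "Im \<sigma> > 0" if "\<sigma> \<in> E" for \<sigma>
  proof -
    have "0 \<le> 2 * \<epsilon> * (norm \<sigma>)\<^sup>2" using \<epsilon> by simp
    then have "0 < pi * Im \<sigma>" using that unfolding E_def mem_Collect_eq by linarith
    then show ?thesis by (simp add: zero_less_mult_iff)
  qed
  have holK: "(\<lambda>w. ?K (\<zeta> w) (\<theta> w) t) holomorphic_on D"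
    if D: "\<zeta> holomorphic_on D" "\<theta> holomorphic_on D" "\<And>w. w \<in> D \<Longrightarrow> \<theta> w \<in> E" for \<zeta> \<theta> D t
  proof -
    have "sinh (\<i> * \<theta> w * (of_real t + \<i> * of_real \<epsilon>)) \<noteq> 0" if w: "w \<in> D" for w
      using D(3)[OF w] E_pos by (intro sinh_rotated_nonzero \<epsilon>(1)) (auto simp: E_def)
    then have "sinh (of_real t + \<i> * of_real \<epsilon>) * sinh (\<i> * \<theta> w * (of_real t + \<i> * of_real \<epsilon>)) \<noteq> 0"
      if "w \<in> D" for w
      using sinh_on_line_nonzero[OF \<epsilon>(1,2), of t] that by (simp only: mult_eq_0_iff simp_thms)
    then show ?thesis
      unfolding sinh_integrand_def
      by (intro holomorphic_intros holomorphic_on_sinh' D(1,2)) auto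
  qed
  have hol: "(\<lambda>w. 1 / 2 * (LBINT t. ?K (\<zeta> w) (\<theta> w) t)) holomorphic_on D"
    if D: "open D" "\<zeta> holomorphic_on D" "\<theta> holomorphic_on D" "\<And>w. w \<in> D \<Longrightarrow> \<theta> w \<in> E"
       "\<And>w. w \<in> D \<Longrightarrow> \<bar>Im (\<zeta> w)\<bar> < pi * Im (\<theta> w)" for \<zeta> \<theta> D
  proof -
    have E: "2 * \<epsilon> * (norm (\<theta> w))\<^sup>2 < pi * Im (\<theta> w)" "Im (\<theta> w) > 0" if w: "w \<in> D" for w
      using D(4)[OF w] E_pos unfolding E_def by blast+
    show ?thesis
    by (intro holomorphic_on_mult holomorphic_on_const holomorphic_integral_if_locally_dominated[where K = ?K] D
        holK sinh_integrand_measurable sinh_integrand_locally_dominated \<epsilon>(1,2) E)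
  qed
  show "F_int z \<tau> = 1 / 2 * (LBINT t. ?K z \<tau> t)"
  proof (rule identity_by_two_continuations[where E = E and U = "regionP \<tau>" and b\<^sub>0 = \<rho>
        and g = "\<lambda>z \<tau>. 1 / 2 * (LBINT t. ?K z \<tau> t)"])
    show "open E" "convex E" by (simp_all add: E_ball)
    show "\<i> * of_real \<rho> \<in> E" using \<rho> by (simp add: E_ball)
    show \<tau>E: "\<tau> \<in> E" using \<epsilon> by (simp add: E_def)
    show "0 \<in> regionP \<tau>" using \<tau> by (simp add: regionP_def stripS_def)
    show "(\<lambda>z. F_int z \<tau>) holomorphic_on regionP \<tau>"
      using \<tau> by (intro F_int_holomorphic_on open_regionP holomorphic_intros) (auto simp: regionP_def)
    show "(\<lambda>z. 1 / 2 * (LBINT t. ?K z \<tau> t)) holomorphic_on regionP \<tau>"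
      using \<tau>E by (intro hol open_regionP holomorphic_intros) (auto simp: regionP_def)
    fix x :: real
    have op: "open (E \<inter> {\<tau>. complex_of_real x \<in> stripS \<tau>})"
      unfolding of_real_in_stripS_iff E_ball
      by (intro open_Int open_ball open_Collect_less continuous_intros)
    show "F_int (of_real x) holomorphic_on (E \<inter> {\<tau>. of_real x \<in> stripS \<tau>})"
      using E_pos by (intro F_int_holomorphic_on[OF op, of "\<lambda>_. of_real x" "\<lambda>\<tau>. \<tau>"] holomorphic_intros) auto
    show "(\<lambda>\<tau>. 1 / 2 * (LBINT t. ?K (of_real x) \<tau> t)) holomorphic_on (E \<inter> {\<tau>. of_real x \<in> stripS \<tau>})"
      using E_pos by (intro hol op holomorphic_intros) auto
    fix b :: real assume b: "b > 0" "\<i> * of_real b \<in> E"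
    have "b * (2 * \<epsilon> * b) < b * pi" using b by (simp add: E_def norm_mult power2_eq_square mult_ac)
    then have "2 * \<epsilon> * b < pi" using b by simp
    moreover have "\<epsilon> * b > 0" using \<epsilon> b by simp
    ultimately have "\<epsilon> * b < pi" by linarith
    then show "F_int (of_real x) (\<i> * of_real b) = 1 / 2 * (LBINT t. ?K (of_real x) (\<i> * of_real b) t)"
      by (rule F_int_sinh_imaginary[OF b(1) \<epsilon>(1,2)])
  qed (use E_pos z open_regionP convex_regionP in auto)
qed

lemma bound_from_Im_inverse:
  fixes \<epsilon> :: real
  assumes "Im \<tau> > 0" "\<epsilon> < Im (- (of_real pi / (2 * \<tau>)))"
  shows "2 * \<epsilon> * (norm \<tau>)\<^sup>2 < pi * Im \<tau>"
proof -
  have "\<tau> \<noteq> 0" using assms(1) by auto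
  then have D: "2 * (norm \<tau>)\<^sup>2 > 0" by simp
  have "- (of_real pi / (2 * \<tau>)) = - of_real pi * cnj \<tau> / of_real (2 * (norm \<tau>)\<^sup>2)"
    using \<open>\<tau> \<noteq> 0\<close> unfolding of_real_mult complex_norm_square by simp
  then have "Im (- (of_real pi / (2 * \<tau>))) = pi * Im \<tau> / (2 * (norm \<tau>)\<^sup>2)"
    by (simp only: Im_divide_of_real) simp
  then have "\<epsilon> * (2 * (norm \<tau>)\<^sup>2) < pi * Im \<tau>"
    using assms(2) by (simp only: pos_less_divide_eq[OF D])
  then show ?thesis by (simp only: mult_ac)
qed

section \<open>The residue series\<close>

text \<open>The remainder in the residue expansion: the points \<open>Z j\<close> keep a positive distance from the boundary of
  the strip, which makes the domination uniform, and the integrand tends to \<open>0\<close> pointwise.\<close>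

lemma F_int_tendsto_0:
  fixes Z :: "nat \<Rightarrow> complex"
  assumes \<tau>: "Im \<tau> > 0" and \<kappa>: "\<kappa> > 0"
    and strip: "\<And>j. \<bar>Re (Z j * cnj \<tau>) / Im \<tau>\<bar> \<le> pi - \<kappa>"
    and lower: "\<And>j. Re (Z j) \<ge> - M" and lim: "filterlim (\<lambda>j. Re (Z j)) at_top sequentially"
  shows "(\<lambda>j. F_int (Z j) \<tau>) \<longlonglongrightarrow> 0"
proof -
  define b where "b = Im \<tau>"
  define m where "m = min 1 b"
  define M' where "M' = max 0 M"
  have b: "b > 0" using \<tau> by (simp add: b_def)
  obtain c where c: "c > 0" "\<And>w \<alpha>. \<bar>\<alpha>\<bar> \<le> \<bar>Re \<tau> / Im \<tau>\<bar> \<Longrightarrow> \<bar>Im w + \<alpha> * Re w\<bar> \<le> pi - \<kappa> \<Longrightarrow> c * (1 + exp (Re w)) \<le> norm (1 + exp w)"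
    using one_plus_exp_lower_bound[OF \<kappa> abs_ge_zero] by metis
  have lb: "c * (1 + exp (Re (Z j) - b * x)) \<le> norm (1 + exp (Z j + \<i> * \<tau> * of_real x))" for j x
  proof -
    define w where "w = Z j + \<i> * \<tau> * of_real x"
    have "Im w + Re \<tau> / Im \<tau> * Re w = Re (Z j * cnj \<tau>) / Im \<tau>"
      using \<tau> by (simp add: w_def field_simps)
    then have "c * (1 + exp (Re w)) \<le> norm (1 + exp w)"
      using strip[of j] by (intro c(2)[OF order.refl]) simp
    then show ?thesis by (simp add: w_def b_def)
  qed
  have "(\<lambda>j. LBINT x. F_kernel (Z j) \<tau> x) \<longlonglongrightarrow> (LBINT x::real. (0::complex))"
  proof (rule integral_dominated_convergence[where s = "\<lambda>j x. F_kernel (Z j) \<tau> x" and f = "\<lambda>_. 0" and w = "\<lambda>x. exp M' / c * exp (- (m * \<bar>x\<bar>))"])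
    show "integrable lborel (\<lambda>x. exp M' / c * exp (- (m * \<bar>x\<bar>)))"
      using b by (intro integrable_mult_right integrable_exp_minus_abs) (auto simp: m_def)
    show "AE x in lborel. norm (F_kernel (Z j) \<tau> x) \<le> exp M' / c * exp (- (m * \<bar>x\<bar>))" for j
    proof (intro AE_I2 inverse_fermi_product_le)
      fix x :: real
      have "exp (- M' - b * x) \<le> exp (Re (Z j) - b * x)" using lower[of j] by (simp add: M'_def)
      then have "c * (1 + exp (- M' - b * x)) \<le> c * (1 + exp (Re (Z j) - b * x))" using c(1) by simp
      also note lb
      finally have "c * (1 + exp (- M' - b * x)) * (1 + exp x)
          \<le> norm (1 + exp (Z j + \<i> * \<tau> * of_real x)) * norm (1 + exp (complex_of_real x))"
        unfolding norm_one_plus_exp_of_real by (intro mult_right_mono) (auto intro: add_nonneg_nonneg)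
      then show "c * ((1 + exp (- M' - b * x)) * (1 + exp x))
          \<le> norm ((1 + exp (Z j + \<i> * \<tau> * of_real x)) * (1 + exp (complex_of_real x)))"
        by (simp only: norm_mult mult.assoc)
    qed (use b c in \<open>auto simp: m_def M'_def\<close>)
    show "AE x in lborel. (\<lambda>j. F_kernel (Z j) \<tau> x) \<longlonglongrightarrow> 0"
    proof (rule AE_I2)
      fix x :: real
      have "filterlim (\<lambda>j. exp (Re (Z j) - b * x)) at_top sequentially"
        by (rule filterlim_compose[OF exp_at_top])
          (use lim in \<open>simp add: filterlim_at_top_add_at_top filterlim_tendsto_add_at_top[OF tendsto_const, of _ _ "- (b * x)", simplified]\<close>)
      then have "filterlim (\<lambda>j. c * exp (Re (Z j) - b * x)) at_top sequentially"
        by (rule filterlim_tendsto_pos_mult_at_top[OF tendsto_const c(1)])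
      moreover have "c * exp (Re (Z j) - b * x) \<le> norm (1 + exp (Z j + \<i> * \<tau> * of_real x))" for j
        using lb[of j x] c(1) by (simp add: algebra_simps)
      ultimately have "filterlim (\<lambda>j. norm (1 + exp (Z j + \<i> * \<tau> * of_real x))) at_top sequentially"
        by (rule filterlim_at_top_mono[OF _ always_eventually[OF allI]])
      then have "filterlim (\<lambda>j. 1 + exp (Z j + \<i> * \<tau> * of_real x)) at_infinity sequentially"
        by (rule filterlim_norm_at_top_imp_at_infinity)
      then have "(\<lambda>j. inverse (1 + exp (Z j + \<i> * \<tau> * of_real x)) * inverse (1 + exp (complex_of_real x))) \<longlonglongrightarrow> 0"
        by (intro tendsto_mult_left_zero tendsto_inverse_0[THEN filterlim_compose])
      then show "(\<lambda>j. F_kernel (Z j) \<tau> x) \<longlonglongrightarrow> 0"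
        by (simp add: divide_inverse)
    qed
  qed auto
  then show ?thesis by (simp add: F_int_def)
qed

text \<open>If \<open>\<rho> + N \<alpha>\<close> and \<open>\<rho> + (N + 1) \<alpha>\<close> were both very close to \<open>1 / 2\<close> modulo \<open>1\<close>, their difference \<open>\<alpha>\<close>
  would be very close to an integer. So if \<open>\<alpha>\<close> is not an integer, one of any two consecutive values
  of \<open>N\<close> serves; if it is one, the sequence is constant modulo \<open>1\<close>.\<close>

lemma rotation_avoids_half_integers:
  fixes \<rho> \<alpha> :: real
  assumes \<rho>: "\<bar>\<rho>\<bar> < 1 / 2"
  obtains \<kappa> where "\<kappa> > 0" "\<And>N\<^sub>0::nat. \<exists>N\<ge>N\<^sub>0. \<exists>M::int. \<bar>\<rho> + real N * \<alpha> - of_int M\<bar> \<le> 1 / 2 - \<kappa>"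
proof (cases "\<alpha> \<in> \<int>")
  case True
  then obtain l :: int where l: "\<alpha> = of_int l" by (auto elim: Ints_cases)
  show thesis
  proof (rule that[of "1 / 2 - \<bar>\<rho>\<bar>"])
    fix N\<^sub>0 :: nat
    show "\<exists>N\<ge>N\<^sub>0. \<exists>M::int. \<bar>\<rho> + real N * \<alpha> - of_int M\<bar> \<le> 1 / 2 - (1 / 2 - \<bar>\<rho>\<bar>)"
      by (intro exI[of _ N\<^sub>0] conjI exI[of _ "int N\<^sub>0 * l"]) (simp_all add: l)
  qed (use \<rho> in simp)
next
  case False
  define d where "d = \<bar>\<alpha> - of_int (round \<alpha>)\<bar>"
  have "\<alpha> \<noteq> of_int (round \<alpha>)" using False by (metis Ints_of_int)
  then have d: "d > 0" by (simp add: d_def)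
  have dmin: "d \<le> \<bar>\<alpha> - of_int n\<bar>" for n
    unfolding d_def by (rule round_diff_minimal)
  show thesis
  proof (rule that[of "d / 3"])
    fix N\<^sub>0 :: nat
    \<comment> \<open>The signed distance to the nearest integer.\<close>
    define r where "r = (\<lambda>N::nat. \<rho> + real N * \<alpha> - of_int (round (\<rho> + real N * \<alpha>)))"
    have r: "\<bar>r N\<bar> \<le> 1 / 2" for N
      using of_int_round_abs_le[of "\<rho> + real N * \<alpha>"] by (simp add: r_def abs_minus_commute)
    have "\<bar>r N\<^sub>0\<bar> \<le> 1 / 2 - d / 3 \<or> \<bar>r (Suc N\<^sub>0)\<bar> \<le> 1 / 2 - d / 3"
    proof (rule ccontr)
      assume "\<not> ?thesis"
      then have big: "\<bar>r N\<^sub>0\<bar> > 1 / 2 - d / 3" "\<bar>r (Suc N\<^sub>0)\<bar> > 1 / 2 - d / 3" by auto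
      define l where "l = round (\<rho> + real (Suc N\<^sub>0) * \<alpha>) - round (\<rho> + real N\<^sub>0 * \<alpha>)"
      have diff: "r (Suc N\<^sub>0) - r N\<^sub>0 = \<alpha> - of_int l"
        by (simp add: r_def l_def algebra_simps)
      have "d \<le> \<bar>r (Suc N\<^sub>0) - r N\<^sub>0\<bar>" "d \<le> \<bar>r (Suc N\<^sub>0) - r N\<^sub>0 - 1\<bar>" "d \<le> \<bar>r (Suc N\<^sub>0) - r N\<^sub>0 + 1\<bar>"
        unfolding diff using dmin[of l] dmin[of "l + 1"] dmin[of "l - 1"] by (simp_all add: algebra_simps)
      then show False using big r[of N\<^sub>0] r[of "Suc N\<^sub>0"] d by linarith
    qed
    then show "\<exists>N\<ge>N\<^sub>0. \<exists>M::int. \<bar>\<rho> + real N * \<alpha> - of_int M\<bar> \<le> 1 / 2 - d / 3"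
      unfolding r_def by (meson le_SucI order_refl)
  qed (use d in simp)
qed

lemma summable_inverse_one_plus_exp:
  assumes v: "Re v > 0"
  shows "summable (\<lambda>k. 1 / (1 + exp (u + of_nat k * v)))"
proof (rule summable_comparison_test_ev)
  have "filterlim (\<lambda>k. Re u + real k * Re v) at_top sequentially"
    using v by (intro filterlim_tendsto_add_at_top[OF tendsto_const]
        filterlim_at_top_mult_tendsto_pos[OF tendsto_const _ filterlim_real_sequentially])
  then have "\<forall>\<^sub>F k in sequentially. Re u + real k * Re v \<ge> 1"
    by (simp add: filterlim_at_top)
  then show "\<forall>\<^sub>F k in sequentially. norm (1 / (1 + exp (u + of_nat k * v))) \<le> 4 * exp (- Re u) * exp (- Re v) ^ k"
  proof eventually_elim
    case (elim k)
    define w where "w = u + of_nat k * v"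
    have "1 + exp (Re w) \<le> 4 * norm (1 + exp w)"
      using elim by (intro one_plus_exp_ge_far) (simp add: w_def)
    then have "exp (Re w) / 4 \<le> norm (1 + exp w)" by simp
    then have "norm (1 / (1 + exp w)) \<le> 1 / (exp (Re w) / 4)"
      unfolding norm_divide norm_one by (intro divide_left_mono mult_pos_pos) (auto intro: less_le_trans[of _ "exp (Re w) / 4"])
    also have "\<dots> = 4 * inverse (exp (Re w))"
      by (simp only: divide_inverse inverse_mult_distrib) simp
    also have "inverse (exp (Re w)) = exp (- Re w)" by (rule exp_minus[symmetric])
    also have "exp (- Re w) = exp (- Re u) * exp (- Re v) ^ k"
      unfolding exp_of_nat_mult[symmetric] exp_add[symmetric] by (simp add: w_def)
    finally show ?case by (simp add: w_def mult.assoc)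
  qed
  show "summable (\<lambda>k. 4 * exp (- Re u) * exp (- Re v) ^ k)"
    using v by (intro summable_mult summable_geometric) simp
qed

text \<open>The integrals over the real line and over the line of height \<open>- 2 \<pi> N\<close>, with the same
  integrand \<open>f\<close>, are \<open>F_int\<close> at \<open>z\<close> and at the shifted point. The zeros \<open>px k\<close> of \<open>1 + exp x\<close>
  between the lines are those with \<open>k < N\<close>, and the zeros \<open>py n\<close> of the other factor are those with
  \<open>0 \<le> n < M\<close>, precisely because both points lie in the strip. Regularity says that no \<open>px k\<close> equals
  any \<open>py n\<close>, so that all poles are simple.\<close>

lemma F_int_shift_finite:
  fixes N M :: nat
  assumes a: "Re \<tau> > 0" and \<tau>: "Im \<tau> > 0" and z: "z \<in> stripS \<tau>" and N: "N > 0"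
    and z': "z + 2 * of_real pi * of_nat N * \<tau> - 2 * of_real pi * \<i> * of_nat M \<in> stripS \<tau>"
    and reg: "residue_regular \<tau> z"
  shows "F_int z \<tau> = F_int (z + 2 * of_real pi * of_nat N * \<tau> - 2 * of_real pi * \<i> * of_nat M) \<tau>
     + (\<Sum>k<N. 2 * of_real pi * \<i> / (1 + residue_exp1 \<tau> z k))
     + (\<Sum>k<M. 2 * of_real pi * inverse \<tau> / (1 + residue_exp2 \<tau> z k))"
proof -
  define z1 where "z1 = z + 2 * of_real pi * of_nat N * \<tau> - 2 * of_real pi * \<i> * of_nat M"
  define g where "g = (\<lambda>x. (1 + exp (z + \<i> * \<tau> * x)) * (1 + exp x))"
  define f where "f = (\<lambda>x. 1 / g x)"
  \<comment> \<open>The zeros of \<open>1 + exp x\<close> below the real line, and all zeros of \<open>1 + exp (z + \<i> \<tau> x)\<close>.\<close>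
  define px where "px = (\<lambda>k::nat. - (of_real pi * \<i> * (2 * of_nat k + 1)))"
  define py where "py = (\<lambda>n::int. \<i> * z / \<tau> + of_real pi * of_int (2 * n + 1) / \<tau>)"
  define P where "P = px ` {..<N} \<union> (\<lambda>k. py (int k)) ` {..<M}"
  define D where "D = (norm \<tau>)\<^sup>2"
  define s where "s = Re (z * cnj \<tau>)"
  define b where "b = Im \<tau>"
  have \<tau>0: "\<tau> \<noteq> 0" and D: "D > 0" and b: "b > 0" using \<tau> by (auto simp: D_def b_def)
  have \<tau>cnj: "inverse \<tau> = cnj \<tau> / of_real D"
  proof -
    have "of_real D = \<tau> * cnj \<tau>" unfolding D_def by (rule complex_norm_square)
    then show ?thesis using \<tau>0 by (simp add: divide_inverse)
  qed
  have Im_py: "Im (py n) = (s - of_int (2 * n + 1) * (pi * b)) / D" for n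
  proof -
    have "py n = \<i> * z * inverse \<tau> + of_real pi * of_int (2 * n + 1) * inverse \<tau>"
      by (simp only: py_def divide_inverse)
    also have "\<dots> = (\<i> * z * cnj \<tau> + of_real pi * of_int (2 * n + 1) * cnj \<tau>) / of_real D"
      unfolding \<tau>cnj by (simp only: times_divide_eq_right add_divide_distrib)
    also have "Im \<dots> = Im (\<i> * z * cnj \<tau> + of_real pi * of_int (2 * n + 1) * cnj \<tau>) / D"
      by (rule Im_divide_of_real)
    finally show ?thesis by (simp add: s_def b_def algebra_simps)
  qed
  have s: "- (pi * b) < s" "s < pi * b"
    using z by (auto simp: stripS_def s_def b_def abs_less_iff)
  have s1: "- (pi * b) < s + 2 * pi * N * D - 2 * pi * M * b" "s + 2 * pi * N * D - 2 * pi * M * b < pi * b"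
  proof -
    have "Re (z1 * cnj \<tau>) = s + 2 * pi * N * D - 2 * pi * M * b"
      unfolding z1_def s_def b_def D_def cmod_power2 by (simp add: power2_eq_square algebra_simps)
    then show "- (pi * b) < s + 2 * pi * N * D - 2 * pi * M * b" "s + 2 * pi * N * D - 2 * pi * M * b < pi * b"
      using z' unfolding z1_def[symmetric] by (auto simp: stripS_def b_def abs_less_iff)
  qed
  have exp_px: "exp (px k) = - 1" for k
    unfolding exp_eq_minus_one_iff by (intro exI[of _ "- int k - 1"]) (simp add: px_def algebra_simps)
  have exp_py: "exp (z + \<i> * \<tau> * py n) = - 1" for n
    unfolding exp_eq_minus_one_iff by (intro exI[of _ n]) (use \<tau>0 in \<open>simp add: py_def field_simps\<close>)
  have E1: "exp (z + \<i> * \<tau> * px k) = residue_exp1 \<tau> z k" for k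
    using a by (simp add: residue_exp1_def px_def algebra_simps)
  have E2: "exp (py (int k)) = residue_exp2 \<tau> z k" for k
    unfolding residue_exp2_def py_def
    by (rule arg_cong[of _ _ exp]) (use a \<tau>0 in \<open>simp add: field_simps\<close>)
  have r1: "1 + residue_exp1 \<tau> z k \<noteq> 0" and r2: "1 + residue_exp2 \<tau> z k \<noteq> 0" for k
    using reg by (auto simp: residue_regular_def)
  have inj_px: "inj px" by (auto simp: px_def inj_def)
  have inj_py: "inj (\<lambda>k::nat. py (int k))" using \<tau>0 by (auto simp: py_def inj_def)
  have disj: "px ` {..<N} \<inter> (\<lambda>k. py (int k)) ` {..<M} = {}"
  proof -
    have "px k \<noteq> py (int l)" for k l
    proof
      assume "px k = py (int l)"
      then have "residue_exp1 \<tau> z k = - 1" using exp_py[of "int l"] E1[of k] by metis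
      then show False using r1[of k] by simp
    qed
    then show ?thesis by auto
  qed
  have Im_px: "Im (px k) = - pi * (2 * k + 1)" for k by (simp add: px_def)
  define c where "c = - (2 * pi * N)"
  have c: "c < 0" using N by (simp add: c_def)
  have P_range: "c < Im p \<and> Im p < 0" if p: "p \<in> P" for p
  proof -
    consider k where "k < N" "p = px k" | k where "k < M" "p = py (int k)"
      using p by (auto simp: P_def)
    then show ?thesis
    proof cases
      case 1
      have "pi * (2 * k + 1) < pi * (2 * N)" using 1 by (intro mult_strict_left_mono) auto
      then show ?thesis using 1 by (simp add: Im_px c_def)
    next
      case 2
      have "0 \<le> real k * (pi * b)" "real k * (pi * b) \<le> (real M - 1) * (pi * b)"
        using 2 b by (auto intro!: mult_right_mono)
      then have "s - of_int (2 * int k + 1) * (pi * b) < 0"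
          "- (2 * pi * N * D) < s - of_int (2 * int k + 1) * (pi * b)"
        using s s1 by (simp_all add: algebra_simps)
      moreover have "Im p = (s - of_int (2 * int k + 1) * (pi * b)) / D" unfolding 2(2) by (rule Im_py)
      ultimately show ?thesis
        unfolding c_def using D by (simp only: pos_less_divide_eq[OF D] pos_divide_less_eq[OF D]) simp
    qed
  qed
  \<comment> \<open>The strip in which \<open>f\<close> has no poles outside \<open>P\<close> extends up to the next poles of either family.\<close>
  define \<alpha> \<beta> where "\<alpha> = max (Im (py (int M))) (- (2 * pi * N) - pi)" and "\<beta> = min pi (Im (py (- 1)))"
  have \<alpha>: "\<alpha> < c"
  proof -
    have "s - of_int (2 * int M + 1) * (pi * b) < - (2 * pi * N * D)" using s1 by (simp add: algebra_simps)
    then have "Im (py (int M)) < c" unfolding Im_py c_def using D by (simp add: field_simps)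
    then show ?thesis by (simp add: \<alpha>_def c_def)
  qed
  have \<beta>: "0 < \<beta>"
  proof -
    have "0 < Im (py (- 1))" unfolding Im_py using s D by (intro divide_pos_pos) auto
    then show ?thesis by (simp add: \<beta>_def)
  qed
  have g_nz: "g x \<noteq> 0" if x: "\<alpha> < Im x" "Im x < \<beta>" "x \<notin> P" for x
  proof
    assume "g x = 0"
    then consider "exp x = - 1" | "exp (z + \<i> * \<tau> * x) = - 1"
      by (auto simp: g_def add_eq_0_iff)
    then show False
    proof cases
      case 1
      then obtain n :: int where n: "x = \<i> * of_real pi * of_int (2 * n + 1)"
        unfolding exp_eq_minus_one_iff by blast
      have "Im x = pi * of_int (2 * n + 1)" by (simp add: n)
      then have "pi * - (2 * real N + 1) < pi * of_int (2 * n + 1)" "pi * of_int (2 * n + 1) < pi * 1"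
        using x by (simp_all add: \<alpha>_def \<beta>_def algebra_simps)
      then have "- (2 * real N + 1) < of_int (2 * n + 1)" "real_of_int (2 * n + 1) < 1"
        by (simp_all only: mult_less_cancel_left_pos[OF pi_gt_zero])
      then have "nat (- n - 1) < N" "n < 0" by linarith+
      moreover from this have "x = px (nat (- n - 1))" by (simp add: n px_def algebra_simps)
      ultimately show False using x(3) by (auto simp: P_def)
    next
      case 2
      then obtain n :: int where n: "z + \<i> * \<tau> * x = \<i> * of_real pi * of_int (2 * n + 1)"
        unfolding exp_eq_minus_one_iff by blast
      then have "\<i> * \<tau> * x = \<i> * of_real pi * of_int (2 * n + 1) - z"
        by (metis add_diff_cancel_left')
      moreover have "\<i> * \<tau> * py n = \<i> * of_real pi * of_int (2 * n + 1) - z"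
        using \<tau>0 by (simp add: py_def field_simps)
      ultimately have "\<i> * \<tau> * x = \<i> * \<tau> * py n" by (rule trans[OF _ sym])
      then have xn: "x = py n" using \<tau>0 by simp
      have "Im (py (int M)) < Im (py n)" "Im (py n) < Im (py (- 1))"
        using x by (simp_all add: \<alpha>_def \<beta>_def xn)
      then have "of_int n * (pi * b) < of_int (int M) * (pi * b)" "of_int (- 1) * (pi * b) < of_int n * (pi * b)"
        unfolding Im_py using D by (simp_all add: divide_less_cancel algebra_simps)
      moreover have "pi * b > 0" using b by simp
      ultimately have "n < int M" "- 1 < n" by (simp_all only: mult_less_cancel_right_pos of_int_less_iff)
      then have "nat n < M" "int (nat n) = n" by auto
      then have "py n \<in> P" unfolding P_def by (metis UnI2 imageI lessThan_iff)
      then show False using x(3) xn by simp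
    qed
  qed
  have dg: "(g has_field_derivative
      (exp (z + \<i> * \<tau> * x) * (\<i> * \<tau>)) * (1 + exp x) + exp x * (1 + exp (z + \<i> * \<tau> * x))) (at x)" for x
    unfolding g_def by (auto intro!: derivative_eq_intros)
  have hol_g: "g holomorphic_on UNIV" unfolding g_def by (intro holomorphic_intros)
  have res: "residue f x = 1 / d" if "g x = 0" "d \<noteq> 0"
    and d: "d = (exp (z + \<i> * \<tau> * x) * (\<i> * \<tau>)) * (1 + exp x) + exp x * (1 + exp (z + \<i> * \<tau> * x))" for x d
    unfolding f_def by (rule residue_simple_pole_deriv[OF _ hol_g _ _ _ dg[of x, folded d] _ that(1,2)]) auto
  have res_px: "residue f (px k) = - (1 / (1 + residue_exp1 \<tau> z k))" for k
  proof -
    have "residue f (px k) = 1 / (- (1 + residue_exp1 \<tau> z k))"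
    proof (rule res)
      show "- (1 + residue_exp1 \<tau> z k) \<noteq> 0" using r1[of k] by (simp only: neg_equal_0_iff_equal not_False_eq_True)
    qed (simp_all only: g_def exp_px E1, simp_all)
    then show ?thesis by (simp only: divide_minus_right)
  qed
  have res_py: "residue f (py (int k)) = - (1 / (\<i> * \<tau> * (1 + residue_exp2 \<tau> z k)))" for k
  proof -
    have "residue f (py (int k)) = 1 / (- (\<i> * \<tau> * (1 + residue_exp2 \<tau> z k)))"
    proof (rule res)
      show "- (\<i> * \<tau> * (1 + residue_exp2 \<tau> z k)) \<noteq> 0"
        using r2[of k] \<tau>0 by (simp only: neg_equal_0_iff_equal mult_eq_0_iff complex_i_not_zero simp_thms)
    qed (simp_all only: g_def exp_py E2, simp_all)
    then show ?thesis by (simp only: divide_minus_right)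
  qed
  have top: "f (of_real t + \<i> * of_real 0) = F_kernel z \<tau> t" for t
    by (simp add: f_def g_def)
  have bot: "f (of_real t + \<i> * of_real c) = F_kernel z1 \<tau> t" for t
  proof -
    have per: "exp (w - 2 * of_real pi * \<i> * of_nat n) = exp w" for w and n :: nat
    proof -
      have "exp (w - 2 * of_real pi * \<i> * of_nat n) = exp w / exp (2 * of_real pi * \<i>) ^ n"
        unfolding exp_diff exp_of_nat_mult[symmetric] by (simp add: mult.commute)
      then show ?thesis by simp
    qed
    have 1: "of_real t + \<i> * of_real c = of_real t - 2 * of_real pi * \<i> * of_nat N" by (simp add: c_def)
    have 2: "z1 + \<i> * \<tau> * of_real t
        = z + \<i> * \<tau> * (of_real t + \<i> * of_real c) - 2 * of_real pi * \<i> * of_nat M"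
      by (simp add: z1_def c_def algebra_simps)
    show ?thesis unfolding 2 per unfolding f_def g_def 1 per by simp
  qed
  have "(LBINT t. f (of_real t + \<i> * of_real c)) - (LBINT t. f (of_real t + \<i> * of_real 0))
      = 2 * pi * \<i> * (\<Sum>p\<in>P. residue f p)"
  proof (rule strip_residue_theorem[where \<alpha> = \<alpha> and \<beta> = \<beta> and m = "min 1 b" and C = "exp \<bar>Re z\<bar> / (1 / 16)"
        and R\<^sub>0 = "max 1 ((1 + \<bar>Re z\<bar> + 2 * pi * N * Re \<tau>) / b)"])
    show "finite P" by (simp add: P_def)
    show "c < Im p \<and> Im p < 0" if "p \<in> P" for p by (rule P_range[OF that])
    show "f holomorphic_on {x. \<alpha> < Im x \<and> Im x < \<beta>} - P"
      unfolding f_def using g_nz by (intro holomorphic_intros holomorphic_on_subset[OF hol_g]) auto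
    fix x :: complex
    assume x: "c \<le> Im x" "Im x \<le> 0" "max 1 ((1 + \<bar>Re z\<bar> + 2 * pi * N * Re \<tau>) / b) \<le> \<bar>Re x\<bar>"
    define w where "w = z + \<i> * \<tau> * x"
    have Re_w: "Re w = Re z - Re \<tau> * Im x - b * Re x" by (simp add: w_def b_def)
    have "0 \<le> Re \<tau> * (- Im x)" "Re \<tau> * (- Im x) \<le> Re \<tau> * (2 * pi * N)"
      using a x(1,2) by (intro mult_nonneg_nonneg mult_left_mono; simp add: c_def)+
    then have aI: "Re \<tau> * Im x \<le> 0" "- (Re \<tau> * Im x) \<le> 2 * pi * N * Re \<tau>" by (simp_all add: mult_ac)
    have "1 + \<bar>Re z\<bar> + 2 * pi * N * Re \<tau> \<le> b * \<bar>Re x\<bar>"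
      using x(3) b by (simp add: pos_divide_le_eq mult.commute)
    also have "\<dots> = \<bar>b * Re x\<bar>" using b by (simp add: abs_mult)
    finally have "\<bar>Re w\<bar> \<ge> 1" unfolding Re_w using aI by linarith
    then have 1: "1 / 4 * (1 + exp (Re w)) \<le> norm (1 + exp w)"
      using one_plus_exp_ge_far[of w] by simp
    have 2: "1 / 4 * (1 + exp (Re x)) \<le> norm (1 + exp x)"
      using one_plus_exp_ge_far[of x] x(3) by simp
    have "- \<bar>Re z\<bar> - b * Re x \<le> Re w" unfolding Re_w using aI by linarith
    then have "exp (- \<bar>Re z\<bar> - b * Re x) \<le> exp (Re w)" by (simp only: exp_le_cancel_iff)
    then have "1 / 4 * (1 + exp (- \<bar>Re z\<bar> - b * Re x)) \<le> 1 / 4 * (1 + exp (Re w))"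
      by (intro mult_left_mono add_left_mono) auto
    also note 1
    finally have "1 / 4 * (1 + exp (- \<bar>Re z\<bar> - b * Re x)) \<le> norm (1 + exp w)" .
    then have "(1 / 4 * (1 + exp (- \<bar>Re z\<bar> - b * Re x))) * (1 / 4 * (1 + exp (Re x)))
        \<le> norm (1 + exp w) * norm (1 + exp x)"
      using 2 by (intro mult_mono) (auto intro: add_nonneg_nonneg)
    then have "1 / 16 * ((1 + exp (- \<bar>Re z\<bar> - b * Re x)) * (1 + exp (Re x))) \<le> norm ((1 + exp w) * (1 + exp x))"
      unfolding norm_mult by simp
    from inverse_fermi_product_le[OF _ _ _ _ _ this, of "min 1 b"]
    show "norm (f x) \<le> exp \<bar>Re z\<bar> / (1 / 16) * exp (- (min 1 b * \<bar>Re x\<bar>))"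
      using b by (simp add: f_def g_def w_def)
  next
    show "integrable lborel (\<lambda>t. f (of_real t + \<i> * of_real c))"
      unfolding bot using F_kernel_integrable[OF \<tau> z'] by (simp add: z1_def)
    show "integrable lborel (\<lambda>t. f (of_real t + \<i> * of_real 0))"
      unfolding top by (rule F_kernel_integrable[OF \<tau> z])
  qed (use \<alpha> \<beta> c b in auto)
  also have "(\<Sum>p\<in>P. residue f p) = (\<Sum>k<N. residue f (px k)) + (\<Sum>k<M. residue f (py (int k)))"
    unfolding P_def using disj inj_px inj_py
    by (subst sum.union_disjoint) (auto simp: sum.reindex inj_on_subset[OF inj_px] inj_on_subset[OF inj_py])
  also have "\<dots> = - (\<Sum>k<N. 1 / (1 + residue_exp1 \<tau> z k)) - (\<Sum>k<M. 1 / (\<i> * \<tau> * (1 + residue_exp2 \<tau> z k)))"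
    unfolding res_px res_py by (simp add: sum_negf)
  also have "2 * pi * \<i> * \<dots> = - (\<Sum>k<N. 2 * of_real pi * \<i> / (1 + residue_exp1 \<tau> z k))
      - (\<Sum>k<M. 2 * of_real pi * \<i> * (1 / (\<i> * \<tau> * (1 + residue_exp2 \<tau> z k))))"
    unfolding right_diff_distrib by (simp add: sum_distrib_left)
  also have "(\<Sum>k<M. 2 * of_real pi * \<i> * (1 / (\<i> * \<tau> * (1 + residue_exp2 \<tau> z k))))
      = (\<Sum>k<M. 2 * of_real pi * inverse \<tau> / (1 + residue_exp2 \<tau> z k))"
  proof (rule sum.cong[OF refl])
    fix k
    show "2 * of_real pi * \<i> * (1 / (\<i> * \<tau> * (1 + residue_exp2 \<tau> z k)))
        = 2 * of_real pi * inverse \<tau> / (1 + residue_exp2 \<tau> z k)"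
      using \<tau>0 r2[of k] by (simp only: inverse_eq_divide) (simp add: divide_simps)
  qed
  finally have "F_int z1 \<tau> - F_int z \<tau> = - (\<Sum>k<N. 2 * of_real pi * \<i> / (1 + residue_exp1 \<tau> z k))
      - (\<Sum>k<M. 2 * of_real pi * inverse \<tau> / (1 + residue_exp2 \<tau> z k))"
    unfolding top bot F_int_def .
  then have "F_int z \<tau> = F_int z1 \<tau> - (- (\<Sum>k<N. 2 * of_real pi * \<i> / (1 + residue_exp1 \<tau> z k))
      - (\<Sum>k<M. 2 * of_real pi * inverse \<tau> / (1 + residue_exp2 \<tau> z k)))"
    by (metis add_diff_cancel_left' diff_diff_eq2 diff_add_cancel)
  then show ?thesis by (simp add: z1_def)
qed

lemma residue_exp1_eq:
  "residue_exp1 \<tau> z k = exp (z + of_real (pi * sgn (Re \<tau>)) * \<tau> + of_nat k * (2 * (of_real (pi * sgn (Re \<tau>)) * \<tau>)))"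
  unfolding residue_exp1_def by (rule arg_cong[of _ _ exp]) (simp add: algebra_simps)

lemma residue_exp2_eq:
  "residue_exp2 \<tau> z k = exp (\<i> / \<tau> * z + of_real (pi * sgn (Re \<tau>)) / \<tau> + of_nat k * (2 * (of_real (pi * sgn (Re \<tau>)) / \<tau>)))"
  unfolding residue_exp2_def
  by (rule arg_cong[of _ _ exp], cases "\<tau> = 0") (simp_all add: field_simps)

text \<open>Both sequences of exponents in the residue series have an increment of positive real part, which
  makes the two parts of the series converge separately.\<close>

lemma Re_residue_steps_pos:
  assumes "Re \<tau> \<noteq> 0"
  shows "Re (of_real (pi * sgn (Re \<tau>)) * \<tau>) > 0" "Re (of_real (pi * sgn (Re \<tau>)) / \<tau>) > 0"
proof -
  have 1: "sgn (Re \<tau>) * Re \<tau> > 0" using assms by (auto simp: sgn_if)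
  then show "Re (of_real (pi * sgn (Re \<tau>)) * \<tau>) > 0" by (simp add: mult.assoc)
  have "\<tau> \<noteq> 0" using assms by auto
  then have D: "(norm \<tau>)\<^sup>2 > 0" by simp
  have "Re (of_real (pi * sgn (Re \<tau>)) / \<tau>) = pi * (sgn (Re \<tau>) * Re \<tau>) / (norm \<tau>)\<^sup>2"
    by (simp add: complex_div_cnj[of _ \<tau>] flip: complex_norm_square)
  then show "Re (of_real (pi * sgn (Re \<tau>)) / \<tau>) > 0" using 1 D by simp
qed

lemma Re_double_pos: "Re x > 0 \<Longrightarrow> Re (2 * x) > 0"
  by simp

lemma summable_residue_parts:
  assumes "Re \<tau> \<noteq> 0"
  shows "summable (\<lambda>k. 2 * of_real pi * \<i> / (1 + residue_exp1 \<tau> z k))"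
    and "summable (\<lambda>k. 2 * of_real pi * inverse \<tau> / (1 + residue_exp2 \<tau> z k))"
proof -
  have "summable (\<lambda>k. 2 * of_real pi * \<i> * (1 / (1 + residue_exp1 \<tau> z k)))"
    unfolding residue_exp1_eq
    by (intro summable_mult summable_inverse_one_plus_exp Re_double_pos Re_residue_steps_pos assms)
  then show "summable (\<lambda>k. 2 * of_real pi * \<i> / (1 + residue_exp1 \<tau> z k))" by simp
  have "summable (\<lambda>k. 2 * of_real pi * inverse \<tau> * (1 / (1 + residue_exp2 \<tau> z k)))"
    unfolding residue_exp2_eq
    by (intro summable_mult summable_inverse_one_plus_exp Re_double_pos Re_residue_steps_pos assms)
  then show "summable (\<lambda>k. 2 * of_real pi * inverse \<tau> / (1 + residue_exp2 \<tau> z k))" by simp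
qed

lemma summable_residue_term:
  assumes "Re \<tau> \<noteq> 0"
  shows "summable (residue_term \<tau> z)"
  unfolding residue_term_def[abs_def] by (intro summable_add summable_residue_parts assms)

text \<open>Measured by \<open>\<rho>\<close> and \<open>\<alpha>\<close>, the position of the shifted points in the strip modulo \<open>2 \<pi> \<i>\<close> is
  \<open>\<rho> + N \<alpha>\<close> modulo \<open>1\<close>, with the boundary at \<open>1 / 2\<close>.\<close>

lemma F_int_residue_series_right:
  assumes a: "Re \<tau> > 0" and \<tau>: "Im \<tau> > 0" and z: "z \<in> stripS \<tau>" and reg: "residue_regular \<tau> z"
  shows "F_int z \<tau> = (\<Sum>k. residue_term \<tau> z k)"
proof -
  define b where "b = Im \<tau>"
  have b: "b > 0" using \<tau> by (simp add: b_def)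
  have \<tau>0: "\<tau> \<noteq> 0" using a by auto
  define \<rho> where "\<rho> = Re (z * cnj \<tau>) / (2 * pi * b)"
  define \<alpha> where "\<alpha> = (norm \<tau>)\<^sup>2 / b"
  have "\<alpha> > 0" using \<tau>0 b by (simp add: \<alpha>_def)
  have \<rho>: "\<bar>\<rho>\<bar> < 1 / 2" using z b by (simp add: \<rho>_def stripS_def b_def abs_divide pos_divide_less_eq)
  obtain \<kappa> where \<kappa>: "\<kappa> > 0" "\<And>N\<^sub>0::nat. \<exists>N\<ge>N\<^sub>0. \<exists>M::int. \<bar>\<rho> + real N * \<alpha> - of_int M\<bar> \<le> 1 / 2 - \<kappa>"
    using rotation_avoids_half_integers[OF \<rho>] by blast
  \<comment> \<open>The shifts have to be positive, hence \<open>Suc j\<close>; and \<open>M\<close> is nonnegative because \<open>\<rho> + N \<alpha> > - 1 / 2\<close>.\<close>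
  have "\<forall>j. \<exists>N M::nat. N \<ge> Suc j \<and> \<bar>\<rho> + real N * \<alpha> - real M\<bar> \<le> 1 / 2 - \<kappa>"
  proof
    fix j
    obtain N and M :: int where NM: "N \<ge> Suc j" "\<bar>\<rho> + real N * \<alpha> - of_int M\<bar> \<le> 1 / 2 - \<kappa>"
      using \<kappa>(2) by blast
    have "real N * \<alpha> \<ge> 0" using \<open>\<alpha> > 0\<close> by simp
    then have "- 1 < real_of_int M" using NM(2) \<rho> \<kappa>(1) by linarith
    then have "M = int (nat M)" by simp
    then show "\<exists>N M::nat. N \<ge> Suc j \<and> \<bar>\<rho> + real N * \<alpha> - real M\<bar> \<le> 1 / 2 - \<kappa>"
      using NM by (metis of_int_of_nat_eq)
  qed
  then obtain N M :: "nat \<Rightarrow> nat" where N: "\<And>j. N j \<ge> Suc j"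
    and NM: "\<And>j. \<bar>\<rho> + real (N j) * \<alpha> - real (M j)\<bar> \<le> 1 / 2 - \<kappa>"
    by metis
  \<comment> \<open>Points of the strip with \<open>Re (Z j) \<rightarrow> \<infinity>\<close>, at least \<open>2 \<pi> \<kappa> Im \<tau>\<close> away from the boundary in terms of \<open>Re (Z j * cnj \<tau>)\<close>.\<close>
  define Z where "Z = (\<lambda>j. z + 2 * of_real pi * of_nat (N j) * \<tau> - 2 * of_real pi * \<i> * of_nat (M j))"
  have ReZ: "Re (Z j) = Re z + 2 * pi * real (N j) * Re \<tau>" for j by (simp add: Z_def)
  have Z_strip: "Re (Z j * cnj \<tau>) / Im \<tau> = 2 * pi * (\<rho> + real (N j) * \<alpha> - real (M j))" for j
  proof -
    have \<rho>b: "Re (z * cnj \<tau>) = 2 * pi * b * \<rho>" and \<alpha>b: "(norm \<tau>)\<^sup>2 = \<alpha> * b"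
      using b by (simp_all add: \<rho>_def \<alpha>_def)
    have "Re (Z j * cnj \<tau>) = Re (z * cnj \<tau>) + 2 * pi * real (N j) * (norm \<tau>)\<^sup>2 - 2 * pi * real (M j) * b"
      unfolding Z_def b_def cmod_power2 by (simp add: power2_eq_square algebra_simps)
    also have "\<dots> = 2 * pi * (\<rho> + real (N j) * \<alpha> - real (M j)) * b"
      unfolding \<rho>b \<alpha>b by (simp add: algebra_simps)
    finally show ?thesis using b by (simp only: b_def) simp
  qed
  have Z_bd: "\<bar>Re (Z j * cnj \<tau>) / Im \<tau>\<bar> \<le> pi - 2 * pi * \<kappa>" for j
  proof -
    have "\<bar>Re (Z j * cnj \<tau>) / Im \<tau>\<bar> = 2 * pi * \<bar>\<rho> + real (N j) * \<alpha> - real (M j)\<bar>"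
      unfolding Z_strip by (simp add: abs_mult)
    also have "\<dots> \<le> 2 * pi * (1 / 2 - \<kappa>)" using NM[of j] by (intro mult_left_mono) auto
    finally show ?thesis by (simp add: algebra_simps)
  qed
  have ZS: "Z j \<in> stripS \<tau>" for j
  proof -
    have "\<bar>Re (Z j * cnj \<tau>)\<bar> / Im \<tau> \<le> pi - 2 * pi * \<kappa>" using Z_bd[of j] \<tau> by (simp add: abs_divide)
    also have "\<dots> < pi" using \<kappa>(1) by simp
    finally show ?thesis using \<tau> by (simp add: stripS_def pos_divide_less_eq)
  qed
  have N_lim: "filterlim N at_top sequentially"
    by (rule filterlim_at_top_mono[OF filterlim_Suc]) (use N in auto)
  have M_lim: "filterlim M at_top sequentially"
  proof -
    have "filterlim (\<lambda>j. real (N j)) at_top sequentially"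
      by (rule filterlim_compose[OF filterlim_real_sequentially N_lim])
    then have "filterlim (\<lambda>j. - 1 + real (N j) * \<alpha>) at_top sequentially"
      using \<open>\<alpha> > 0\<close> by (intro filterlim_tendsto_add_at_top[OF tendsto_const]
        filterlim_at_top_mult_tendsto_pos[OF tendsto_const])
    moreover have "- 1 + real (N j) * \<alpha> \<le> real (M j)" for j
      using NM[of j] \<rho> \<kappa>(1) by linarith
    ultimately have "filterlim (\<lambda>j. real (M j)) at_top sequentially"
      by (rule filterlim_at_top_mono[OF _ always_eventually[OF allI]])
    then show ?thesis by (simp add: filterlim_sequentially_iff_filterlim_real)
  qed
  have "(\<lambda>j. F_int (Z j) \<tau>) \<longlonglongrightarrow> 0"
  proof (rule F_int_tendsto_0[OF \<tau> _ Z_bd])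
    show "2 * pi * \<kappa> > 0" using \<kappa>(1) by simp
    show "Re (Z j) \<ge> - \<bar>Re z\<bar>" for j
    proof -
      have "0 \<le> 2 * pi * real (N j) * Re \<tau>" using a by simp
      then show ?thesis unfolding ReZ by linarith
    qed
    have "filterlim (\<lambda>j. real (N j)) at_top sequentially"
      by (rule filterlim_compose[OF filterlim_real_sequentially N_lim])
    then have "filterlim (\<lambda>j. Re z + (2 * pi * Re \<tau>) * real (N j)) at_top sequentially"
      using a by (intro filterlim_tendsto_add_at_top[OF tendsto_const]
        filterlim_tendsto_pos_mult_at_top[OF tendsto_const]) auto
    then show "filterlim (\<lambda>j. Re (Z j)) at_top sequentially"
      unfolding ReZ by (simp add: mult_ac)
  qed
  moreover have "(\<lambda>j. \<Sum>k<N j. 2 * of_real pi * \<i> / (1 + residue_exp1 \<tau> z k))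
      \<longlonglongrightarrow> (\<Sum>k. 2 * of_real pi * \<i> / (1 + residue_exp1 \<tau> z k))"
    using filterlim_compose[OF summable_LIMSEQ[OF summable_residue_parts(1)] N_lim] a by simp
  moreover have "(\<lambda>j. \<Sum>k<M j. 2 * of_real pi * inverse \<tau> / (1 + residue_exp2 \<tau> z k))
      \<longlonglongrightarrow> (\<Sum>k. 2 * of_real pi * inverse \<tau> / (1 + residue_exp2 \<tau> z k))"
    using filterlim_compose[OF summable_LIMSEQ[OF summable_residue_parts(2)] M_lim] a by simp
  ultimately have "(\<lambda>j. F_int (Z j) \<tau> + (\<Sum>k<N j. 2 * of_real pi * \<i> / (1 + residue_exp1 \<tau> z k))
      + (\<Sum>k<M j. 2 * of_real pi * inverse \<tau> / (1 + residue_exp2 \<tau> z k)))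
      \<longlonglongrightarrow> 0 + (\<Sum>k. 2 * of_real pi * \<i> / (1 + residue_exp1 \<tau> z k))
        + (\<Sum>k. 2 * of_real pi * inverse \<tau> / (1 + residue_exp2 \<tau> z k))"
    by (intro tendsto_add)
  moreover have "F_int (Z j) \<tau> + (\<Sum>k<N j. 2 * of_real pi * \<i> / (1 + residue_exp1 \<tau> z k))
      + (\<Sum>k<M j. 2 * of_real pi * inverse \<tau> / (1 + residue_exp2 \<tau> z k)) = F_int z \<tau>" for j
    unfolding Z_def
    by (rule F_int_shift_finite[symmetric, OF a \<tau> z _ ZS[unfolded Z_def] reg]) (use N[of j] in simp)
  ultimately have "F_int z \<tau> = (\<Sum>k. 2 * of_real pi * \<i> / (1 + residue_exp1 \<tau> z k))
        + (\<Sum>k. 2 * of_real pi * inverse \<tau> / (1 + residue_exp2 \<tau> z k))"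
    by (simp add: LIMSEQ_const_iff)
  also have "\<dots> = (\<Sum>k. residue_term \<tau> z k)"
    unfolding residue_term_def using a by (intro suminf_add summable_residue_parts) auto
  finally show ?thesis .
qed

lemma stripS_cnj: "cnj z \<in> stripS (- cnj \<tau>) \<longleftrightarrow> z \<in> stripS \<tau>"
proof -
  have R: "Re (cnj z * cnj (- cnj \<tau>)) = - Re (z * cnj \<tau>)" and I: "Im (- cnj \<tau>) = Im \<tau>" by simp_all
  show ?thesis unfolding stripS_def mem_Collect_eq R I abs_minus_cancel ..
qed

text \<open>The map \<open>\<tau> \<mapsto> - cnj \<tau>\<close> preserves the upper half plane and reverses the sign of \<open>Re \<tau>\<close>.\<close>

lemma F_int_cnj: "F_int (cnj z) (- cnj \<tau>) = cnj (F_int z \<tau>)"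
proof -
  have "F_kernel (cnj z) (- cnj \<tau>) x = cnj (F_kernel z \<tau> x)" for x
  proof -
    have "cnj z + \<i> * (- cnj \<tau>) * of_real x = cnj (z + \<i> * \<tau> * of_real x)" by simp
    then have e: "exp (cnj z + \<i> * (- cnj \<tau>) * of_real x) = cnj (exp (z + \<i> * \<tau> * of_real x))"
      by (simp only: exp_cnj)
    have x: "cnj (exp (of_real x)) = exp (of_real x)" by (simp only: exp_cnj complex_cnj_complex_of_real)
    show ?thesis
      by (simp only: e x complex_cnj_divide complex_cnj_mult complex_cnj_add complex_cnj_one)
  qed
  then have "F_int (cnj z) (- cnj \<tau>) = (LBINT x. cnj (F_kernel z \<tau> x))"
    unfolding F_int_def by (rule Bochner_Integration.integral_cong[OF refl])
  then show ?thesis unfolding F_int_def Bochner_Integration.integral_cnj .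
qed

lemma residue_exp1_cnj: "residue_exp1 (- cnj \<tau>) (cnj z) k = cnj (residue_exp1 \<tau> z k)"
  unfolding residue_exp1_def exp_cnj by (rule arg_cong[of _ _ exp]) (simp add: sgn_minus)

lemma residue_exp2_cnj: "residue_exp2 (- cnj \<tau>) (cnj z) k = cnj (residue_exp2 \<tau> z k)"
  unfolding residue_exp2_def exp_cnj by (rule arg_cong[of _ _ exp]) (simp add: sgn_minus)

lemma residue_term_cnj: "residue_term (- cnj \<tau>) (cnj z) k = - cnj (residue_term \<tau> z k)"
  by (simp add: residue_term_def residue_exp1_cnj residue_exp2_cnj)

theorem F_int_residue_series:
  assumes a: "Re \<tau> \<noteq> 0" and \<tau>: "Im \<tau> > 0" and z: "z \<in> stripS \<tau>" and reg: "residue_regular \<tau> z"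
  shows "F_int z \<tau> = of_real (sgn (Re \<tau>)) * (\<Sum>k. residue_term \<tau> z k)"
proof (cases "Re \<tau> > 0")
  case True
  then show ?thesis using F_int_residue_series_right[OF True \<tau> z reg] by simp
next
  case False
  then have a': "Re \<tau> < 0" using a by simp
  have "1 + cnj w \<noteq> 0 \<longleftrightarrow> 1 + w \<noteq> 0" for w :: complex
  proof -
    have "1 + cnj w = cnj (1 + w)" by simp
    then show ?thesis by (simp only: complex_cnj_zero_iff)
  qed
  then have reg': "residue_regular (- cnj \<tau>) (cnj z)"
    using reg unfolding residue_regular_def residue_exp1_cnj residue_exp2_cnj by simp
  have "cnj (F_int z \<tau>) = (\<Sum>k. residue_term (- cnj \<tau>) (cnj z) k)"
    unfolding F_int_cnj[symmetric]
    using a' \<tau> z reg' by (intro F_int_residue_series_right) (auto simp: stripS_cnj)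
  also have "\<dots> = - cnj (\<Sum>k. residue_term \<tau> z k)"
  proof (rule sums_unique[symmetric])
    have "(\<lambda>k. residue_term \<tau> z k) sums (\<Sum>k. residue_term \<tau> z k)"
      by (rule summable_sums[OF summable_residue_term[OF a]])
    then show "(\<lambda>k. residue_term (- cnj \<tau>) (cnj z) k) sums (- cnj (\<Sum>k. residue_term \<tau> z k))"
      unfolding residue_term_cnj by (intro sums_minus) (simp add: sums_cnj)
  qed
  also have "\<dots> = cnj (of_real (sgn (Re \<tau>)) * (\<Sum>k. residue_term \<tau> z k))"
    using a' by simp
  finally show ?thesis by (simp only: complex_cnj_cancel_iff)
qed

text \<open>Only finitely many \<open>k\<close> matter near \<open>z\<close>, since the real parts of the exponents tend to infinity, and
  for each of them the zeros in \<open>w\<close> are isolated.\<close>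

lemma eventually_one_plus_exp_nonzero:
  fixes \<beta> u v z :: complex
  assumes \<beta>: "\<beta> \<noteq> 0" and v: "Re v > 0"
  shows "\<forall>\<^sub>F w in at z. \<forall>k::nat. 1 + exp (\<beta> * w + u + of_nat k * v) \<noteq> 0"
proof -
  have "filterlim (\<lambda>k. (Re (\<beta> * z + u) - norm \<beta>) + real k * Re v) at_top sequentially"
    using v by (intro filterlim_tendsto_add_at_top[OF tendsto_const]
        filterlim_at_top_mult_tendsto_pos[OF tendsto_const _ filterlim_real_sequentially])
  then have "\<forall>\<^sub>F k in sequentially. (Re (\<beta> * z + u) - norm \<beta>) + real k * Re v > 0"
    by (simp add: filterlim_at_top_dense)
  then obtain K where K: "\<And>k. k \<ge> K \<Longrightarrow> (Re (\<beta> * z + u) - norm \<beta>) + real k * Re v > 0"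
    by (auto simp: eventually_sequentially)
  have "\<forall>\<^sub>F w in at z. \<forall>k\<in>{..<K}. 1 + exp (\<beta> * w + u + of_nat k * v) \<noteq> 0"
  proof (rule eventually_ball_finite, simp, rule ballI)
    fix k
    define e where "e = \<beta> * z + u + of_nat k * v"
    have e: "\<beta> * w + u + of_nat k * v = e + \<beta> * (w - z)" for w
      by (simp add: e_def algebra_simps)
    show "\<forall>\<^sub>F w in at z. 1 + exp (\<beta> * w + u + of_nat k * v) \<noteq> 0"
    proof (cases "1 + exp e = 0")
      case False
      have "((\<lambda>w. 1 + exp (e + \<beta> * (w - z))) \<longlongrightarrow> 1 + exp (e + \<beta> * (z - z))) (at z)"
        by (intro tendsto_intros)
      then show ?thesis unfolding e using False by (intro tendsto_imp_eventually_ne) auto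
    next
      case True
      have "\<forall>\<^sub>F w in at z. dist w z < 1 / norm \<beta>"
        using \<beta> by (intro eventually_at_ball[THEN eventually_mono, of "1 / norm \<beta>"]) (auto simp: dist_commute)
      then show ?thesis unfolding e using eventually_neq_at_within[of z z UNIV]
      proof eventually_elim
        case (elim w)
        show "1 + exp (e + \<beta> * (w - z)) \<noteq> 0"
        proof
          assume "1 + exp (e + \<beta> * (w - z)) = 0"
          then have "exp e * exp (\<beta> * (w - z)) = - 1" by (simp add: exp_add add_eq_0_iff)
          moreover have "exp e = - 1" using True by (simp add: add_eq_0_iff)
          ultimately have "exp (\<beta> * (w - z)) = 1" by simp
          then obtain n :: int where n: "Re (\<beta> * (w - z)) = 0" "Im (\<beta> * (w - z)) = of_int (2 * n) * pi"
            unfolding exp_eq_1 by blast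
          have lt: "norm (\<beta> * (w - z)) < 1"
            using elim(1) \<beta> by (simp add: norm_mult dist_norm pos_less_divide_eq mult.commute)
          have "\<bar>of_int (2 * n) * pi\<bar> \<le> norm (\<beta> * (w - z))"
            using abs_Im_le_cmod[of "\<beta> * (w - z)"] by (simp only: n)
          then have "real_of_int \<bar>2 * n\<bar> * pi < 1" using lt by (simp add: abs_mult)
          moreover have "real_of_int \<bar>2 * n\<bar> * 1 \<le> real_of_int \<bar>2 * n\<bar> * pi"
            using pi_gt3 by (intro mult_left_mono) auto
          ultimately have "\<bar>2 * n\<bar> < 1" by linarith
          then have "n = 0" by linarith
          then have "\<beta> * (w - z) = 0" using n by (simp add: complex_eq_iff)
          then show False using \<beta> elim(2) by simp
        qed
      qed
    qed
  qed
  moreover have "\<forall>\<^sub>F w in at z. dist w z < 1"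
    by (intro eventually_at_ball[THEN eventually_mono, of 1]) (auto simp: dist_commute)
  ultimately show ?thesis
  proof eventually_elim
    case (elim w)
    show ?case
    proof
      fix k
      show "1 + exp (\<beta> * w + u + of_nat k * v) \<noteq> 0"
      proof (cases "k < K")
        case False
        have "Re (\<beta> * (z - w)) \<le> norm \<beta> * norm (z - w)"
          using complex_Re_le_cmod[of "\<beta> * (z - w)"] by (simp add: norm_mult)
        also have "\<dots> \<le> norm \<beta> * 1" using elim(2) by (intro mult_left_mono) (auto simp: dist_norm norm_minus_commute)
        finally have "Re (\<beta> * z) - Re (\<beta> * w) \<le> norm \<beta>" by (simp only: right_diff_distrib minus_complex.simps mult_1_right)
        moreover have "(Re (\<beta> * z) + Re u - norm \<beta>) + real k * Re v > 0" using K[of k] False by simp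
        ultimately have "Re (\<beta> * w) + Re u + real k * Re v > 0" by linarith
        then have "Re (\<beta> * w + u + of_nat k * v) > 0" by simp
        then have "norm (exp (\<beta> * w + u + of_nat k * v)) > 1" by (simp only: norm_exp_eq_Re one_less_exp_iff)
        then show ?thesis by (metis add_eq_0_iff norm_minus_cancel norm_one order_less_irrefl)
      qed (use elim(1) in auto)
    qed
  qed
qed

lemma eventually_residue_regular:
  assumes "Re \<tau> \<noteq> 0"
  shows "\<forall>\<^sub>F w in at z. residue_regular \<tau> w"
proof -
  have "\<tau> \<noteq> 0" using assms by auto
  have "\<forall>\<^sub>F w in at z. \<forall>k. 1 + residue_exp1 \<tau> w k \<noteq> 0"
    unfolding residue_exp1_eq
    using eventually_one_plus_exp_nonzero[where \<beta> = 1, OF one_neq_zero Re_double_pos[OF Re_residue_steps_pos(1)[OF assms]]]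
    unfolding mult_1_left .
  moreover have "\<forall>\<^sub>F w in at z. \<forall>k. 1 + residue_exp2 \<tau> w k \<noteq> 0"
    unfolding residue_exp2_eq
    by (intro eventually_one_plus_exp_nonzero Re_double_pos Re_residue_steps_pos(2) assms)
      (use \<open>\<tau> \<noteq> 0\<close> in simp)
  ultimately show ?thesis
    by eventually_elim (simp add: residue_regular_def)
qed

lemma residue_series_tendsto:
  assumes a: "Re \<tau> \<noteq> 0" and \<tau>: "Im \<tau> > 0" and z: "z \<in> stripS \<tau>"
  shows "((\<lambda>w. of_real (sgn (Re \<tau>)) * (\<Sum>k. residue_term \<tau> w k)) \<longlongrightarrow> F_int z \<tau>) (at z)"
proof -
  have "(\<lambda>w. F_int w \<tau>) holomorphic_on stripS \<tau>"
    using \<tau> by (intro F_int_holomorphic_on open_stripS holomorphic_intros) auto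
  then have "continuous_on (stripS \<tau>) (\<lambda>w. F_int w \<tau>)" by (rule holomorphic_on_imp_continuous_on)
  then have "isCont (\<lambda>w. F_int w \<tau>) z" using z by (simp add: continuous_on_eq_continuous_at[OF open_stripS])
  then have "((\<lambda>w. F_int w \<tau>) \<longlongrightarrow> F_int z \<tau>) (at z)" by (simp only: isCont_def)
  moreover have "\<forall>\<^sub>F w in at z. w \<in> stripS \<tau>"
    by (rule eventually_at_in_open'[OF open_stripS z])
  then have "\<forall>\<^sub>F w in at z. F_int w \<tau> = of_real (sgn (Re \<tau>)) * (\<Sum>k. residue_term \<tau> w k)"
    using eventually_residue_regular[OF a]
    by eventually_elim (rule F_int_residue_series[OF a \<tau>])
  ultimately show ?thesis by (rule Lim_transform_eventually)
qed

section \<open>The Lambert series\<close>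

text \<open>The partial sum over \<open>k < K\<close> may be exchanged with the sum of the geometric series; the sum over \<open>k\<close> is
  then geometric too. The resulting error term is smaller by the factor \<open>q ^ K\<close>.\<close>

lemma lambert_series_sums:
  fixes r q :: complex
  assumes r: "norm r < 1" and q: "norm q < 1"
  defines "L \<equiv> \<lambda>j. (-1) ^ j * r ^ Suc j / (1 - q ^ Suc j)"
  shows "summable L" and "(\<lambda>k. r * q ^ k / (1 + r * q ^ k)) sums (\<Sum>j. L j)"
proof -
  have qj: "norm (q ^ Suc j) \<le> norm q" for j
    unfolding norm_power using q by (simp add: mult_left_le power_le_one)
  then have den: "1 - norm q \<le> norm (1 - q ^ Suc j)" for j
    using norm_triangle_ineq2[of 1 "q ^ Suc j"] qj[of j] unfolding norm_one by linarith
  have den0: "1 - q ^ Suc j \<noteq> 0" for j using den[of j] q by auto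
  have L_bd: "norm (L j) \<le> norm r ^ Suc j / (1 - norm q)" for j
    unfolding L_def norm_divide norm_mult norm_power using den[of j] q
    by (intro frac_le) (auto simp: norm_power)
  have sum_bd: "summable (\<lambda>j. norm r ^ Suc j / (1 - norm q))"
    using r by (intro summable_divide summable_ignore_initial_segment[of _ 1, simplified] summable_geometric) simp
  show L: "summable L" by (rule summable_comparison_test'[OF sum_bd L_bd])
  have Lq: "summable (\<lambda>j. L j * (q ^ Suc j) ^ K)" for K
  proof (rule summable_comparison_test'[OF sum_bd])
    fix j
    have "norm (L j * (q ^ Suc j) ^ K) \<le> norm (L j) * 1"
      unfolding norm_mult using qj[of j] q by (intro mult_left_mono) (auto simp: norm_power intro!: power_le_one mult_le_one)
    then show "norm (L j * (q ^ Suc j) ^ K) \<le> norm r ^ Suc j / (1 - norm q)" using L_bd[of j] by simp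
  qed
  have term_eq: "r * q ^ k / (1 + r * q ^ k) = (\<Sum>j. (-1) ^ j * (r * q ^ k) ^ Suc j)"
    and term_summable: "summable (\<lambda>j. (-1) ^ j * (r * q ^ k) ^ Suc j)" for k
  proof -
    have "norm (r * q ^ k) \<le> norm r * 1"
      unfolding norm_mult norm_power using q by (intro mult_left_mono power_le_one) auto
    then have lt: "norm (- (r * q ^ k)) < 1" using r by simp
    have "(\<lambda>j. (r * q ^ k) * (- (r * q ^ k)) ^ j) sums ((r * q ^ k) * (1 / (1 - - (r * q ^ k))))"
      by (intro sums_mult geometric_sums lt)
    also have "(\<lambda>j. (r * q ^ k) * (- (r * q ^ k)) ^ j) = (\<lambda>j. (-1) ^ j * (r * q ^ k) ^ Suc j)"
      by (intro ext) (simp add: power_minus[of "r * q ^ k"] mult_ac)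
    finally have "(\<lambda>j. (-1) ^ j * (r * q ^ k) ^ Suc j) sums (r * q ^ k / (1 + r * q ^ k))" by simp
    then show "r * q ^ k / (1 + r * q ^ k) = (\<Sum>j. (-1) ^ j * (r * q ^ k) ^ Suc j)"
      "summable (\<lambda>j. (-1) ^ j * (r * q ^ k) ^ Suc j)"
      by (auto simp: sums_iff)
  qed
  have partial: "(\<Sum>k<K. r * q ^ k / (1 + r * q ^ k)) = (\<Sum>j. L j) - (\<Sum>j. L j * (q ^ Suc j) ^ K)" for K
  proof -
    have "(\<Sum>k<K. r * q ^ k / (1 + r * q ^ k)) = (\<Sum>j. \<Sum>k<K. (-1) ^ j * (r * q ^ k) ^ Suc j)"
      unfolding term_eq using term_summable by (intro suminf_sum[symmetric])
    also have "\<dots> = (\<Sum>j. L j - L j * (q ^ Suc j) ^ K)"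
    proof (rule suminf_cong)
      fix j
      have "(\<Sum>k<K. (-1) ^ j * (r * q ^ k) ^ Suc j) = (-1) ^ j * r ^ Suc j * (\<Sum>k<K. (q ^ Suc j) ^ k)"
        unfolding sum_distrib_left
        by (intro sum.cong refl) (simp only: power_mult_distrib power_mult[symmetric] mult.commute[of "Suc j"] mult.assoc)
      also have "(\<Sum>k<K. (q ^ Suc j) ^ k) = (1 - (q ^ Suc j) ^ K) / (1 - q ^ Suc j)"
        using den0[of j] one_diff_power_eq[of "q ^ Suc j" K] by (simp only: nonzero_mult_div_cancel_left not_False_eq_True)
      finally show "(\<Sum>k<K. (-1) ^ j * (r * q ^ k) ^ Suc j) = L j - L j * (q ^ Suc j) ^ K"
        unfolding L_def by (simp only: times_divide_eq_right right_diff_distrib mult_1_right diff_divide_distrib times_divide_eq_left)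
    qed
    also have "\<dots> = (\<Sum>j. L j) - (\<Sum>j. L j * (q ^ Suc j) ^ K)"
      by (rule suminf_diff[symmetric, OF L Lq])
    finally show ?thesis .
  qed
  have "(\<lambda>K. \<Sum>j. L j * (q ^ Suc j) ^ K) \<longlonglongrightarrow> 0"
  proof (rule Lim_null_comparison)
    show "\<forall>\<^sub>F K in sequentially. norm (\<Sum>j. L j * (q ^ Suc j) ^ K) \<le> norm q ^ K * (\<Sum>j. norm r ^ Suc j / (1 - norm q))"
    proof (intro always_eventually allI)
      fix K
      have bd: "norm (L j * (q ^ Suc j) ^ K) \<le> norm q ^ K * (norm r ^ Suc j / (1 - norm q))" for j
      proof -
        have "norm (L j * (q ^ Suc j) ^ K) = norm (q ^ Suc j) ^ K * norm (L j)"
          by (simp only: norm_mult norm_power mult.commute)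
        also have "\<dots> \<le> norm q ^ K * (norm r ^ Suc j / (1 - norm q))"
          by (intro mult_mono L_bd power_mono qj) auto
        finally show ?thesis .
      qed
      have "norm (\<Sum>j. L j * (q ^ Suc j) ^ K) \<le> (\<Sum>j. norm q ^ K * (norm r ^ Suc j / (1 - norm q)))"
        by (rule norm_suminf_le[OF bd summable_mult[OF sum_bd]])
      also have "\<dots> = norm q ^ K * (\<Sum>j. norm r ^ Suc j / (1 - norm q))"
        by (rule suminf_mult[OF sum_bd])
      finally show "norm (\<Sum>j. L j * (q ^ Suc j) ^ K) \<le> norm q ^ K * (\<Sum>j. norm r ^ Suc j / (1 - norm q))" .
    qed
    show "(\<lambda>K. norm q ^ K * (\<Sum>j. norm r ^ Suc j / (1 - norm q))) \<longlonglongrightarrow> 0"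
      using q by (intro tendsto_mult_left_zero LIMSEQ_power_zero) simp
  qed
  then have "(\<lambda>K. (\<Sum>j. L j) - (\<Sum>j. L j * (q ^ Suc j) ^ K)) \<longlonglongrightarrow> (\<Sum>j. L j) - 0"
    by (intro tendsto_diff tendsto_const)
  then show "(\<lambda>k. r * q ^ k / (1 + r * q ^ k)) sums (\<Sum>j. L j)"
    unfolding sums_def partial by simp
qed

text \<open>The case \<open>r = exp (- z - \<delta> h)\<close>, \<open>q = exp (- 2 \<delta> h)\<close>. The sign \<open>\<delta>\<close>, which makes \<open>\<delta> h\<close> have positive
  real part, disappears from the coefficients up to an overall factor since \<open>sinh\<close> is odd.\<close>

lemma lambert_sinh_sums:
  fixes z h :: complex and \<delta> :: real
  assumes \<delta>: "\<delta> = 1 \<or> \<delta> = - 1" and h: "Re (of_real \<delta> * h) > 0" and z: "Re (z + of_real \<delta> * h) > 0"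
  defines "L \<equiv> \<lambda>j. (-1) ^ j * exp (- (of_nat (Suc j) * z)) / (2 * sinh (of_nat (Suc j) * h))"
  shows "summable L"
    and "(\<lambda>k. 1 / (1 + exp (z + of_real \<delta> * h + of_nat k * (2 * (of_real \<delta> * h))))) sums (of_real \<delta> * (\<Sum>j. L j))"
proof -
  define u where "u = z + of_real \<delta> * h"
  define v where "v = 2 * (of_real \<delta> * h)"
  define r where "r = exp (- u)"
  define q where "q = exp (- v)"
  have rq: "norm r < 1" "norm q < 1" using h z by (simp_all add: r_def q_def u_def v_def)
  have summand: "r * q ^ k / (1 + r * q ^ k) = 1 / (1 + exp (u + of_nat k * v))" for k
  proof -
    have "r * q ^ k = exp (- (u + of_nat k * v))"
      unfolding r_def q_def exp_of_nat_mult[symmetric] exp_add[symmetric] by (simp add: algebra_simps)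
    also have "\<dots> = inverse (exp (u + of_nat k * v))" by (rule exp_minus)
    finally have rq: "r * q ^ k = inverse (exp (u + of_nat k * v))" .
    show ?thesis unfolding rq by (simp add: divide_simps add.commute)
  qed
  have L: "(-1) ^ j * r ^ Suc j / (1 - q ^ Suc j) = of_real \<delta> * L j" for j
  proof -
    define n :: complex where "n = of_nat (Suc j)"
    have rn: "r ^ Suc j = exp (- (n * z)) * exp (- (of_real \<delta> * (n * h)))"
      unfolding r_def exp_of_nat_mult[symmetric] exp_add[symmetric] n_def u_def
      by (rule arg_cong[of _ _ exp]) (simp add: algebra_simps)
    have qn: "q ^ Suc j = exp (- (of_real \<delta> * (n * h))) * exp (- (of_real \<delta> * (n * h)))"
      unfolding q_def exp_of_nat_mult[symmetric] exp_add[symmetric] n_def v_def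
      by (rule arg_cong[of _ _ exp]) (simp add: algebra_simps)
    define e where "e = exp (of_real \<delta> * (n * h))"
    have e: "exp (- (of_real \<delta> * (n * h))) = inverse e" "e \<noteq> 0" by (simp_all add: e_def exp_minus)
    have sh: "2 * sinh (n * h) = of_real \<delta> * (e - inverse e)"
      using \<delta> by (auto simp: e_def sinh_field_def exp_minus)
    have "r ^ Suc j / (1 - q ^ Suc j) = exp (- (n * z)) * (inverse e / (1 - inverse e * inverse e))"
      unfolding rn qn e(1) by simp
    also have "inverse e / (1 - inverse e * inverse e) = 1 / (e - inverse e)"
    proof -
      have "1 - inverse e * inverse e = inverse e * (e - inverse e)" using e(2) by (simp add: algebra_simps)
      then show ?thesis using e(2) by simp
    qed
    also have "1 / (e - inverse e) = of_real \<delta> * (1 / (2 * sinh (n * h)))"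
      unfolding sh using \<delta> by auto
    finally have "r ^ Suc j / (1 - q ^ Suc j) = exp (- (n * z)) * (of_real \<delta> * (1 / (2 * sinh (n * h))))" .
    then show ?thesis
      unfolding L_def n_def[symmetric] times_divide_eq_right[symmetric] by (simp add: mult_ac)
  qed
  have "summable (\<lambda>j. of_real \<delta> * L j)"
    using lambert_series_sums(1)[OF rq] unfolding L .
  then show sL: "summable L" using \<delta> by (auto dest: summable_minus)
  have "(\<lambda>k. 1 / (1 + exp (u + of_nat k * v))) sums (\<Sum>j. of_real \<delta> * L j)"
    using lambert_series_sums(2)[OF rq] unfolding L summand .
  then show "(\<lambda>k. 1 / (1 + exp (z + of_real \<delta> * h + of_nat k * (2 * (of_real \<delta> * h))))) sums (of_real \<delta> * (\<Sum>j. L j))"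
    unfolding suminf_mult[OF sL] u_def v_def .
qed

lemma sgn_cases: "x \<noteq> 0 \<Longrightarrow> sgn x = 1 \<or> sgn x = - (1::real)"
  by (auto simp: sgn_if)

text \<open>This is what makes the second family of exponentials in the residue series larger than \<open>1\<close> for
  \<open>Re z > 0\<close>: with \<open>z = x + \<i> y\<close> and \<open>\<tau> = a + \<i> b\<close> it amounts to
  \<open>b (x b - y a) = x (a\<^sup>2 + b\<^sup>2) - a (x a + y b) > - \<pi> \<bar>a\<bar> b\<close>.\<close>

lemma stripS_lower_bound_rotated:
  assumes \<tau>: "Im \<tau> > 0" and z: "z \<in> stripS \<tau>" "Re z > 0"
  shows "Re (\<i> / \<tau> * z + of_real (pi * sgn (Re \<tau>)) / \<tau>) > 0"
proof -
  define a b x y where "a = Re \<tau>" and "b = Im \<tau>" and "x = Re z" and "y = Im z"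
  have b: "b > 0" and x: "x > 0" using assms by (simp_all add: b_def x_def)
  have D: "(norm \<tau>)\<^sup>2 > 0" using \<tau> by auto
  have s: "\<bar>x * a + y * b\<bar> < pi * b" using z by (simp add: stripS_def x_def y_def a_def b_def)
  have "\<i> / \<tau> * z + of_real (pi * sgn a) / \<tau> = (\<i> * z + of_real (pi * sgn a)) * cnj \<tau> / of_real ((norm \<tau>)\<^sup>2)"
    unfolding complex_norm_square using D by (simp add: field_simps)
  then have R: "Re (\<i> / \<tau> * z + of_real (pi * sgn a) / \<tau>) = (x * b - y * a + pi * \<bar>a\<bar>) / (norm \<tau>)\<^sup>2"
    by (simp only: Re_divide_of_real) (simp add: x_def y_def a_def b_def abs_sgn[of "Re \<tau>"] algebra_simps)
  have "- (\<bar>a\<bar> * (pi * b)) \<le> - (\<bar>a\<bar> * \<bar>x * a + y * b\<bar>)"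
    using s by (simp add: mult_left_mono)
  also have "\<dots> \<le> - (a * (x * a + y * b))" by (simp add: abs_mult[symmetric] flip: abs_mult)
  finally have "0 < x * (a * a + b * b) - a * (x * a + y * b) + \<bar>a\<bar> * (pi * b)"
    using x b mult_pos_pos[OF x, of "a * a + b * b"] by (smt (verit) mult_pos_pos zero_le_square)
  also have "\<dots> = b * (x * b - y * a + pi * \<bar>a\<bar>)" by (simp add: algebra_simps)
  finally have "x * b - y * a + pi * \<bar>a\<bar> > 0" using b by (simp add: zero_less_mult_iff)
  then show ?thesis using R D unfolding a_def by simp
qed

lemma one_plus_exp_nonzero_if_Re_pos: "Re w > 0 \<Longrightarrow> 1 + exp w \<noteq> 0"
proof
  assume "Re w > 0" "1 + exp w = 0"
  then have "norm (exp w) = norm (- 1 :: complex)" by (simp add: add_eq_0_iff)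
  then show False using \<open>Re w > 0\<close> by simp
qed

theorem F_int_lambert_series:
  assumes a: "Re \<tau> \<noteq> 0" and \<tau>: "Im \<tau> > 0" and z: "z \<in> stripS \<tau>" "Re z > 0"
  shows "summable (\<lambda>k. lambert_term \<tau> z (Suc k))"
    and "F_int z \<tau> = - of_real pi * \<i> * (\<Sum>k. lambert_term \<tau> z (Suc k))"
proof -
  define \<delta> where "\<delta> = sgn (Re \<tau>)"
  define h1 h2 where "h1 = of_real pi * \<tau>" and "h2 = of_real pi / \<tau>"
  have \<delta>: "\<delta> = 1 \<or> \<delta> = - 1" using sgn_cases[OF a] by (simp add: \<delta>_def)
  have \<tau>0: "\<tau> \<noteq> 0" using a by auto
  have h: "of_real (pi * sgn (Re \<tau>)) * \<tau> = of_real \<delta> * h1" "of_real (pi * sgn (Re \<tau>)) / \<tau> = of_real \<delta> * h2"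
    by (simp_all add: \<delta>_def h1_def h2_def)
  have hpos: "Re (of_real \<delta> * h1) > 0" "Re (of_real \<delta> * h2) > 0"
    using Re_residue_steps_pos[OF a] unfolding h .
  have zpos: "Re (z + of_real \<delta> * h1) > 0" using hpos(1) z(2) by simp
  have zpos2: "Re (\<i> / \<tau> * z + of_real \<delta> * h2) > 0"
    using stripS_lower_bound_rotated[OF \<tau> z] unfolding h .
  define L1 where "L1 = (\<lambda>j. (-1) ^ j * exp (- (of_nat (Suc j) * z)) / (2 * sinh (of_nat (Suc j) * h1)))"
  define L2 where "L2 = (\<lambda>j. (-1) ^ j * exp (- (of_nat (Suc j) * (\<i> / \<tau> * z))) / (2 * sinh (of_nat (Suc j) * h2)))"
  note s1 = lambert_sinh_sums[OF \<delta> hpos(1) zpos, folded L1_def]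
  note s2 = lambert_sinh_sums[OF \<delta> hpos(2) zpos2, folded L2_def]
  have E1: "residue_exp1 \<tau> z k = exp (z + of_real \<delta> * h1 + of_nat k * (2 * (of_real \<delta> * h1)))" for k
    unfolding residue_exp1_eq h ..
  have E2: "residue_exp2 \<tau> z k = exp (\<i> / \<tau> * z + of_real \<delta> * h2 + of_nat k * (2 * (of_real \<delta> * h2)))" for k
    unfolding residue_exp2_eq h ..
  have Re_step: "Re (u + of_nat k * (2 * v)) > 0" if "Re u > 0" "Re v > 0" for u v and k :: nat
    using that by (simp add: add_pos_nonneg)
  have reg: "residue_regular \<tau> z"
    unfolding residue_regular_def E1 E2
    using Re_step[OF zpos hpos(1)] Re_step[OF zpos2 hpos(2)] one_plus_exp_nonzero_if_Re_pos by blast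
  have "(\<lambda>k. 2 * of_real pi * \<i> * (1 / (1 + residue_exp1 \<tau> z k)) + 2 * of_real pi * inverse \<tau> * (1 / (1 + residue_exp2 \<tau> z k)))
      sums (2 * of_real pi * \<i> * (of_real \<delta> * (\<Sum>j. L1 j)) + 2 * of_real pi * inverse \<tau> * (of_real \<delta> * (\<Sum>j. L2 j)))"
    unfolding E1 E2 by (intro sums_add sums_mult s1(2) s2(2))
  then have "(\<Sum>k. residue_term \<tau> z k)
      = 2 * of_real pi * \<i> * (of_real \<delta> * (\<Sum>j. L1 j)) + 2 * of_real pi * inverse \<tau> * (of_real \<delta> * (\<Sum>j. L2 j))"
    unfolding residue_term_def times_divide_eq_right mult_1_right by (rule sums_unique[symmetric])
  then have "F_int z \<tau> = of_real \<delta> * (2 * of_real pi * \<i> * (of_real \<delta> * (\<Sum>j. L1 j)) + 2 * of_real pi * inverse \<tau> * (of_real \<delta> * (\<Sum>j. L2 j)))"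
    using F_int_residue_series[OF a \<tau> z(1) reg] by (simp only: \<delta>_def)
  also have "\<dots> = 2 * of_real pi * \<i> * (\<Sum>j. L1 j) + 2 * of_real pi * inverse \<tau> * (\<Sum>j. L2 j)"
    using \<delta> by (elim disjE) simp_all
  finally have F: "F_int z \<tau> = 2 * of_real pi * \<i> * (\<Sum>j. L1 j) + 2 * of_real pi * inverse \<tau> * (\<Sum>j. L2 j)" .
  have lam: "lambert_term \<tau> z (Suc j) = - 2 * L1 j + 2 * \<i> * inverse \<tau> * L2 j" for j
  proof -
    define n :: complex where "n = of_nat (Suc j)"
    have n: "of_real pi * n * \<tau> = n * h1" "of_real pi * n / \<tau> = n * h2" "\<i> * n * z / \<tau> = n * (\<i> / \<tau> * z)"
      by (simp_all add: h1_def h2_def)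
    show ?thesis
      unfolding lambert_term_def L1_def L2_def n_def[symmetric] n inverse_eq_divide
      by (simp add: right_diff_distrib)
  qed
  have "(\<lambda>j. - 2 * L1 j + 2 * \<i> * inverse \<tau> * L2 j) sums (- 2 * (\<Sum>j. L1 j) + 2 * \<i> * inverse \<tau> * (\<Sum>j. L2 j))"
    by (intro sums_add sums_mult summable_sums s1(1) s2(1))
  then have S: "(\<lambda>k. lambert_term \<tau> z (Suc k)) sums (- 2 * (\<Sum>j. L1 j) + 2 * \<i> * inverse \<tau> * (\<Sum>j. L2 j))"
    unfolding lam .
  then show "summable (\<lambda>k. lambert_term \<tau> z (Suc k))" by (rule sums_summable)
  have eqS: "(\<Sum>k. lambert_term \<tau> z (Suc k)) = - 2 * (\<Sum>j. L1 j) + 2 * \<i> * inverse \<tau> * (\<Sum>j. L2 j)"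
    using S by (rule sums_unique[symmetric])
  show "F_int z \<tau> = - of_real pi * \<i> * (\<Sum>k. lambert_term \<tau> z (Suc k))"
    unfolding F eqS by (simp add: algebra_simps)
qed

section \<open>The properties of the integral\<close>

theorem theorem1:
  fixes \<tau> :: complex
  assumes "Im \<tau> > 0"
  shows
    "(\<forall>z \<in> regionP \<tau>. F_int z \<tau> = \<i> / \<tau> * F_int (\<i> * z / \<tau>) (- (1 / \<tau>)))
   \<and> (\<forall>z \<in> stripS \<tau>. \<forall>n::nat. n \<ge> 2 \<longrightarrow>
        F_int z (of_nat n * \<tau>) =
          1 / of_nat n * (\<Sum>k = 0..n - 1.
             F_int (1 / of_nat n *
               (z + of_real pi * \<i> * (of_nat n - 2 * of_nat k - 1))) \<tau>))
   \<and> (\<forall>z \<in> regionP \<tau>. \<forall>\<epsilon>::real.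
        0 < \<epsilon> \<and> \<epsilon> < min (pi / 2) (Im (- (of_real pi / (2 * \<tau>)))) \<longrightarrow>
        integrable lborel (\<lambda>t::real. sinh_integrand \<tau> z (of_real t + \<i> * of_real \<epsilon>)) \<and>
        F_int z \<tau> = 1 / 2 * (LBINT t. sinh_integrand \<tau> z (of_real t + \<i> * of_real \<epsilon>)))
   \<and> (\<forall>z \<in> stripS \<tau> \<inter> uminus ` stripS \<tau>. F_int z \<tau> = F_int (- z) \<tau> - \<i> * z / \<tau>)
   \<and> (Re \<tau> \<noteq> 0 \<longrightarrow> (\<forall>z \<in> stripS \<tau>.
        (residue_regular \<tau> z \<longrightarrow>
           summable (residue_term \<tau> z) \<and>
           F_int z \<tau> = of_real (sgn (Re \<tau>)) * (\<Sum>k. residue_term \<tau> z k)) \<and>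
        (\<forall>\<^sub>F w in at z. residue_regular \<tau> w) \<and>
        ((\<lambda>w. of_real (sgn (Re \<tau>)) * (\<Sum>k. residue_term \<tau> w k)) \<longlongrightarrow> F_int z \<tau>) (at z)))
   \<and> (Re \<tau> \<noteq> 0 \<longrightarrow> (\<forall>z \<in> stripS \<tau> \<inter> {z. Re z > 0}.
        summable (\<lambda>k. lambert_term \<tau> z (Suc k)) \<and>
        F_int z \<tau> = - of_real pi * \<i> * (\<Sum>k. lambert_term \<tau> z (Suc k))))"
proof (intro conjI ballI allI impI)
  fix z assume "z \<in> regionP \<tau>"
  then show "F_int z \<tau> = \<i> / \<tau> * F_int (\<i> * z / \<tau>) (- (1 / \<tau>))"
    by (rule F_int_inversion[OF assms])
next
  fix z and n :: nat
  assume "z \<in> stripS \<tau>" "2 \<le> n"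
  then show "F_int z (of_nat n * \<tau>) =
          1 / of_nat n * (\<Sum>k = 0..n - 1.
             F_int (1 / of_nat n *
               (z + of_real pi * \<i> * (of_nat n - 2 * of_nat k - 1))) \<tau>)"
    by (intro F_int_multiplication assms) auto
next
  fix z and \<epsilon> :: real
  assume z: "z \<in> regionP \<tau>" and \<epsilon>: "0 < \<epsilon> \<and> \<epsilon> < min (pi / 2) (Im (- (of_real pi / (2 * \<tau>))))"
  have \<epsilon>': "0 < \<epsilon>" "\<epsilon> < pi" "2 * \<epsilon> * (norm \<tau>)\<^sup>2 < pi * Im \<tau>"
    using \<epsilon> bound_from_Im_inverse[OF assms, of \<epsilon>] by auto
  show "integrable lborel (\<lambda>t::real. sinh_integrand \<tau> z (of_real t + \<i> * of_real \<epsilon>))"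
    by (rule F_int_sinh_representation(1)[OF assms z \<epsilon>'])
  show "F_int z \<tau> = 1 / 2 * (LBINT t. sinh_integrand \<tau> z (of_real t + \<i> * of_real \<epsilon>))"
    by (rule F_int_sinh_representation(2)[OF assms z \<epsilon>'])
next
  fix z assume "z \<in> stripS \<tau> \<inter> uminus ` stripS \<tau>"
  then show "F_int z \<tau> = F_int (- z) \<tau> - \<i> * z / \<tau>"
    by (intro F_int_reflection assms) auto
next
  fix z assume a: "Re \<tau> \<noteq> 0" and z: "z \<in> stripS \<tau>" and reg: "residue_regular \<tau> z"
  show "summable (residue_term \<tau> z)" by (rule summable_residue_term[OF a])
  show "F_int z \<tau> = of_real (sgn (Re \<tau>)) * (\<Sum>k. residue_term \<tau> z k)"
    by (rule F_int_residue_series[OF a assms z reg])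
next
  fix z assume a: "Re \<tau> \<noteq> 0" and z: "z \<in> stripS \<tau>"
  show "\<forall>\<^sub>F w in at z. residue_regular \<tau> w" by (rule eventually_residue_regular[OF a])
  show "((\<lambda>w. of_real (sgn (Re \<tau>)) * (\<Sum>k. residue_term \<tau> w k)) \<longlongrightarrow> F_int z \<tau>) (at z)"
    by (rule residue_series_tendsto[OF a assms z])
next
  fix z assume a: "Re \<tau> \<noteq> 0" and z: "z \<in> stripS \<tau> \<inter> {z. Re z > 0}"
  then have z': "z \<in> stripS \<tau>" "Re z > 0" by auto
  show "summable (\<lambda>k. lambert_term \<tau> z (Suc k))"
    by (rule F_int_lambert_series(1)[OF a assms z'])
  show "F_int z \<tau> = - of_real pi * \<i> * (\<Sum>k. lambert_term \<tau> z (Suc k))"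
    by (rule F_int_lambert_series(2)[OF a assms z'])
qed

end
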